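(* Let $p$ be a prime and let $G$ be a finitely generated virtually free group. Then the left $\mathbb{F}_p[G]$-module $\mathbb{F}_p[[\widehat{G}]]$ is isomorphic to a direct union of free left $\mathbb{F}_p[G]$-modules.
   Context: $\widehat{G}$ is the profinite completion of $G$, and $\mathbb{F}_p[[\widehat{G}]]=\varprojlim_N\mathbb{F}_p[G/N]$ is the completed group ring, where $N$ ranges over the normal subgroups of finite index in $G$; it is a left $\mathbb{F}_p[G]$-module via the natural map $\mathbb{F}_p[G]\to\mathbb{F}_p[[\widehat{G}]]$. A direct union of modules is the union of a family of submodules that is directed with respect to inclusion. *)

theory Defs
  imports "HOL-Algebra.Generated_Groups" "HOL-Algebra.Module" "HOL-Number_Theory.Residues"
begin

section \<open>Finitely generated, free and virtually free groups\<close>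

definition finitely_generated_group :: "('a, 'b) monoid_scheme \<Rightarrow> bool" where
  "finitely_generated_group G \<longleftrightarrow>
     group G \<and> (\<exists>S. finite S \<and> S \<subseteq> carrier G \<and> generate G S = carrier G)"

text \<open>A letter \<open>(x, True)\<close> stands for \<open>x\<close> and a letter \<open>(x, False)\<close> for the inverse of \<open>x\<close>.\<close>

definition reduced_words :: "'a set \<Rightarrow> ('a \<times> bool) list set" where
  "reduced_words B =
     {w. fst ` set w \<subseteq> B \<and> successively (\<lambda>(x, a) (y, b). x = y \<longrightarrow> a = b) w}"

definition eval_word :: "('a, 'b) monoid_scheme \<Rightarrow> ('a \<times> bool) list \<Rightarrow> 'a" where
  "eval_word G w =
     foldr (\<lambda>(x, a) y. (if a then x else inv\<^bsub>G\<^esub> x) \<otimes>\<^bsub>G\<^esub> y) w \<one>\<^bsub>G\<^esub>"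

text \<open>A group is free on \<open>B\<close> if each of its elements is the value of exactly one reduced word
  over \<open>B\<close>. The basis may be empty or infinite.\<close>

definition freely_generates :: "('a, 'b) monoid_scheme \<Rightarrow> 'a set \<Rightarrow> bool" where
  "freely_generates G B \<longleftrightarrow>
     B \<subseteq> carrier G \<and> bij_betw (eval_word G) (reduced_words B) (carrier G)"

definition free_group :: "('a, 'b) monoid_scheme \<Rightarrow> bool" where
  "free_group G \<longleftrightarrow> group G \<and> (\<exists>B. freely_generates G B)"

definition virtually_free_group :: "('a, 'b) monoid_scheme \<Rightarrow> bool" where
  "virtually_free_group G \<longleftrightarrow>
     group G \<and>
     (\<exists>F. subgroup F G \<and> finite (rcosets\<^bsub>G\<^esub> F) \<and> free_group (G\<lparr>carrier := F\<rparr>))"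


section \<open>Group rings\<close>

text \<open>Elements are finitely supported functions on the group, normalised by \<open>extensional\<close> outside
  its carrier; the product is convolution.\<close>

definition group_ring ::
    "('k, 'c) ring_scheme \<Rightarrow> ('a, 'b) monoid_scheme \<Rightarrow> ('a \<Rightarrow> 'k) ring" where
  "group_ring K G =
     \<lparr>carrier = {f \<in> carrier G \<rightarrow>\<^sub>E carrier K. finite {x \<in> carrier G. f x \<noteq> \<zero>\<^bsub>K\<^esub>}},
      monoid.mult = (\<lambda>f g. \<lambda>x\<in>carrier G.
        \<Oplus>\<^bsub>K\<^esub>y\<in>{y \<in> carrier G. f y \<noteq> \<zero>\<^bsub>K\<^esub>}. f y \<otimes>\<^bsub>K\<^esub> g (inv\<^bsub>G\<^esub> y \<otimes>\<^bsub>G\<^esub> x)),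
      one = (\<lambda>x\<in>carrier G. if x = \<one>\<^bsub>G\<^esub> then \<one>\<^bsub>K\<^esub> else \<zero>\<^bsub>K\<^esub>),
      zero = (\<lambda>x\<in>carrier G. \<zero>\<^bsub>K\<^esub>),
      add = (\<lambda>f g. \<lambda>x\<in>carrier G. f x \<oplus>\<^bsub>K\<^esub> g x)\<rparr>"

text \<open>The \<open>K\<close>-linear extension of a map \<open>\<phi>\<close> from (the carrier of) \<open>G\<close> to \<open>H\<close>.\<close>

definition group_ring_map ::
    "('k, 'c) ring_scheme \<Rightarrow> ('a, 'b) monoid_scheme \<Rightarrow> ('h, 'd) monoid_scheme \<Rightarrow>
     ('a \<Rightarrow> 'h) \<Rightarrow> ('a \<Rightarrow> 'k) \<Rightarrow> 'h \<Rightarrow> 'k" where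
  "group_ring_map K G H \<phi> f =
     (\<lambda>h\<in>carrier H. \<Oplus>\<^bsub>K\<^esub>x\<in>{x \<in> carrier G. f x \<noteq> \<zero>\<^bsub>K\<^esub> \<and> \<phi> x = h}. f x)"


section \<open>The completed group ring\<close>

definition finite_index_normal :: "('a, 'b) monoid_scheme \<Rightarrow> 'a set set" where
  "finite_index_normal G = {N. N \<lhd> G \<and> finite (rcosets\<^bsub>G\<^esub> N)}"

text \<open>The inverse limit of the rings \<open>K[G/N]\<close>, realised as the ring of compatible families.
  For \<open>N \<subseteq> M\<close> the projection from \<open>G/N\<close> to \<open>G/M\<close> maps a coset \<open>C\<close> to \<open>M <#> C\<close>.\<close>

definition completed_group_ring ::
    "('k, 'c) ring_scheme \<Rightarrow> ('a, 'b) monoid_scheme \<Rightarrow> ('a set \<Rightarrow> 'a set \<Rightarrow> 'k) ring" where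
  "completed_group_ring K G =
     \<lparr>carrier = {u \<in> (\<Pi>\<^sub>E N\<in>finite_index_normal G. carrier (group_ring K (G Mod N))).
        \<forall>N\<in>finite_index_normal G. \<forall>M\<in>finite_index_normal G. N \<subseteq> M \<longrightarrow>
          group_ring_map K (G Mod N) (G Mod M) (\<lambda>C. M <#>\<^bsub>G\<^esub> C) (u N) = u M},
      monoid.mult = (\<lambda>u v. \<lambda>N\<in>finite_index_normal G. u N \<otimes>\<^bsub>group_ring K (G Mod N)\<^esub> v N),
      one = (\<lambda>N\<in>finite_index_normal G. \<one>\<^bsub>group_ring K (G Mod N)\<^esub>),
      zero = (\<lambda>N\<in>finite_index_normal G. \<zero>\<^bsub>group_ring K (G Mod N)\<^esub>),
      add = (\<lambda>u v. \<lambda>N\<in>finite_index_normal G. u N \<oplus>\<^bsub>group_ring K (G Mod N)\<^esub> v N)\<rparr>"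

definition to_completed_group_ring ::
    "('k, 'c) ring_scheme \<Rightarrow> ('a, 'b) monoid_scheme \<Rightarrow>
     ('a \<Rightarrow> 'k) \<Rightarrow> 'a set \<Rightarrow> 'a set \<Rightarrow> 'k" where
  "to_completed_group_ring K G f =
     (\<lambda>N\<in>finite_index_normal G. group_ring_map K G (G Mod N) (\<lambda>x. N #>\<^bsub>G\<^esub> x) f)"


section \<open>Left modules over rings that need not be commutative\<close>

text \<open>The locale \<open>module\<close> of HOL-Algebra requires a commutative ring of scalars; its record type and
  the locale \<open>submodule\<close> do not depend on this and are used here. As there, the fields \<open>mult\<close> and
  \<open>one\<close> of a module record carry no meaning.\<close>

locale left_module = R?: ring R + M?: abelian_group M
  for R :: "('r, 'c) ring_scheme" (structure) and M :: "('r, 'm, 'd) module_scheme" (structure) +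
  assumes smult_closed:
      "\<lbrakk>a \<in> carrier R; x \<in> carrier M\<rbrakk> \<Longrightarrow> a \<odot>\<^bsub>M\<^esub> x \<in> carrier M"
    and smult_l_distr:
      "\<lbrakk>a \<in> carrier R; b \<in> carrier R; x \<in> carrier M\<rbrakk> \<Longrightarrow>
        (a \<oplus>\<^bsub>R\<^esub> b) \<odot>\<^bsub>M\<^esub> x = a \<odot>\<^bsub>M\<^esub> x \<oplus>\<^bsub>M\<^esub> b \<odot>\<^bsub>M\<^esub> x"
    and smult_r_distr:
      "\<lbrakk>a \<in> carrier R; x \<in> carrier M; y \<in> carrier M\<rbrakk> \<Longrightarrow>
        a \<odot>\<^bsub>M\<^esub> (x \<oplus>\<^bsub>M\<^esub> y) = a \<odot>\<^bsub>M\<^esub> x \<oplus>\<^bsub>M\<^esub> a \<odot>\<^bsub>M\<^esub> y"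
    and smult_assoc:
      "\<lbrakk>a \<in> carrier R; b \<in> carrier R; x \<in> carrier M\<rbrakk> \<Longrightarrow>
        (a \<otimes>\<^bsub>R\<^esub> b) \<odot>\<^bsub>M\<^esub> x = a \<odot>\<^bsub>M\<^esub> (b \<odot>\<^bsub>M\<^esub> x)"
    and smult_one:
      "x \<in> carrier M \<Longrightarrow> \<one>\<^bsub>R\<^esub> \<odot>\<^bsub>M\<^esub> x = x"

definition left_module_basis ::
    "('r, 'c) ring_scheme \<Rightarrow> ('r, 'm, 'd) module_scheme \<Rightarrow> 'm set \<Rightarrow> bool" where
  "left_module_basis R M B \<longleftrightarrow>
     B \<subseteq> carrier M \<and>
     (\<forall>x\<in>carrier M. \<exists>!c. c \<in> B \<rightarrow>\<^sub>E carrier R \<and> finite {b \<in> B. c b \<noteq> \<zero>\<^bsub>R\<^esub>} \<and>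
        x = (\<Oplus>\<^bsub>M\<^esub>b\<in>{b \<in> B. c b \<noteq> \<zero>\<^bsub>R\<^esub>}. c b \<odot>\<^bsub>M\<^esub> b))"

definition free_left_module ::
    "('r, 'c) ring_scheme \<Rightarrow> ('r, 'm, 'd) module_scheme \<Rightarrow> bool" where
  "free_left_module R M \<longleftrightarrow> left_module R M \<and> (\<exists>B. left_module_basis R M B)"

definition direct_union_of_free_left_modules ::
    "('r, 'c) ring_scheme \<Rightarrow> ('r, 'm, 'd) module_scheme \<Rightarrow> bool" where
  "direct_union_of_free_left_modules R M \<longleftrightarrow>
     left_module R M \<and>
     (\<exists>\<U>. \<U> \<noteq> {} \<and>
        (\<forall>U\<in>\<U>. submodule U R M \<and> free_left_module R (M\<lparr>carrier := U\<rparr>)) \<and>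
        (\<forall>U\<in>\<U>. \<forall>V\<in>\<U>. \<exists>W\<in>\<U>. U \<subseteq> W \<and> V \<subseteq> W) \<and>
        \<Union>\<U> = carrier M)"

definition left_module_isomorphic ::
    "('r, 'c) ring_scheme \<Rightarrow> ('r, 'm, 'd) module_scheme \<Rightarrow> ('r, 'n, 'e) module_scheme \<Rightarrow> bool" where
  "left_module_isomorphic R M N \<longleftrightarrow>
     (\<exists>h. bij_betw h (carrier M) (carrier N) \<and>
        (\<forall>x\<in>carrier M. \<forall>y\<in>carrier M. h (x \<oplus>\<^bsub>M\<^esub> y) = h x \<oplus>\<^bsub>N\<^esub> h y) \<and>
        (\<forall>a\<in>carrier R. \<forall>x\<in>carrier M. h (a \<odot>\<^bsub>M\<^esub> x) = a \<odot>\<^bsub>N\<^esub> h x))"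

definition completed_group_ring_module ::
    "('k, 'c) ring_scheme \<Rightarrow> ('a, 'b) monoid_scheme \<Rightarrow>
     ('a \<Rightarrow> 'k, 'a set \<Rightarrow> 'a set \<Rightarrow> 'k) module" where
  "completed_group_ring_module K G =
     ring.extend (completed_group_ring K G)
       (module.fields
         (\<lambda>f u. to_completed_group_ring K G f \<otimes>\<^bsub>completed_group_ring K G\<^esub> u))"

end

theory Submission
  imports Defs
begin

text \<open>Let \<open>F\<close> be a free subgroup of finite index in \<open>G\<close> with basis \<open>B\<close>. The completed group ring is itself the
  direct union: it suffices that every finite set of its elements lies in a submodule with a finite
  basis (\<open>ex_independent\<close>), because such submodules then form a directed family that covers the
  whole module.

  An element of the completed group ring is a finitely additive measure with values in the prime
  field on the clopen subsets of \<open>G\<close>, the finite unions of cosets of normal subgroups of finite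
  index (\<open>mass\<close>, \<open>family\<close>). Restricting measures to the left cosets of \<open>F\<close> decomposes the module
  into translates of the submodule \<open>on_F\<close> of the measures concentrated on \<open>F\<close>, and subsets of
  \<open>on_F\<close> that are independent over the group ring of \<open>F\<close> are independent over that of \<open>G\<close>
  (\<open>independent_F_imp_independent\<close>). So one has to find, for a finite subset of \<open>on_F\<close>, a finite
  independent set over the group ring of \<open>F\<close> whose span contains it.

  A set \<open>X\<close> of least cardinality with this span property is independent, for the following reason.
  Suppose that \<open>\<Sum> c\<^sub>b b = 0\<close>. Let \<open>T\<close> be a finite set of elements of \<open>F\<close> that contains the supports
  of the \<open>c\<^sub>b\<close> and is closed under suffixes of reduced words, and let \<open>W\<close> be the finite group of all
  combinations of \<open>X\<close> with coefficients supported on \<open>T\<close>. It carries a partial action of the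
  letters: \<open>s\<close> sends \<open>w\<close> to \<open>s w\<close> if both lie in \<open>W\<close>. A nonzero finite group of measures in
  \<open>on_F\<close> behaves like a finite tree: it has a leaf, that is a proper subgroup that contains
  \<open>W \<inter> s W\<close> for all letters \<open>s\<close> but one (\<open>leaf\<close>). Removing leaves one after the other yields a set
  \<open>X' \<subseteq> W\<close> that generates \<open>W\<close> and on which a partially equivariant map on \<open>W\<close> may be prescribed
  arbitrarily (\<open>partial_basis\<close>). Take as target the finite module of functions on \<open>T\<close>, on which the
  letters act through permutations of \<open>T\<close> that extend left multiplication as far as it stays in
  \<open>T\<close>. A partially equivariant map on \<open>W\<close> is determined by its values on \<open>X\<close>, so counting maps
  gives \<open>|X'| \<le> |X|\<close>, while the choice of \<open>X\<close> gives the opposite inequality. Hence the values on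
  \<open>X\<close> may be prescribed as well, and sending one \<open>b\<close> to the indicator function of the unit and the
  other elements of \<open>X\<close> to 0 turns the relation into \<open>c\<^sub>b = 0\<close>.

  Leaves exist because of a flow argument. If \<open>W\<close> has no leaf, then for every letter \<open>e\<close> the groups
  \<open>W \<inter> s W\<close> with \<open>s \<noteq> e\<close> already generate \<open>W\<close>. For \<open>w \<in> W\<close> and a clopen set \<open>A\<close> consider flows
  along the edges of the Cayley tree of \<open>F\<close>, with values in the groups \<open>W \<inter> s W\<close>, whose total at
  a vertex \<open>g\<close> is \<open>w\<close> if \<open>g \<in> A\<close> and 0 otherwise. The condition at a vertex can be solved with any
  prescribed value on one edge, always with the same number of solutions. So the finite set of all
  solutions, over all cosets of a suitable normal subgroup, can be permuted compatibly with the
  edges, with one permutation for each basis element, and since \<open>F\<close> is free these permutations define an action of \<open>F\<close>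
  (\<open>ex_flow_permutations\<close>). An orbit of this action is a flow that is constant on the cosets of a
  normal subgroup of finite index. Evaluating the values of the flow, which are measures, on these
  cosets and adding up gives \<open>w(A)\<close>, but the two ends of every edge cancel; hence \<open>w = 0\<close>
  (\<open>core_mass_zero\<close>).\<close>

section \<open>Additive maps on subgroups of p-torsion groups\<close>

text \<open>As in \<open>eval_word\<close>, a letter is a generator together with a sign; \<open>flip\<close> is formal inversion.\<close>

definition flip :: "'b \<times> bool \<Rightarrow> 'b \<times> bool" where
  "flip s = (fst s, \<not> snd s)"

lemma flip_flip [simp]: "flip (flip s) = s" by (simp add: flip_def)
lemma flip_neq [simp]: "flip s \<noteq> s" by (cases s) (simp add: flip_def)
lemma flip_pair [simp]: "flip (x, b) = (x, \<not> b)" by (simp add: flip_def)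

locale torsion_group = abelian_group M for M (structure) +
  fixes p :: nat
  assumes prime_p: "prime p"
    and torsion: "x \<in> carrier M \<Longrightarrow> [p] \<cdot> x = \<zero>"
begin

lemma mult_mod: "x \<in> carrier M \<Longrightarrow> [(k mod p)] \<cdot> x = [k] \<cdot> x"
proof -
  assume x: "x \<in> carrier M"
  have "[k] \<cdot> x = [((k div p) * p + k mod p)] \<cdot> x" by simp
  also have "\<dots> = [((k div p) * p)] \<cdot> x \<oplus> [(k mod p)] \<cdot> x"
    using x by (metis add.nat_pow_mult)
  also have "[((k div p) * p)] \<cdot> x = [(k div p)] \<cdot> ([p] \<cdot> x)"
    using x by (metis add.nat_pow_pow mult.commute)
  also have "\<dots> = \<zero>" using x torsion by simp
  finally show ?thesis using x by simp
qed

text \<open>Closure under addition suffices because \<open>- x\<close> is the multiple \<open>(p - 1) x\<close>.\<close>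

lemma additive_subgroup_intro:
  assumes "V \<subseteq> carrier M" "\<zero> \<in> V" and cl: "\<And>x y. x \<in> V \<Longrightarrow> y \<in> V \<Longrightarrow> x \<oplus> y \<in> V"
  shows "additive_subgroup V M"
proof -
  have mult: "[k] \<cdot> x \<in> V" if "x \<in> V" for k :: nat and x
    using that assms by (induct k) auto
  have "\<ominus> x \<in> V" if x: "x \<in> V" for x
  proof -
    have xc: "x \<in> carrier M" using x assms by auto
    have "p > 0" using prime_p prime_gt_0_nat by blast
    then have "Suc (p - 1) = p" by simp
    then have "[(p - 1)] \<cdot> x \<oplus> x = \<zero>" using xc torsion by (metis add.nat_pow_Suc)
    then have "\<ominus> x = [(p - 1)] \<cdot> x" using xc by (simp add: minus_equality)
    then show ?thesis using mult[OF x] by simp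
  qed
  then show ?thesis
    using assms by (intro additive_subgroupI add.subgroupI) auto
qed

text \<open>The factor \<open>k\<close> is invertible modulo \<open>p\<close>.\<close>

lemma multiple_in_subgroup:
  assumes V: "additive_subgroup V M" and w: "w \<in> carrier M" and k: "[k] \<cdot> w \<in> V" "0 < k" "k < p"
  shows "w \<in> V"
proof -
  have "\<not> p dvd k" using k by (auto dest: dvd_imp_le)
  then have "coprime k p" using prime_p by (metis coprime_commute prime_imp_coprime)
  then obtain m where m: "[k * m = 1] (mod p)" using cong_solve_coprime_nat[of k p] by auto
  have cl: "[m] \<cdot> x \<in> V" if "x \<in> V" for x and m :: nat
    using that additive_subgroup.zero_closed[OF V] additive_subgroup.a_closed[OF V]
      additive_subgroup.a_subset[OF V]
    by (induct m) (auto simp: subset_iff)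
  have "w = [(k * m)] \<cdot> w"
    using m mult_mod[OF w, of "k*m"] mult_mod[OF w, of 1] w by (simp add: cong_def)
  also have "\<dots> = [m] \<cdot> ([k] \<cdot> w)" using w by (simp add: add.nat_pow_pow)
  finally show ?thesis using cl[OF k(1)] by metis
qed

definition adjoin :: "'a set \<Rightarrow> 'a \<Rightarrow> 'a set" where
  "adjoin V w = {v \<oplus> [k] \<cdot> w | v (k::nat). v \<in> V}"

lemma adjoin_subgroup:
  assumes V: "additive_subgroup V M" and w: "w \<in> carrier M"
  shows "additive_subgroup (adjoin V w) M"
proof (rule additive_subgroup_intro)
  have s: "V \<subseteq> carrier M" using additive_subgroup.a_subset[OF V] .
  show "adjoin V w \<subseteq> carrier M" using s w by (auto simp: adjoin_def)
  have "\<zero> = \<zero> \<oplus> [(0::nat)] \<cdot> w" using w by simp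
  then show "\<zero> \<in> adjoin V w" using additive_subgroup.zero_closed[OF V]
    unfolding adjoin_def by blast
  fix x y assume "x \<in> adjoin V w" "y \<in> adjoin V w"
  then obtain v k v' k' where x: "x = v \<oplus> [(k::nat)] \<cdot> w" "y = v' \<oplus> [(k'::nat)] \<cdot> w" and
    v: "v \<in> V" "v' \<in> V" unfolding adjoin_def by blast
  have vc: "v \<in> carrier M" "v' \<in> carrier M" using v s by auto
  have "x \<oplus> y = (v \<oplus> v') \<oplus> ([k] \<cdot> w \<oplus> [k'] \<cdot> w)"
    unfolding x using vc w by (simp add: a_ac)
  also have "[k] \<cdot> w \<oplus> [k'] \<cdot> w = [(k + k')] \<cdot> w" using w by (simp add: add.nat_pow_mult)
  finally show "x \<oplus> y \<in> adjoin V w"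
    using v additive_subgroup.a_closed[OF V] by (auto simp: adjoin_def)
qed

lemma adjoin_superset:
  assumes V: "additive_subgroup V M" and w: "w \<in> carrier M"
  shows "V \<subseteq> adjoin V w" "w \<in> adjoin V w"
proof -
  have s: "V \<subseteq> carrier M" using additive_subgroup.a_subset[OF V] .
  show "V \<subseteq> adjoin V w"
  proof
    fix v assume "v \<in> V"
    then have "v = v \<oplus> [(0::nat)] \<cdot> w" using s w by auto
    then show "v \<in> adjoin V w" using \<open>v \<in> V\<close> unfolding adjoin_def by blast
  qed
  have "w = \<zero> \<oplus> [(1::nat)] \<cdot> w" using w by simp
  then show "w \<in> adjoin V w" using additive_subgroup.zero_closed[OF V] unfolding adjoin_def by blast
qed

text \<open>Such a subgroup has index \<open>p\<close>; it plays the role of a hyperplane.\<close>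

lemma ex_maximal_proper_subgroup:
  assumes W: "additive_subgroup W M" "finite W"
    and V: "additive_subgroup V M" "V \<subseteq> W" "V \<noteq> W"
  obtains H where "additive_subgroup H M" "V \<subseteq> H" "H \<subset> W" "\<And>w. w \<in> W - H \<Longrightarrow> W = adjoin H w"
proof -
  let ?\<H> = "{H. additive_subgroup H M \<and> V \<subseteq> H \<and> H \<subset> W}"
  have fin: "finite ?\<H>" by (rule finite_subset[of _ "Pow W"]) (use W in auto)
  have ne: "?\<H> \<noteq> {}" using V by auto
  obtain H where H: "H \<in> ?\<H>" and mx: "\<forall>H'\<in>?\<H>. H \<subseteq> H' \<longrightarrow> H = H'"
    using finite_has_maximal[OF fin ne] by (rule bexE)
  have "W = adjoin H w" if w: "w \<in> W - H" for w
  proof (rule ccontr)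
    assume ne: "W \<noteq> adjoin H w"
    have wc: "w \<in> carrier M" using w additive_subgroup.a_subset[OF W(1)] by auto
    have Hs: "additive_subgroup H M" "H \<subseteq> W" using H by auto
    have mul: "[k] \<cdot> w \<in> W" for k :: nat
      using w additive_subgroup.zero_closed[OF W(1)] additive_subgroup.a_closed[OF W(1)]
      by (induct k) auto
    have "adjoin H w \<subseteq> W"
      using Hs mul additive_subgroup.a_closed[OF W(1)] by (auto simp: adjoin_def)
    then have in1: "adjoin H w \<in> ?\<H>"
      using ne adjoin_subgroup[OF Hs(1) wc] adjoin_superset[OF Hs(1) wc] H by blast
    have "H \<subset> adjoin H w" using adjoin_superset[OF Hs(1) wc] w by auto
    then show False using mx in1 by (metis psubset_eq)
  qed
  then show ?thesis using H that by blast
qed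

end

text \<open>Homomorphisms are needed on subgroups only, without a record for the subgroup as a group of its own.\<close>

definition additive_on :: "('m, 'd) ring_scheme \<Rightarrow> ('x, 'e) ring_scheme \<Rightarrow> 'm set \<Rightarrow> ('m \<Rightarrow> 'x) \<Rightarrow> bool" where
  "additive_on M X W \<phi> \<longleftrightarrow> \<phi> \<in> W \<rightarrow> carrier X \<and>
     (\<forall>u\<in>W. \<forall>v\<in>W. \<phi> (u \<oplus>\<^bsub>M\<^esub> v) = \<phi> u \<oplus>\<^bsub>X\<^esub> \<phi> v)"

lemma additive_on_zero:
  assumes "abelian_group M" "abelian_group X" "additive_on M X W \<phi>" "\<zero>\<^bsub>M\<^esub> \<in> W"
  shows "\<phi> \<zero>\<^bsub>M\<^esub> = \<zero>\<^bsub>X\<^esub>"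
proof -
  interpret M: abelian_group M by fact
  interpret X: abelian_group X by fact
  have "\<phi> \<zero>\<^bsub>M\<^esub> \<oplus>\<^bsub>X\<^esub> \<phi> \<zero>\<^bsub>M\<^esub> = \<phi> \<zero>\<^bsub>M\<^esub>" "\<phi> \<zero>\<^bsub>M\<^esub> \<in> carrier X"
    using assms(3,4) unfolding additive_on_def by (metis M.r_zero M.zero_closed, auto)
  then show ?thesis by (metis X.add.l_cancel_one')
qed

lemma additive_on_multiple:
  assumes "abelian_group M" "abelian_group X" "additive_on M X W \<phi>" "additive_subgroup W M" "w \<in> W"
  shows "[(k::nat)] \<cdot>\<^bsub>M\<^esub> w \<in> W \<and> \<phi> ([k] \<cdot>\<^bsub>M\<^esub> w) = [k] \<cdot>\<^bsub>X\<^esub> \<phi> w"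
proof -
  interpret M: abelian_group M by fact
  interpret X: abelian_group X by fact
  interpret W: additive_subgroup W M by fact
  show ?thesis
  proof (induct k)
    case 0
    then show ?case using additive_on_zero[OF assms(1-3)] by simp
  next
    case (Suc k)
    then show ?case using assms(3,5) by (auto simp: additive_on_def)
  qed
qed

text \<open>Modulo \<open>H\<close> the element \<open>w\<close> has order \<open>p\<close>. So an element of the larger group is \<open>v + k w\<close>
  with \<open>v \<in> H\<close> unique and \<open>k\<close> unique modulo \<open>p\<close>, and as \<open>X\<close> has exponent \<open>p\<close> too, the image of
  \<open>w\<close> can be chosen freely.\<close>

lemma extend_additive:
  assumes M: "torsion_group M p" and X: "torsion_group X p"
    and H: "additive_subgroup H M" and \<phi>: "additive_on M X H \<phi>"
    and w: "w \<in> carrier M" "w \<notin> H" and x: "x \<in> carrier X"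
  obtains \<psi> where "additive_on M X (torsion_group.adjoin M H w) \<psi>" "\<And>v. v \<in> H \<Longrightarrow> \<psi> v = \<phi> v" "\<psi> w = x"
proof -
  interpret M: torsion_group M p by fact
  interpret X: torsion_group X p by fact
  interpret H: additive_subgroup H M by fact
  have p0: "p > 1" using M.prime_p prime_gt_1_nat by blast
  have aux: "k mod p = k' mod p" if "v \<oplus>\<^bsub>M\<^esub> [k] \<cdot>\<^bsub>M\<^esub> w = v' \<oplus>\<^bsub>M\<^esub> [k'] \<cdot>\<^bsub>M\<^esub> w" "v \<in> H" "v' \<in> H"
    "k' mod p \<le> k mod p" for v v' and k k' :: nat
  proof (rule ccontr)
    assume ne: "k mod p \<noteq> k' mod p"
    define j where "j = k mod p - k' mod p"
    have j: "0 < j" "j < p" using ne that(4) p0 by (auto simp: j_def less_imp_diff_less)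
    have kj: "k mod p = j + k' mod p" using that(4) by (simp add: j_def)
    have vc: "v \<in> carrier M" "v' \<in> carrier M" using that H.a_subset by auto
    have "v \<oplus>\<^bsub>M\<^esub> [(j + k' mod p)] \<cdot>\<^bsub>M\<^esub> w = v' \<oplus>\<^bsub>M\<^esub> [(k' mod p)] \<cdot>\<^bsub>M\<^esub> w"
      using that(1) w M.mult_mod kj by metis
    then have "(v \<oplus>\<^bsub>M\<^esub> [j] \<cdot>\<^bsub>M\<^esub> w) \<oplus>\<^bsub>M\<^esub> [(k' mod p)] \<cdot>\<^bsub>M\<^esub> w = v' \<oplus>\<^bsub>M\<^esub> [(k' mod p)] \<cdot>\<^bsub>M\<^esub> w"
      using w vc by (simp add: M.add.nat_pow_mult M.a_assoc)
    then have "v \<oplus>\<^bsub>M\<^esub> [j] \<cdot>\<^bsub>M\<^esub> w = v'" using w vc that(3) by simp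
    then have "[j] \<cdot>\<^bsub>M\<^esub> w = \<ominus>\<^bsub>M\<^esub> v \<oplus>\<^bsub>M\<^esub> v'" using w vc
      by (metis M.r_neg1 M.add.nat_pow_closed)
    then have "[j] \<cdot>\<^bsub>M\<^esub> w \<in> H" using that by simp
    then show False using M.multiple_in_subgroup[OF H w(1) _ j] w by blast
  qed
  define rep where "rep u v k \<longleftrightarrow> v \<in> H \<and> u = v \<oplus>\<^bsub>M\<^esub> [(k::nat)] \<cdot>\<^bsub>M\<^esub> w" for u v k
  define \<psi> where "\<psi> u = (let (v, k) = (SOME (v, k). rep u v k) in \<phi> v \<oplus>\<^bsub>X\<^esub> [k] \<cdot>\<^bsub>X\<^esub> x)" for u
  have \<psi>_eq: "\<psi> u = \<phi> v \<oplus>\<^bsub>X\<^esub> [k] \<cdot>\<^bsub>X\<^esub> x" if r: "rep u v k" for u v k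
  proof -
    obtain v' k' where c: "(SOME (v, k). rep u v k) = (v', k')" by (cases "(SOME (v, k). rep u v k)")
    have r': "rep u v' k'" using someI[of "\<lambda>(v, k). rep u v k" "(v, k)"] r c by auto
    have "k mod p = k' mod p" using aux r r' unfolding rep_def by (metis nat_le_linear)
    then have kk: "[k] \<cdot>\<^bsub>M\<^esub> w = [k'] \<cdot>\<^bsub>M\<^esub> w" "[k] \<cdot>\<^bsub>X\<^esub> x = [k'] \<cdot>\<^bsub>X\<^esub> x"
      using M.mult_mod[OF w(1)] X.mult_mod[OF x] by metis+
    have vc: "v \<in> carrier M" "v' \<in> carrier M" using r r' H.a_subset by (auto simp: rep_def)
    have "v \<oplus>\<^bsub>M\<^esub> [k'] \<cdot>\<^bsub>M\<^esub> w = v' \<oplus>\<^bsub>M\<^esub> [k'] \<cdot>\<^bsub>M\<^esub> w"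
      using r r' kk by (simp add: rep_def)
    then have "v = v'" using w vc by simp
    then show ?thesis using c kk by (simp add: \<psi>_def)
  qed
  show ?thesis
  proof
    have \<phi>c: "\<phi> v \<in> carrier X" if "v \<in> H" for v using \<phi> that by (auto simp: additive_on_def)
    show "additive_on M X (M.adjoin H w) \<psi>" unfolding additive_on_def
    proof (intro conjI ballI funcsetI)
      fix u assume "u \<in> M.adjoin H w"
      then obtain v k where "rep u v k" unfolding M.adjoin_def rep_def by blast
      then show "\<psi> u \<in> carrier X" using \<psi>_eq \<phi>c x by (simp add: rep_def)
    next
      fix u u' assume "u \<in> M.adjoin H w" "u' \<in> M.adjoin H w"
      then obtain v k v' k' where r: "rep u v k" "rep u' v' k'" unfolding M.adjoin_def rep_def by blast
      then have vc: "v \<in> H" "v' \<in> H" "v \<in> carrier M" "v' \<in> carrier M" using H.a_subset by (auto simp: rep_def)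
      have "u \<oplus>\<^bsub>M\<^esub> u' = (v \<oplus>\<^bsub>M\<^esub> v') \<oplus>\<^bsub>M\<^esub> ([k] \<cdot>\<^bsub>M\<^esub> w \<oplus>\<^bsub>M\<^esub> [k'] \<cdot>\<^bsub>M\<^esub> w)"
        using r w vc by (simp add: rep_def M.a_ac)
      then have "rep (u \<oplus>\<^bsub>M\<^esub> u') (v \<oplus>\<^bsub>M\<^esub> v') (k + k')"
        using vc w by (simp add: rep_def M.add.nat_pow_mult)
      then have "\<psi> (u \<oplus>\<^bsub>M\<^esub> u') = (\<phi> v \<oplus>\<^bsub>X\<^esub> \<phi> v') \<oplus>\<^bsub>X\<^esub> ([k] \<cdot>\<^bsub>X\<^esub> x \<oplus>\<^bsub>X\<^esub> [k'] \<cdot>\<^bsub>X\<^esub> x)"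
        using \<psi>_eq \<phi> vc x by (simp add: additive_on_def X.add.nat_pow_mult)
      then show "\<psi> (u \<oplus>\<^bsub>M\<^esub> u') = \<psi> u \<oplus>\<^bsub>X\<^esub> \<psi> u'"
        using \<psi>_eq[OF r(1)] \<psi>_eq[OF r(2)] \<phi>c vc x by (simp add: X.a_ac)
    qed
    fix v assume v: "v \<in> H"
    then have "rep v v 0" using H.a_subset w by (auto simp: rep_def)
    then show "\<psi> v = \<phi> v" using \<psi>_eq \<phi>c v x by fastforce
  next
    have "rep w \<zero>\<^bsub>M\<^esub> 1" using w by (simp add: rep_def)
    then show "\<psi> w = x" using \<psi>_eq x
      additive_on_zero[OF M.abelian_group_axioms X.abelian_group_axioms \<phi>] by fastforce
  qed
qed

section \<open>Partially equivariant maps on finite subgroups\<close>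

text \<open>Only the letters in \<open>S\<close> act; no group acting on \<open>M\<close> is mentioned, so that the same notion covers
  measures and functions on a finite set.\<close>

locale letter_module = torsion_group M p for M (structure) and p +
  fixes S :: "('l \<times> bool) set" and act :: "'l \<times> bool \<Rightarrow> 'a \<Rightarrow> 'a"
  assumes flip_S: "s \<in> S \<Longrightarrow> flip s \<in> S"
    and act_closed: "s \<in> S \<Longrightarrow> x \<in> carrier M \<Longrightarrow> act s x \<in> carrier M"
    and act_add: "s \<in> S \<Longrightarrow> x \<in> carrier M \<Longrightarrow> y \<in> carrier M \<Longrightarrow> act s (x \<oplus> y) = act s x \<oplus> act s y"
    and act_flip: "s \<in> S \<Longrightarrow> x \<in> carrier M \<Longrightarrow> act (flip s) (act s x) = x"
begin

definition overlap :: "'l \<times> bool \<Rightarrow> 'a set \<Rightarrow> 'a set" where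
  "overlap s W = {w \<in> W. act (flip s) w \<in> W}"

text \<open>The model is the group \<open>W\<close> of all functions supported on a finite subtree of the Cayley graph of a free
  group: for \<open>H\<close> take the functions that vanish at a leaf \<open>g\<close> of the tree, and for \<open>e\<close> the letter
  such that the neighbour of \<open>g\<close> in the tree is \<open>inv e g\<close>. The subgroup \<open>overlap s W\<close>, which is
  \<open>W \<inter> s W\<close>, consists of the functions supported on those vertices \<open>h\<close> of the tree for which
  \<open>inv s h\<close> belongs to the tree, too.\<close>

definition has_leaf :: "'a set \<Rightarrow> bool" where
  "has_leaf W \<longleftrightarrow>
     (\<exists>H e. additive_subgroup H M \<and> H \<subset> W \<and> (\<forall>s\<in>S - {e}. overlap s W \<subseteq> H))"

lemma act_zero: "s \<in> S \<Longrightarrow> act s \<zero> = \<zero>"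
  by (metis act_add act_closed zero_closed add.l_cancel_one' r_zero)

lemma act_multiple: "s \<in> S \<Longrightarrow> x \<in> carrier M \<Longrightarrow> act s ([(k::nat)] \<cdot> x) = [k] \<cdot> act s x"
  by (induct k) (auto simp: act_zero act_add act_closed)

lemma act_minus: "s \<in> S \<Longrightarrow> x \<in> carrier M \<Longrightarrow> act s (\<ominus> x) = \<ominus> act s x"
  by (metis act_add act_closed act_zero a_inv_closed l_neg minus_equality)

lemma overlap_pair:
  assumes "s \<in> S" "W \<subseteq> carrier M" "v \<in> W" "act s v \<in> W"
  shows "v \<in> overlap (flip s) W" "act s v \<in> overlap s W"
  using assms act_flip[of s v] by (auto simp: overlap_def)

lemma act_overlap:
  assumes "s \<in> S" "W \<subseteq> carrier M" "v \<in> overlap (flip s) W"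
  shows "act s v \<in> overlap s W"
  using assms act_flip[of s v] by (auto simp: overlap_def)

end

definition partially_equivariant where
  "partially_equivariant M act X actX S W \<phi> \<longleftrightarrow>
     additive_on M X W \<phi> \<and> (\<forall>s\<in>S. \<forall>v\<in>W. act s v \<in> W \<longrightarrow> \<phi> (act s v) = actX s (\<phi> v))"

text \<open>Induction on the order of \<open>W\<close>, removing a leaf. Let \<open>H\<close> be a maximal proper subgroup that contains
  \<open>W \<inter> s W\<close> for all \<open>s \<noteq> e\<close>. If \<open>H\<close> contains \<open>W \<inter> e W\<close> too, then no equivariance condition
  involves an element outside \<open>H\<close>, and any such element can be added to the basis. Otherwise there is
  \<open>w = e v\<close> outside \<open>H\<close> with \<open>v \<in> H\<close>; equivariance dictates the image of \<open>w\<close>, and the basis of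
  \<open>H\<close> serves for \<open>W\<close>.\<close>

lemma partial_basis:
  assumes M: "letter_module M p S act" and X: "letter_module X p S actX"
    and W: "additive_subgroup W M" "finite W"
    and leaf: "\<And>V. additive_subgroup V M \<Longrightarrow> V \<subseteq> W \<Longrightarrow> V \<noteq> {\<zero>\<^bsub>M\<^esub>} \<Longrightarrow>
       letter_module.has_leaf M S act V"
  shows "\<exists>B\<subseteq>W.
     (\<forall>U. additive_subgroup U M \<and> (\<forall>s\<in>S. \<forall>u\<in>U. act s u \<in> U) \<and> B \<subseteq> U \<longrightarrow> W \<subseteq> U) \<and>
     (\<forall>\<beta>\<in>B \<rightarrow> carrier X. \<exists>\<phi>. partially_equivariant M act X actX S W \<phi> \<and> (\<forall>b\<in>B. \<phi> b = \<beta> b))"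
  using W leaf
proof (induct "card W" arbitrary: W rule: less_induct)
  case less
  interpret M: letter_module M p S act by fact
  interpret X: letter_module X p S actX by fact
  interpret W: additive_subgroup W M by fact
  show ?case
  proof (cases "W = {\<zero>\<^bsub>M\<^esub>}")
    case True
    have "partially_equivariant M act X actX S W (\<lambda>_. \<zero>\<^bsub>X\<^esub>)"
      unfolding partially_equivariant_def additive_on_def by (auto simp: X.act_zero)
    then show ?thesis using True
      by (intro exI[of _ "{}"]) (auto dest: additive_subgroup.zero_closed)
  next
    case False
    obtain H0 e where H0: "additive_subgroup H0 M" "H0 \<subset> W" "\<And>s. s \<in> S - {e} \<Longrightarrow> M.overlap s W \<subseteq> H0"
      using less.prems(3)[OF less.prems(1) order_refl False] unfolding M.has_leaf_def by blast
    obtain H where H: "additive_subgroup H M" "H0 \<subseteq> H" "H \<subset> W" 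
      and adj: "\<And>w. w \<in> W - H \<Longrightarrow> W = M.adjoin H w"
      using M.ex_maximal_proper_subgroup[OF less.prems(1,2) H0(1)] H0(2) by blast
    interpret H: additive_subgroup H M by fact
    have Hs: "M.overlap s W \<subseteq> H" if "s \<in> S" "s \<noteq> e" for s using H0(3)[of s] that H(2) by auto
    have Wc: "W \<subseteq> carrier M" by (rule W.a_subset)
    have cardH: "card H < card W" using H(3) less.prems(2) by (rule psubset_card_mono[rotated])
    have finH: "finite H" using H(3) less.prems(2) finite_subset by blast
    have leafH: "M.has_leaf V" if "additive_subgroup V M" "V \<subseteq> H" "V \<noteq> {\<zero>\<^bsub>M\<^esub>}" for V
      using less.prems(3)[OF that(1) _ that(3)] that(2) H(3) by blast
    obtain B where B: "B \<subseteq> H"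
      and gen: "\<forall>U. additive_subgroup U M \<and> (\<forall>s\<in>S. \<forall>u\<in>U. act s u \<in> U) \<and> B \<subseteq> U \<longrightarrow> H \<subseteq> U"
      and ext: "\<forall>\<beta>\<in>B \<rightarrow> carrier X. \<exists>\<phi>. partially_equivariant M act X actX S H \<phi> \<and> (\<forall>b\<in>B. \<phi> b = \<beta> b)"
      using less.hyps[OF cardH H(1) finH] leafH by (elim meta_impE exE conjE) (assumption | rule that)+
    have adj_sub: "M.adjoin H w \<subseteq> U" if "H \<subseteq> U" "w \<in> U" "additive_subgroup U M" for U w
    proof -
      interpret U: additive_subgroup U M by fact
      have "[k] \<cdot>\<^bsub>M\<^esub> w \<in> U" for k :: nat using that by (induct k) auto
      then show ?thesis using that by (auto simp: M.adjoin_def)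
    qed
    show ?thesis
    proof (cases "e \<in> S \<and> \<not> M.overlap e W \<subseteq> H")
      case False
      then have Hs': "M.overlap s W \<subseteq> H" if "s \<in> S" for s using Hs that by blast
      obtain w where w: "w \<in> W" "w \<notin> H" using H(3) by blast
      have wc: "w \<in> carrier M" using w Wc by auto
      have Wadj: "W = M.adjoin H w" using adj w by blast
      show ?thesis
      proof (intro exI[of _ "insert w B"] conjI allI impI ballI)
        show "insert w B \<subseteq> W" using w B H(3) by auto
      next
        fix U assume U: "additive_subgroup U M \<and> (\<forall>s\<in>S. \<forall>u\<in>U. act s u \<in> U) \<and> insert w B \<subseteq> U"
        then have "H \<subseteq> U" using gen by simp
        then show "W \<subseteq> U" using adj_sub U Wadj by simp
      next
        fix \<beta> assume \<beta>: "\<beta> \<in> insert w B \<rightarrow> carrier X"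
        then obtain \<phi> where \<phi>: "partially_equivariant M act X actX S H \<phi>" "\<forall>b\<in>B. \<phi> b = \<beta> b"
          using bspec[OF ext, of \<beta>] by auto
        have add: "additive_on M X H \<phi>" using \<phi> by (simp add: partially_equivariant_def)
        obtain \<psi> where \<psi>: "additive_on M X W \<psi>" "\<And>v. v \<in> H \<Longrightarrow> \<psi> v = \<phi> v" "\<psi> w = \<beta> w"
          using extend_additive[OF M.torsion_group_axioms X.torsion_group_axioms H(1) add wc w(2), of "\<beta> w"]
            \<beta> Wadj by auto
        have "\<psi> (act s v) = actX s (\<psi> v)" if s: "s \<in> S" "v \<in> W" "act s v \<in> W" for s v
        proof -
          have "v \<in> H" "act s v \<in> H"
            using M.overlap_pair[OF s(1) Wc s(2,3)] Hs' s M.flip_S by blast+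
          then show ?thesis using \<psi> \<phi>(1) s(1) by (simp add: partially_equivariant_def)
        qed
        then show "\<exists>\<phi>. partially_equivariant M act X actX S W \<phi> \<and> (\<forall>b\<in>insert w B. \<phi> b = \<beta> b)"
          using \<psi> \<phi>(2) B by (intro exI[of _ \<psi>]) (auto simp: partially_equivariant_def)
      qed
    next
      case True
      then obtain w where w: "w \<in> M.overlap e W" "w \<notin> H" and e: "e \<in> S" by blast
      define v where "v = act (flip e) w"
      have wW: "w \<in> W" and vW: "v \<in> W" using w by (auto simp: M.overlap_def v_def)
      have wc: "w \<in> carrier M" and vc: "v \<in> carrier M" using wW vW Wc by auto
      have fe: "flip e \<in> S" using e M.flip_S by blast
      have ev: "act e v = w" using M.act_flip[OF fe wc] by (simp add: v_def)
      have vH: "v \<in> H"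
        using M.overlap_pair(1)[OF e Wc vW] ev wW Hs[OF fe] by auto
      have Wadj: "W = M.adjoin H w" using adj wW w by blast
      show ?thesis
      proof (intro exI[of _ B] conjI allI impI ballI)
        show "B \<subseteq> W" using B H(3) by auto
      next
        fix U assume U: "additive_subgroup U M \<and> (\<forall>s\<in>S. \<forall>u\<in>U. act s u \<in> U) \<and> B \<subseteq> U"
        then have "H \<subseteq> U" using gen by simp
        moreover from this have "w \<in> U" using U vH e ev by blast
        ultimately show "W \<subseteq> U" using adj_sub U Wadj by simp
      next
        fix \<beta> assume \<beta>: "\<beta> \<in> B \<rightarrow> carrier X"
        then obtain \<phi> where \<phi>: "partially_equivariant M act X actX S H \<phi>" "\<forall>b\<in>B. \<phi> b = \<beta> b"
          using bspec[OF ext, of \<beta>] by auto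
        have add: "additive_on M X H \<phi>" using \<phi> by (simp add: partially_equivariant_def)
        have pvc: "\<phi> v \<in> carrier X" using add vH by (auto simp: additive_on_def)
        then have xc: "actX e (\<phi> v) \<in> carrier X" using X.act_closed[OF e] by blast
        obtain \<psi> where \<psi>: "additive_on M X W \<psi>" "\<And>v. v \<in> H \<Longrightarrow> \<psi> v = \<phi> v" "\<psi> w = actX e (\<phi> v)"
          using extend_additive[OF M.torsion_group_axioms X.torsion_group_axioms H(1) add wc w(2) xc] Wadj
          by metis
        \<comment> \<open>Modulo multiples of \<open>w = e v\<close> the equation \<open>u \<mapsto> e u\<close> takes place inside \<open>H\<close>.\<close>
        have \<psi>_e: "\<psi> (act e u) = actX e (\<psi> u)" if u: "u \<in> W" "act e u \<in> W" for u
        proof -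
          have uH: "u \<in> H" using M.overlap_pair(1)[OF e Wc u] Hs[OF fe] by auto
          have uc: "u \<in> carrier M" using u Wc by auto
          obtain h k where hk: "h \<in> H" "act e u = h \<oplus>\<^bsub>M\<^esub> [(k::nat)] \<cdot>\<^bsub>M\<^esub> w"
            using u(2) Wadj unfolding M.adjoin_def by blast
          have hc: "h \<in> carrier M" using hk H.a_subset by auto
          define u' where "u' = u \<oplus>\<^bsub>M\<^esub> \<ominus>\<^bsub>M\<^esub> ([k] \<cdot>\<^bsub>M\<^esub> v)"
          have kv: "[k] \<cdot>\<^bsub>M\<^esub> v \<in> H" "\<phi> ([k] \<cdot>\<^bsub>M\<^esub> v) = [k] \<cdot>\<^bsub>X\<^esub> \<phi> v"
            using additive_on_multiple[OF M.abelian_group_axioms X.abelian_group_axioms add H(1) vH] by auto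
          have u'H: "u' \<in> H" using uH kv by (simp add: u'_def)
          have "act e u' = act e u \<oplus>\<^bsub>M\<^esub> \<ominus>\<^bsub>M\<^esub> ([k] \<cdot>\<^bsub>M\<^esub> w)"
            using uc vc e ev by (simp add: u'_def M.act_add M.act_minus M.act_multiple)
          also have "\<dots> = h" using hk(2) hc wc by (simp add: M.a_assoc M.r_neg)
          finally have eu': "act e u' = h" .
          have "u = u' \<oplus>\<^bsub>M\<^esub> [k] \<cdot>\<^bsub>M\<^esub> v" using uc vc by (simp add: u'_def M.a_assoc M.l_neg)
          then have "\<psi> u = \<phi> u' \<oplus>\<^bsub>X\<^esub> [k] \<cdot>\<^bsub>X\<^esub> \<phi> v"
            using \<psi>(2) uH u'H kv add by (simp add: additive_on_def)
          moreover have "\<phi> u' \<in> carrier X" using add u'H by (auto simp: additive_on_def)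
          ultimately have "actX e (\<psi> u) = actX e (\<phi> u') \<oplus>\<^bsub>X\<^esub> [k] \<cdot>\<^bsub>X\<^esub> actX e (\<phi> v)"
            using pvc e by (simp add: X.act_add X.act_multiple)
          also have "actX e (\<phi> u') = \<phi> h" using \<phi>(1) e u'H hk(1) eu' by (auto simp: partially_equivariant_def)
          also have "\<phi> h \<oplus>\<^bsub>X\<^esub> [k] \<cdot>\<^bsub>X\<^esub> actX e (\<phi> v) = \<psi> (act e u)"
          proof -
            have kw: "[k] \<cdot>\<^bsub>M\<^esub> w \<in> W" "\<psi> ([k] \<cdot>\<^bsub>M\<^esub> w) = [k] \<cdot>\<^bsub>X\<^esub> \<psi> w"
              using additive_on_multiple[OF M.abelian_group_axioms X.abelian_group_axioms \<psi>(1)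
                  less.prems(1) wW] by auto
            then show ?thesis using \<psi> hk H(3) by (auto simp: additive_on_def)
          qed
          finally show ?thesis by simp
        qed
        have "\<psi> (act s u) = actX s (\<psi> u)" if s: "s \<in> S" "u \<in> W" "act s u \<in> W" for s u
        proof -
          consider "s = e" | "s = flip e" | "s \<noteq> e" "flip s \<noteq> e" by (metis flip_flip)
          then show ?thesis
          proof cases
            case 1
            then show ?thesis using \<psi>_e s by simp
          next
            case 2
            have uc: "u \<in> carrier M" using s Wc by auto
            have eu: "act e (act s u) = u" using M.act_flip[OF s(1) uc] 2 by simp
            have "\<psi> u = actX e (\<psi> (act s u))" using \<psi>_e[OF s(3)] eu s by simp
            moreover have "\<psi> (act s u) \<in> carrier X" using \<psi>(1) s(3) by (auto simp: additive_on_def)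
            ultimately show ?thesis using X.act_flip[OF e] 2 by simp
          next
            case 3
            have "u \<in> H" "act s u \<in> H"
              using M.overlap_pair[OF s(1) Wc s(2,3)] Hs s M.flip_S 3 by blast+
            then show ?thesis using \<psi> \<phi>(1) s(1) by (simp add: partially_equivariant_def)
          qed
        qed
        then show "\<exists>\<phi>. partially_equivariant M act X actX S W \<phi> \<and> (\<forall>b\<in>B. \<phi> b = \<beta> b)"
          using \<psi> \<phi>(2) B by (intro exI[of _ \<psi>]) (auto simp: partially_equivariant_def)
      qed
    qed
  qed
qed

section \<open>Reduced words and actions of free groups\<close>

lemma extend_partial_injection:
  assumes T: "finite T" and D: "D \<subseteq> T" and f: "inj_on f D" "f ` D \<subseteq> T"
  obtains \<pi> where "bij_betw \<pi> T T" "\<And>d. d \<in> D \<Longrightarrow> \<pi> d = f d"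
proof -
  have "card (T - D) = card (T - f ` D)"
    using assms by (metis card_Diff_subset card_image finite_imageI finite_subset)
  then obtain g where g: "bij_betw g (T - D) (T - f ` D)"
    using T by (meson finite_Diff finite_same_card_bij)
  define \<pi> where "\<pi> x = (if x \<in> D then f x else g x)" for x
  have 1: "bij_betw \<pi> D (f ` D)" using f by (simp add: \<pi>_def bij_betw_def inj_on_def)
  have 2: "bij_betw \<pi> (T - D) (T - f ` D)"
    using g by (rule bij_betw_cong[THEN iffD1, rotated]) (simp add: \<pi>_def)
  have "bij_betw \<pi> (D \<union> (T - D)) (f ` D \<union> (T - f ` D))" by (rule bij_betw_combine[OF 1 2]) auto
  moreover have "D \<union> (T - D) = T" "f ` D \<union> (T - f ` D) = T" using D f by auto
  ultimately show ?thesis using that[of \<pi>] by (simp add: \<pi>_def)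
qed

lemma ex_bij_matching_fibres:
  assumes fin: "finite P" "finite Q"
    and card: "\<And>i. card {x \<in> P. \<alpha> x = i} = card {y \<in> Q. \<beta> y = i}"
  obtains h where "bij_betw h P Q" "\<And>x. x \<in> P \<Longrightarrow> \<beta> (h x) = \<alpha> x"
proof -
  have "\<exists>g. bij_betw g {x \<in> P. \<alpha> x = i} {y \<in> Q. \<beta> y = i}" for i
    using card[of i] fin by (intro finite_same_card_bij) auto
  then obtain g where g: "\<And>i. bij_betw (g i) {x \<in> P. \<alpha> x = i} {y \<in> Q. \<beta> y = i}" by metis
  define h where "h x = g (\<alpha> x) x" for x
  have h: "h x \<in> Q \<and> \<beta> (h x) = \<alpha> x" if "x \<in> P" for x
    using bij_betwE[OF g[of "\<alpha> x"]] that by (auto simp: h_def)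
  have inj: "inj_on h P"
  proof (rule inj_onI)
    fix x y assume xy: "x \<in> P" "y \<in> P" "h x = h y"
    then have "\<alpha> x = \<alpha> y" using h by metis
    then show "x = y" using xy bij_betw_imp_inj_on[OF g[of "\<alpha> x"]] by (auto simp: h_def inj_on_def)
  qed
  have "h ` P = Q"
  proof
    show "h ` P \<subseteq> Q" using h by auto
    show "Q \<subseteq> h ` P"
    proof
      fix y assume "y \<in> Q"
      then obtain x where "x \<in> P" "\<alpha> x = \<beta> y" "g (\<beta> y) x = y"
        using bij_betw_imp_surj_on[OF g[of "\<beta> y"]] by (smt (verit) imageE mem_Collect_eq)
      then show "y \<in> h ` P" by (metis h_def imageI)
    qed
  qed
  then show ?thesis using that[of h] inj h by (auto simp: bij_betw_def)
qed

text \<open>Left multiplication of a reduced word by a letter, with cancellation.\<close>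

definition red_cons :: "'b \<times> bool \<Rightarrow> ('b \<times> bool) list \<Rightarrow> ('b \<times> bool) list" where
  "red_cons s w = (case w of [] \<Rightarrow> [s] | t # w' \<Rightarrow> if t = flip s then w' else s # w)"

lemma reduced_words_Nil [simp]: "[] \<in> reduced_words B"
  by (simp add: reduced_words_def)

lemma reduced_words_single [simp]: "[s] \<in> reduced_words B \<longleftrightarrow> fst s \<in> B"
  by (simp add: reduced_words_def)

lemma reduced_words_Cons2:
  "s # t # w \<in> reduced_words B \<longleftrightarrow> fst s \<in> B \<and> t \<noteq> flip s \<and> t # w \<in> reduced_words B"
  by (cases s; cases t) (auto simp: reduced_words_def)

lemma reduced_words_ConsD: "s # w \<in> reduced_words B \<Longrightarrow> fst s \<in> B \<and> w \<in> reduced_words B"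
  by (cases w) (auto simp: reduced_words_Cons2)

lemma reduced_words_appendD: "u @ v \<in> reduced_words B \<Longrightarrow> v \<in> reduced_words B"
  by (induct u) (auto dest: reduced_words_ConsD)

lemma red_cons_reduced: "w \<in> reduced_words B \<Longrightarrow> fst s \<in> B \<Longrightarrow> red_cons s w \<in> reduced_words B"
  by (auto simp: red_cons_def reduced_words_Cons2 split: list.split dest: reduced_words_ConsD)

locale free_basis = group G for G (structure) +
  fixes F B
  assumes F: "subgroup F G" and BF: "B \<subseteq> F"
    and bij: "bij_betw (eval_word G) (reduced_words B) F"
begin

lemma F_carrier: "g \<in> F \<Longrightarrow> g \<in> carrier G"
  using subgroup.subset[OF F] by auto

definition letter :: "'a \<times> bool \<Rightarrow> 'a" where
  "letter s = (if snd s then fst s else inv (fst s))"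

definition word :: "'a \<Rightarrow> ('a \<times> bool) list" where
  "word g = inv_into (reduced_words B) (eval_word G) g"

lemma letter_F: "fst s \<in> B \<Longrightarrow> letter s \<in> F"
  using BF subgroup.m_inv_closed[OF F] by (auto simp: letter_def)

lemma letter_carrier [simp]: "fst s \<in> B \<Longrightarrow> letter s \<in> carrier G"
  using letter_F F_carrier by auto

lemma letter_flip: "fst s \<in> B \<Longrightarrow> letter (flip s) = inv (letter s)"
  using BF F_carrier by (auto simp: letter_def flip_def)

lemma eval_word_Nil [simp]: "eval_word G [] = \<one>"
  by (simp add: eval_word_def)

lemma eval_word_Cons [simp]: "eval_word G (s # w) = letter s \<otimes> eval_word G w"
  by (cases s) (simp add: eval_word_def letter_def)

lemma eval_word_F: "w \<in> reduced_words B \<Longrightarrow> eval_word G w \<in> F"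
  using bij bij_betwE by blast

lemma word_reduced: "g \<in> F \<Longrightarrow> word g \<in> reduced_words B"
  using bij unfolding word_def bij_betw_def by (metis inv_into_into)

lemma eval_word_word: "g \<in> F \<Longrightarrow> eval_word G (word g) = g"
  using bij unfolding word_def by (metis bij_betw_inv_into_right)

lemma word_eval_word: "w \<in> reduced_words B \<Longrightarrow> word (eval_word G w) = w"
  using bij unfolding word_def by (metis bij_betw_inv_into_left)

lemma word_one: "word \<one> = []"
  using word_eval_word[of "[]"] by simp

lemma eval_red_cons:
  assumes "w \<in> reduced_words B" "fst s \<in> B"
  shows "eval_word G (red_cons s w) = letter s \<otimes> eval_word G w"
proof (cases w)
  case Nil
  then show ?thesis by (simp add: red_cons_def)
next
  case (Cons t w')
  have w': "w' \<in> reduced_words B" using assms Cons reduced_words_ConsD by blast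
  show ?thesis
  proof (cases "t = flip s")
    case True
    have "letter s \<otimes> eval_word G w = letter s \<otimes> (inv (letter s) \<otimes> eval_word G w')"
      using Cons True assms by (simp add: letter_flip)
    also have "\<dots> = eval_word G w'"
      using assms(2) eval_word_F[OF w'] F_carrier by (simp flip: m_assoc)
    finally show ?thesis using Cons True by (simp add: red_cons_def)
  next
    case False
    then show ?thesis using Cons by (simp add: red_cons_def)
  qed
qed

lemma word_mult: "g \<in> F \<Longrightarrow> fst s \<in> B \<Longrightarrow> word (letter s \<otimes> g) = red_cons s (word g)"
  by (metis eval_red_cons eval_word_word red_cons_reduced word_eval_word word_reduced)

lemma F_induct [consumes 1, case_names one step]:
  assumes "g \<in> F" and one: "P \<one>"
    and step: "\<And>s h. fst s \<in> B \<Longrightarrow> h \<in> F \<Longrightarrow> word (letter s \<otimes> h) = s # word h \<Longrightarrow> P h \<Longrightarrow> P (letter s \<otimes> h)"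
  shows "P g"
proof -
  have "w \<in> reduced_words B \<Longrightarrow> P (eval_word G w)" for w
  proof (induct w)
    case (Cons s w)
    have w: "fst s \<in> B" "w \<in> reduced_words B" using Cons(2) reduced_words_ConsD by blast+
    have "word (letter s \<otimes> eval_word G w) = s # word (eval_word G w)"
      using word_eval_word[OF Cons(2)] word_eval_word[OF w(2)] by simp
    then show ?case using step[OF w(1) eval_word_F[OF w(2)]] Cons(1) w by simp
  qed (simp add: one)
  then show ?thesis using word_reduced[OF assms(1)] eval_word_word[OF assms(1)] by metis
qed

text \<open>The elements of such a set \<open>T\<close> form a subtree, rooted at the unit, of the Cayley graph of \<open>F\<close> for left
  multiplication by letters. Every element is reached from the unit letter by letter within \<open>T\<close>.\<close>

definition suffix_closed :: "'a set \<Rightarrow> bool" where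
  "suffix_closed T \<longleftrightarrow> T \<subseteq> F \<and> \<one> \<in> T \<and>
     (\<forall>s h. fst s \<in> B \<longrightarrow> h \<in> F \<longrightarrow> word (letter s \<otimes> h) = s # word h \<longrightarrow> letter s \<otimes> h \<in> T \<longrightarrow> h \<in> T)"

lemma suffix_closed_induct [consumes 2, case_names one step]:
  assumes "suffix_closed T" "g \<in> T" and one: "P \<one>"
    and step: "\<And>s h. fst s \<in> B \<Longrightarrow> s \<in> set (word (letter s \<otimes> h)) \<Longrightarrow> h \<in> T \<Longrightarrow> letter s \<otimes> h \<in> T \<Longrightarrow> P h \<Longrightarrow> P (letter s \<otimes> h)"
  shows "P g"
proof -
  have "g \<in> F" using assms by (auto simp: suffix_closed_def)
  then have "g \<in> T \<longrightarrow> P g"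
  proof (induct rule: F_induct)
    case (step s h)
    then show ?case using assms(1,4) unfolding suffix_closed_def by (metis list.set_intros(1))
  qed (simp add: one)
  then show ?thesis using assms by simp
qed

lemma ex_suffix_closed:
  assumes "finite T0" "T0 \<subseteq> F"
  obtains T where "finite T" "T0 \<subseteq> T" "suffix_closed T"
proof
  define V where "V = {v. \<exists>u. \<exists>g\<in>T0. u @ v = word g}"
  have "V = (\<Union>g\<in>T0. (\<lambda>n. drop n (word g)) ` {..length (word g)})"
    unfolding V_def by (auto, metis append_eq_conv_conj atMost_iff image_eqI le_add1 length_append,
      metis append_take_drop_id)
  then have finV: "finite V" using assms by simp
  let ?T = "insert \<one> (eval_word G ` V)"
  show "finite ?T" using finV by simp
  have red: "v \<in> reduced_words B" if "v \<in> V" for v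
    using that assms word_reduced reduced_words_appendD unfolding V_def by (smt (verit) mem_Collect_eq subsetD)
  show "T0 \<subseteq> ?T"
  proof
    fix g assume "g \<in> T0"
    then have "word g \<in> V" "eval_word G (word g) = g"
      using assms eval_word_word unfolding V_def by (auto intro: exI[of _ "[]"])
    then show "g \<in> ?T" by (metis imageI insertI2)
  qed
  show "suffix_closed ?T" unfolding suffix_closed_def
  proof (intro conjI allI impI)
    show "?T \<subseteq> F" using red eval_word_F subgroup.one_closed[OF F] by auto
    fix s h assume a: "fst s \<in> B" "h \<in> F" "word (letter s \<otimes> h) = s # word h" "letter s \<otimes> h \<in> ?T"
    then have "letter s \<otimes> h \<noteq> \<one>" using word_one by auto
    then obtain v where v: "v \<in> V" "letter s \<otimes> h = eval_word G v" using a by blast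
    then have "v = s # word h" using a red word_eval_word by metis
    moreover obtain u g where ug: "g \<in> T0" "u @ v = word g" using v(1) unfolding V_def by blast
    ultimately have "(u @ [s]) @ word h = word g" by simp
    then have "word h \<in> V" using ug(1) unfolding V_def by blast
    then show "h \<in> ?T" using eval_word_word[OF a(2)] by (metis imageI insertI2)
  qed simp
qed

end

text \<open>The universal property of a free group: an arbitrary choice \<open>\<pi>\<close> of permutations of \<open>\<Omega>\<close>, one for each
  basis element, extends to an action \<open>\<rho>\<close> of the whole group.\<close>

locale free_action = free_basis G F B for G (structure) and F B +
  fixes \<pi> :: "'a \<Rightarrow> 'w \<Rightarrow> 'w" and \<Omega> :: "'w set"
  assumes \<pi>: "x \<in> B \<Longrightarrow> bij_betw (\<pi> x) \<Omega> \<Omega>"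
begin

definition lact :: "'a \<times> bool \<Rightarrow> 'w \<Rightarrow> 'w" where
  "lact s = (if snd s then \<pi> (fst s) else inv_into \<Omega> (\<pi> (fst s)))"

definition \<rho> :: "'a \<Rightarrow> 'w \<Rightarrow> 'w" where
  "\<rho> g \<omega> = foldr lact (word g) \<omega>"

lemma lact_closed: "fst s \<in> B \<Longrightarrow> \<omega> \<in> \<Omega> \<Longrightarrow> lact s \<omega> \<in> \<Omega>"
  using \<pi>[of "fst s"] by (auto simp: lact_def bij_betw_def inv_into_into)

lemma lact_flip: "fst s \<in> B \<Longrightarrow> \<omega> \<in> \<Omega> \<Longrightarrow> lact s (lact (flip s) \<omega>) = \<omega>"
  using \<pi>[of "fst s"] by (auto simp: lact_def flip_def bij_betw_inv_into_right bij_betw_inv_into_left)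

lemma foldr_lact_closed: "w \<in> reduced_words B \<Longrightarrow> \<omega> \<in> \<Omega> \<Longrightarrow> foldr lact w \<omega> \<in> \<Omega>"
  by (induct w) (auto simp: lact_closed dest: reduced_words_ConsD)

lemma \<rho>_closed: "g \<in> F \<Longrightarrow> \<omega> \<in> \<Omega> \<Longrightarrow> \<rho> g \<omega> \<in> \<Omega>"
  unfolding \<rho>_def using foldr_lact_closed word_reduced by blast

lemma \<rho>_one: "\<rho> \<one> \<omega> = \<omega>"
  by (simp add: \<rho>_def word_one)

lemma \<rho>_letter: 
  assumes "g \<in> F" "fst s \<in> B" "\<omega> \<in> \<Omega>"
  shows "\<rho> (letter s \<otimes> g) \<omega> = lact s (\<rho> g \<omega>)"
proof (cases "word g")
  case Nil
  then show ?thesis using assms by (simp add: \<rho>_def word_mult red_cons_def)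
next
  case (Cons t w)
  have "foldr lact w \<omega> \<in> \<Omega>"
    using Cons assms word_reduced foldr_lact_closed reduced_words_ConsD by metis
  then show ?thesis using assms Cons by (simp add: \<rho>_def word_mult red_cons_def lact_flip)
qed

lemma \<rho>_mult: 
  assumes "g \<in> F" "h \<in> F" "\<omega> \<in> \<Omega>"
  shows "\<rho> (g \<otimes> h) \<omega> = \<rho> g (\<rho> h \<omega>)"
  using assms(1)
proof (induct rule: F_induct)
  case one
  then show ?case using assms F_carrier by (simp add: \<rho>_one)
next
  case (step s g)
  have "\<rho> (letter s \<otimes> g \<otimes> h) \<omega> = \<rho> (letter s \<otimes> (g \<otimes> h)) \<omega>"
    using step assms F_carrier by (simp add: m_assoc)
  also have "\<dots> = lact s (\<rho> (g \<otimes> h) \<omega>)"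
    using step assms subgroup.m_closed[OF F] by (intro \<rho>_letter) auto
  also have "\<dots> = \<rho> (letter s \<otimes> g) (\<rho> h \<omega>)"
    using step assms by (simp add: \<rho>_letter \<rho>_closed)
  finally show ?case .
qed

end

section \<open>The group ring over the prime field\<close>

text \<open>The elements of \<open>residue_ring\<close> are integers. Sums in it are therefore computed as sums of integers,
  and identities are stated as congruences modulo \<open>q\<close>.\<close>

locale mod_p_group_ring = group G for G :: "('a, 'b) monoid_scheme" (structure) + fixes p :: nat
  assumes p: "prime p"
begin

abbreviation q :: int where "q \<equiv> int p"
abbreviation K :: "int ring" where "K \<equiv> residue_ring q"
abbreviation R :: "('a \<Rightarrow> int) ring" where "R \<equiv> group_ring K G"

lemma q1: "q > 1" using prime_gt_1_nat[OF p] by simp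

lemma K_simps: "carrier K = {0..q - 1}" "\<zero>\<^bsub>K\<^esub> = 0" "\<one>\<^bsub>K\<^esub> = 1" "x \<oplus>\<^bsub>K\<^esub> y = (x + y) mod q"
  "x \<otimes>\<^bsub>K\<^esub> y = (x * y) mod q"
  by (simp_all add: residue_ring_def)

sublocale K: cring K
  using residues.cring[of q] q1 by (simp add: residues_def)

lemma modq: "x mod q \<in> carrier K" using q1 by (simp add: K_simps)

lemma carrier_mod: "x \<in> carrier K \<Longrightarrow> x mod q = x" by (simp add: K_simps)

lemma finsum_K: "(\<And>x. x \<in> A \<Longrightarrow> f x \<in> carrier K) \<Longrightarrow> finsum K f A = sum f A mod q"
proof (induct A rule: infinite_finite_induct)
  case (insert x A)
  then have "finsum K f (insert x A) = f x \<oplus>\<^bsub>K\<^esub> finsum K f A"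
    by (intro K.finsum_insert) auto
  then show ?case using insert by (simp add: K_simps mod_add_right_eq)
qed (simp_all add: K_simps K.finsum_infinite)

definition supp :: "('a \<Rightarrow> int) \<Rightarrow> 'a set" where
  "supp f = {x \<in> carrier G. f x \<noteq> 0}"

lemma R_carrier: "f \<in> carrier R \<longleftrightarrow> f \<in> carrier G \<rightarrow>\<^sub>E carrier K \<and> finite (supp f)"
  by (simp add: group_ring_def supp_def K_simps)

lemma R_val: "f \<in> carrier R \<Longrightarrow> x \<in> carrier G \<Longrightarrow> f x \<in> carrier K"
  by (auto simp: R_carrier)

lemma R_supp: "f \<in> carrier R \<Longrightarrow> finite (supp f)" by (simp add: R_carrier)

lemma supp_carrier: "supp f \<subseteq> carrier G" by (auto simp: supp_def)

lemma supp_in [dest]: "x \<in> supp f \<Longrightarrow> x \<in> carrier G" by (auto simp: supp_def)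

lemma R_mod: "f \<in> carrier R \<Longrightarrow> x \<in> carrier G \<Longrightarrow> f x mod q = f x"
  using R_val carrier_mod by blast

lemma R_zero: "\<zero>\<^bsub>R\<^esub> = (\<lambda>x\<in>carrier G. 0)"
  by (simp add: group_ring_def K_simps)

lemma R_one: "\<one>\<^bsub>R\<^esub> = (\<lambda>x\<in>carrier G. if x = \<one> then 1 else 0)"
  by (simp add: group_ring_def K_simps cong: if_cong)

lemma R_add: "f \<oplus>\<^bsub>R\<^esub> g = (\<lambda>x\<in>carrier G. (f x + g x) mod q)"
  by (simp add: group_ring_def K_simps)

lemma R_mult: 
  assumes "f \<in> carrier R" "g \<in> carrier R"
  shows "f \<otimes>\<^bsub>R\<^esub> g = (\<lambda>x\<in>carrier G. (\<Sum>y\<in>supp f. f y * g (inv y \<otimes> x)) mod q)"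
proof -
  have "f \<otimes>\<^bsub>R\<^esub> g = (\<lambda>x\<in>carrier G. finsum K (\<lambda>y. f y \<otimes>\<^bsub>K\<^esub> g (inv y \<otimes> x)) (supp f))"
    by (simp add: group_ring_def supp_def K_simps)
  also have "\<dots> = (\<lambda>x\<in>carrier G. (\<Sum>y\<in>supp f. f y * g (inv y \<otimes> x)) mod q)"
  proof (rule restrict_ext)
    fix x assume x: "x \<in> carrier G"
    have "finsum K (\<lambda>y. f y \<otimes>\<^bsub>K\<^esub> g (inv y \<otimes> x)) (supp f)
      = (\<Sum>y\<in>supp f. f y \<otimes>\<^bsub>K\<^esub> g (inv y \<otimes> x)) mod q"
      using x R_val[OF assms(1)] R_val[OF assms(2)] by (intro finsum_K K.m_closed) auto
    also have "\<dots> = (\<Sum>y\<in>supp f. f y * g (inv y \<otimes> x)) mod q"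
      by (simp add: K_simps mod_sum_eq)
    finally show "finsum K (\<lambda>y. f y \<otimes>\<^bsub>K\<^esub> g (inv y \<otimes> x)) (supp f)
      = (\<Sum>y\<in>supp f. f y * g (inv y \<otimes> x)) mod q" .
  qed
  finally show ?thesis .
qed

lemma sum_supp: "finite S \<Longrightarrow> supp f \<subseteq> S \<Longrightarrow> S \<subseteq> carrier G \<Longrightarrow>
  (\<Sum>y\<in>S. f y * h y) = (\<Sum>y\<in>supp f. f y * h y)" for h :: "'a \<Rightarrow> int"
  by (rule sum.mono_neutral_right) (auto simp: supp_def)

lemma supp_add: "supp (f \<oplus>\<^bsub>R\<^esub> g) \<subseteq> supp f \<union> supp g"
  by (auto simp: supp_def R_add)

lemma R_add_closed: "f \<in> carrier R \<Longrightarrow> g \<in> carrier R \<Longrightarrow> f \<oplus>\<^bsub>R\<^esub> g \<in> carrier R"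
proof -
  assume c: "f \<in> carrier R" "g \<in> carrier R"
  then have "finite (supp (f \<oplus>\<^bsub>R\<^esub> g))" using finite_subset[OF supp_add] R_supp by blast
  then show ?thesis using modq unfolding R_carrier by (auto simp: R_add)
qed

lemma supp_mult:
  assumes "f \<in> carrier R" "g \<in> carrier R"
  shows "supp (f \<otimes>\<^bsub>R\<^esub> g) \<subseteq> (\<lambda>(y, z). y \<otimes> z) ` (supp f \<times> supp g)"
proof
  fix x assume x: "x \<in> supp (f \<otimes>\<^bsub>R\<^esub> g)"
  then have xc: "x \<in> carrier G" and "(\<Sum>y\<in>supp f. f y * g (inv y \<otimes> x)) \<noteq> 0"
    using R_mult[OF assms] by (auto simp: supp_def)
  then obtain y where y: "y \<in> supp f" "g (inv y \<otimes> x) \<noteq> 0"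
    by (metis (mono_tags, lifting) mult_zero_right sum.neutral)
  then have "inv y \<otimes> x \<in> supp g" "x = y \<otimes> (inv y \<otimes> x)" "y \<in> carrier G"
    using xc by (auto simp: supp_def simp flip: m_assoc)
  then show "x \<in> (\<lambda>(y, z). y \<otimes> z) ` (supp f \<times> supp g)" using y by force
qed

lemma R_mult_closed:
  assumes "f \<in> carrier R" "g \<in> carrier R" shows "f \<otimes>\<^bsub>R\<^esub> g \<in> carrier R"
proof -
  have "finite (supp (f \<otimes>\<^bsub>R\<^esub> g))"
    using finite_subset[OF supp_mult[OF assms]] assms R_supp by blast
  then show ?thesis using modq unfolding R_carrier by (auto simp: R_mult[OF assms])
qed

text \<open>The convolution product acts like its factors one after the other. For \<open>h z = k (inv z \<otimes> x)\<close> this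
  is associativity of the group ring, and for \<open>h z = u (inv z <# A)\<close> it is associativity of the
  module operation.\<close>

lemma conv_sum:
  assumes f: "f \<in> carrier R" and g: "g \<in> carrier R"
  shows "[(\<Sum>z\<in>supp (f \<otimes>\<^bsub>R\<^esub> g). (f \<otimes>\<^bsub>R\<^esub> g) z * h z)
     = (\<Sum>y\<in>supp f. f y * (\<Sum>z\<in>supp g. g z * h (y \<otimes> z)))] (mod q)"
proof -
  define S where "S = (\<lambda>(y, z). y \<otimes> z) ` (supp f \<times> supp g)"
  have finS: "finite S" using f g R_supp by (simp add: S_def)
  have Sc: "S \<subseteq> carrier G" using supp_carrier by (auto simp: S_def)
  have inner: "(\<Sum>z\<in>S. g (inv y \<otimes> z) * h z) = (\<Sum>z\<in>supp g. g z * h (y \<otimes> z))" if y: "y \<in> supp f" for y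
  proof -
    have yc: "y \<in> carrier G" using y supp_carrier by auto
    have "(\<Sum>z\<in>supp g. g z * h (y \<otimes> z)) = (\<Sum>z\<in>(\<lambda>z. y \<otimes> z) ` supp g. g (inv y \<otimes> z) * h z)"
    proof (subst sum.reindex)
      show "inj_on ((\<otimes>) y) (supp g)"
      proof (rule inj_onI)
        fix a b assume "a \<in> supp g" "b \<in> supp g" "y \<otimes> a = y \<otimes> b"
        then show "a = b" using yc supp_in[of a g] supp_in[of b g] by simp
      qed
      show "(\<Sum>z\<in>supp g. g z * h (y \<otimes> z)) = (\<Sum>z\<in>supp g. ((\<lambda>z. g (inv y \<otimes> z) * h z) \<circ> (\<otimes>) y) z)"
        using yc supp_carrier[of g] by (intro sum.cong) (auto simp: subset_iff simp flip: m_assoc)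
    qed
    also have "\<dots> = (\<Sum>z\<in>S. g (inv y \<otimes> z) * h z)"
    proof (rule sum.mono_neutral_left)
      show "finite S" by fact
      show "(\<otimes>) y ` supp g \<subseteq> S" using y by (force simp: S_def)
      show "\<forall>z\<in>S - (\<otimes>) y ` supp g. g (inv y \<otimes> z) * h z = 0"
      proof
        fix z assume z: "z \<in> S - (\<otimes>) y ` supp g"
        then have zc: "z \<in> carrier G" using Sc by auto
        then have "y \<otimes> (inv y \<otimes> z) = z" using yc by (simp flip: m_assoc)
        then have "inv y \<otimes> z \<notin> supp g" using z by (metis DiffD2 imageI)
        then show "g (inv y \<otimes> z) * h z = 0" using yc zc by (auto simp: supp_def)
      qed
    qed
    finally show ?thesis by simp
  qed
  have "(\<Sum>z\<in>supp (f \<otimes>\<^bsub>R\<^esub> g). (f \<otimes>\<^bsub>R\<^esub> g) z * h z) = (\<Sum>z\<in>S. (f \<otimes>\<^bsub>R\<^esub> g) z * h z)"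
    using supp_mult[OF f g] finS Sc by (intro sum_supp[symmetric]) (auto simp: S_def)
  also have "[(\<Sum>z\<in>S. (f \<otimes>\<^bsub>R\<^esub> g) z * h z) = (\<Sum>z\<in>S. (\<Sum>y\<in>supp f. f y * g (inv y \<otimes> z)) * h z)] (mod q)"
    using Sc by (intro cong_sum cong_scalar_right) (auto simp: R_mult[OF f g] subset_iff cong_def)
  also have "(\<Sum>z\<in>S. (\<Sum>y\<in>supp f. f y * g (inv y \<otimes> z)) * h z)
      = (\<Sum>z\<in>S. \<Sum>y\<in>supp f. f y * (g (inv y \<otimes> z) * h z))"
    by (simp add: sum_distrib_right mult.assoc)
  also have "\<dots> = (\<Sum>y\<in>supp f. f y * (\<Sum>z\<in>S. g (inv y \<otimes> z) * h z))"
    by (subst sum.swap) (simp add: sum_distrib_left)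
  also have "\<dots> = (\<Sum>y\<in>supp f. f y * (\<Sum>z\<in>supp g. g z * h (y \<otimes> z)))"
    using inner by simp
  finally show ?thesis .
qed

lemma add_sum:
  assumes f: "f \<in> carrier R" and g: "g \<in> carrier R"
  shows "[(\<Sum>z\<in>supp (f \<oplus>\<^bsub>R\<^esub> g). (f \<oplus>\<^bsub>R\<^esub> g) z * h z)
     = (\<Sum>z\<in>supp f. f z * h z) + (\<Sum>z\<in>supp g. g z * h z)] (mod q)"
proof -
  let ?S = "supp f \<union> supp g"
  have S: "finite ?S" "?S \<subseteq> carrier G" using f g R_supp supp_carrier by auto
  have "(\<Sum>z\<in>supp (f \<oplus>\<^bsub>R\<^esub> g). (f \<oplus>\<^bsub>R\<^esub> g) z * h z) = (\<Sum>z\<in>?S. (f \<oplus>\<^bsub>R\<^esub> g) z * h z)"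
    using S supp_add by (intro sum_supp[symmetric]) auto
  also have "[(\<Sum>z\<in>?S. (f \<oplus>\<^bsub>R\<^esub> g) z * h z) = (\<Sum>z\<in>?S. (f z + g z) * h z)] (mod q)"
    using S by (intro cong_sum cong_scalar_right) (auto simp: R_add subset_iff cong_def)
  also have "(\<Sum>z\<in>?S. (f z + g z) * h z) = (\<Sum>z\<in>?S. f z * h z) + (\<Sum>z\<in>?S. g z * h z)"
    by (simp add: distrib_right sum.distrib)
  also have "(\<Sum>z\<in>?S. f z * h z) = (\<Sum>z\<in>supp f. f z * h z)" using S by (intro sum_supp) auto
  also have "(\<Sum>z\<in>?S. g z * h z) = (\<Sum>z\<in>supp g. g z * h z)" using S by (intro sum_supp) auto
  finally show ?thesis .
qed

lemma one_sum: "(\<Sum>z\<in>supp \<one>\<^bsub>R\<^esub>. \<one>\<^bsub>R\<^esub> z * h z) = h \<one>"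
proof -
  have "supp \<one>\<^bsub>R\<^esub> = {\<one>}" by (auto simp: supp_def R_one)
  then show ?thesis by (simp add: R_one)
qed

lemma R_eqI: "f \<in> carrier R \<Longrightarrow> g \<in> carrier R \<Longrightarrow> (\<And>x. x \<in> carrier G \<Longrightarrow> [f x = g x] (mod q)) \<Longrightarrow> f = g"
  by (rule PiE_ext[of f "carrier G" "\<lambda>_. carrier K" g]) (auto simp: R_carrier cong_def R_mod)

lemma R_mult_cong:
  assumes "f \<in> carrier R" "g \<in> carrier R" "x \<in> carrier G"
  shows "[(f \<otimes>\<^bsub>R\<^esub> g) x = (\<Sum>y\<in>supp f. f y * g (inv y \<otimes> x))] (mod q)"
  using assms by (simp add: R_mult cong_def)

lemma R_add_cong: "x \<in> carrier G \<Longrightarrow> [(f \<oplus>\<^bsub>R\<^esub> g) x = f x + g x] (mod q)"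
  by (simp add: R_add cong_def)

lemma zero_R: "\<zero>\<^bsub>R\<^esub> \<in> carrier R" using q1 by (auto simp: R_carrier R_zero supp_def K_simps)

lemma one_R: "\<one>\<^bsub>R\<^esub> \<in> carrier R"
proof -
  have "supp \<one>\<^bsub>R\<^esub> \<subseteq> {\<one>}" by (auto simp: supp_def R_one)
  then show ?thesis using q1 by (auto simp: R_carrier R_one K_simps dest: finite_subset)
qed

lemma ring_R: "ring R"
proof (rule ringI)
  show "abelian_group R"
  proof (rule abelian_groupI)
    fix f assume f: "f \<in> carrier R"
    let ?g = "\<lambda>x\<in>carrier G. (- f x) mod q"
    have "supp ?g \<subseteq> supp f" by (auto simp: supp_def)
    then have "?g \<in> carrier R" using f modq by (auto simp: R_carrier dest: finite_subset)
    moreover have "?g \<oplus>\<^bsub>R\<^esub> f = \<zero>\<^bsub>R\<^esub>"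
      by (auto simp: R_add R_zero mod_add_left_eq intro!: restrict_ext)
    ultimately show "\<exists>g\<in>carrier R. g \<oplus>\<^bsub>R\<^esub> f = \<zero>\<^bsub>R\<^esub>" by blast
  next
    fix f assume f: "f \<in> carrier R"
    show "\<zero>\<^bsub>R\<^esub> \<oplus>\<^bsub>R\<^esub> f = f"
    proof (rule R_eqI)
      show "\<zero>\<^bsub>R\<^esub> \<oplus>\<^bsub>R\<^esub> f \<in> carrier R" using f zero_R R_add_closed by blast
    qed (use f in \<open>auto simp: R_add R_zero cong_def\<close>)
  next
    fix f g assume "f \<in> carrier R" "g \<in> carrier R"
    then show "f \<oplus>\<^bsub>R\<^esub> g \<in> carrier R" by (rule R_add_closed)
  qed (auto simp: zero_R R_add add_ac mod_add_left_eq mod_add_right_eq intro!: restrict_ext)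
  show "monoid R"
  proof (rule monoidI)
    fix f g h assume c: "f \<in> carrier R" "g \<in> carrier R" "h \<in> carrier R"
    note cl = R_mult_closed
    show "f \<otimes>\<^bsub>R\<^esub> g \<otimes>\<^bsub>R\<^esub> h = f \<otimes>\<^bsub>R\<^esub> (g \<otimes>\<^bsub>R\<^esub> h)"
    proof (rule R_eqI)
      fix x assume x: "x \<in> carrier G"
      have "[(f \<otimes>\<^bsub>R\<^esub> g \<otimes>\<^bsub>R\<^esub> h) x = (\<Sum>z\<in>supp (f \<otimes>\<^bsub>R\<^esub> g). (f \<otimes>\<^bsub>R\<^esub> g) z * h (inv z \<otimes> x))] (mod q)"
        using c x cl by (intro R_mult_cong) auto
      also have "[(\<Sum>z\<in>supp (f \<otimes>\<^bsub>R\<^esub> g). (f \<otimes>\<^bsub>R\<^esub> g) z * h (inv z \<otimes> x)) = (\<Sum>y\<in>supp f. f y * (\<Sum>z\<in>supp g. g z * h (inv (y \<otimes> z) \<otimes> x)))] (mod q)"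
        using c by (intro conv_sum) auto
      also have "(\<Sum>y\<in>supp f. f y * (\<Sum>z\<in>supp g. g z * h (inv (y \<otimes> z) \<otimes> x)))
        = (\<Sum>y\<in>supp f. f y * (\<Sum>z\<in>supp g. g z * h (inv z \<otimes> (inv y \<otimes> x))))"
        using x supp_carrier
        by (intro sum.cong arg_cong2[where f="(*)"] arg_cong[where f=h]) (auto simp: inv_mult_group m_assoc subset_iff)
      also have "[(\<Sum>y\<in>supp f. f y * (\<Sum>z\<in>supp g. g z * h (inv z \<otimes> (inv y \<otimes> x)))) = (\<Sum>y\<in>supp f. f y * (g \<otimes>\<^bsub>R\<^esub> h) (inv y \<otimes> x))] (mod q)"
        using c x supp_carrier
        by (intro cong_sum cong_scalar_left cong_sym[OF R_mult_cong]) (auto simp: subset_iff)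
      also have "[(\<Sum>y\<in>supp f. f y * (g \<otimes>\<^bsub>R\<^esub> h) (inv y \<otimes> x)) = (f \<otimes>\<^bsub>R\<^esub> (g \<otimes>\<^bsub>R\<^esub> h)) x] (mod q)"
        using c x cl by (intro cong_sym[OF R_mult_cong]) auto
      finally show "[(f \<otimes>\<^bsub>R\<^esub> g \<otimes>\<^bsub>R\<^esub> h) x = (f \<otimes>\<^bsub>R\<^esub> (g \<otimes>\<^bsub>R\<^esub> h)) x] (mod q)" .
    qed (use c cl in auto)
  next
    fix f assume f: "f \<in> carrier R"
    show "\<one>\<^bsub>R\<^esub> \<otimes>\<^bsub>R\<^esub> f = f"
    proof (rule R_eqI)
      fix x assume x: "x \<in> carrier G"
      have "[(\<one>\<^bsub>R\<^esub> \<otimes>\<^bsub>R\<^esub> f) x = (\<Sum>y\<in>supp \<one>\<^bsub>R\<^esub>. \<one>\<^bsub>R\<^esub> y * f (inv y \<otimes> x))] (mod q)"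
        using f x one_R by (intro R_mult_cong)
      then show "[(\<one>\<^bsub>R\<^esub> \<otimes>\<^bsub>R\<^esub> f) x = f x] (mod q)" using x by (simp add: one_sum)
    qed (use f one_R R_mult_closed in auto)
    show "f \<otimes>\<^bsub>R\<^esub> \<one>\<^bsub>R\<^esub> = f"
    proof (rule R_eqI)
      fix x assume x: "x \<in> carrier G"
      have "[(f \<otimes>\<^bsub>R\<^esub> \<one>\<^bsub>R\<^esub>) x = (\<Sum>y\<in>supp f. f y * \<one>\<^bsub>R\<^esub> (inv y \<otimes> x))] (mod q)"
        using f x one_R by (intro R_mult_cong)
      also have "(\<Sum>y\<in>supp f. f y * \<one>\<^bsub>R\<^esub> (inv y \<otimes> x)) = (\<Sum>y\<in>supp f. if y = x then f y else 0)"
      proof (intro sum.cong refl)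
        fix y assume "y \<in> supp f"
        then have y: "y \<in> carrier G" using supp_carrier by auto
        have "inv y \<otimes> x = \<one> \<longleftrightarrow> y = x" using x y by (metis inv_equality inv_inv inv_closed l_inv)
        then show "f y * \<one>\<^bsub>R\<^esub> (inv y \<otimes> x) = (if y = x then f y else 0)" using x y by (simp add: R_one)
      qed
      also have "\<dots> = f x" using R_supp[OF f] x by (auto simp: sum.delta supp_def)
      finally show "[(f \<otimes>\<^bsub>R\<^esub> \<one>\<^bsub>R\<^esub>) x = f x] (mod q)" .
    qed (use f one_R R_mult_closed in auto)
  qed (auto simp: R_mult_closed one_R)
next
  fix f g h assume c: "f \<in> carrier R" "g \<in> carrier R" "h \<in> carrier R"
  note cl = R_mult_closed R_add_closed
  show "(f \<oplus>\<^bsub>R\<^esub> g) \<otimes>\<^bsub>R\<^esub> h = f \<otimes>\<^bsub>R\<^esub> h \<oplus>\<^bsub>R\<^esub> g \<otimes>\<^bsub>R\<^esub> h"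
  proof (rule R_eqI)
    fix x assume x: "x \<in> carrier G"
    have "[((f \<oplus>\<^bsub>R\<^esub> g) \<otimes>\<^bsub>R\<^esub> h) x = (\<Sum>z\<in>supp (f \<oplus>\<^bsub>R\<^esub> g). (f \<oplus>\<^bsub>R\<^esub> g) z * h (inv z \<otimes> x))] (mod q)"
      using c x cl by (intro R_mult_cong) auto
    also have "[(\<Sum>z\<in>supp (f \<oplus>\<^bsub>R\<^esub> g). (f \<oplus>\<^bsub>R\<^esub> g) z * h (inv z \<otimes> x)) = (\<Sum>z\<in>supp f. f z * h (inv z \<otimes> x)) + (\<Sum>z\<in>supp g. g z * h (inv z \<otimes> x))] (mod q)"
      using c by (intro add_sum)
    also have "[(\<Sum>z\<in>supp f. f z * h (inv z \<otimes> x)) + (\<Sum>z\<in>supp g. g z * h (inv z \<otimes> x)) = (f \<otimes>\<^bsub>R\<^esub> h) x + (g \<otimes>\<^bsub>R\<^esub> h) x] (mod q)"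
      using c x by (intro cong_add cong_sym[OF R_mult_cong])
    also have "[(f \<otimes>\<^bsub>R\<^esub> h) x + (g \<otimes>\<^bsub>R\<^esub> h) x = (f \<otimes>\<^bsub>R\<^esub> h \<oplus>\<^bsub>R\<^esub> g \<otimes>\<^bsub>R\<^esub> h) x] (mod q)"
      using x by (intro cong_sym[OF R_add_cong])
    finally show "[((f \<oplus>\<^bsub>R\<^esub> g) \<otimes>\<^bsub>R\<^esub> h) x = (f \<otimes>\<^bsub>R\<^esub> h \<oplus>\<^bsub>R\<^esub> g \<otimes>\<^bsub>R\<^esub> h) x] (mod q)" .
  qed (use c cl in auto)
  show "h \<otimes>\<^bsub>R\<^esub> (f \<oplus>\<^bsub>R\<^esub> g) = h \<otimes>\<^bsub>R\<^esub> f \<oplus>\<^bsub>R\<^esub> h \<otimes>\<^bsub>R\<^esub> g"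
  proof (rule R_eqI)
    fix x assume x: "x \<in> carrier G"
    have "[(h \<otimes>\<^bsub>R\<^esub> (f \<oplus>\<^bsub>R\<^esub> g)) x = (\<Sum>z\<in>supp h. h z * (f \<oplus>\<^bsub>R\<^esub> g) (inv z \<otimes> x))] (mod q)"
      using c x cl by (intro R_mult_cong) auto
    also have "[(\<Sum>z\<in>supp h. h z * (f \<oplus>\<^bsub>R\<^esub> g) (inv z \<otimes> x)) = (\<Sum>z\<in>supp h. h z * (f (inv z \<otimes> x) + g (inv z \<otimes> x)))] (mod q)"
      using x supp_carrier by (intro cong_sum cong_scalar_left R_add_cong) (auto simp: subset_iff)
    also have "(\<Sum>z\<in>supp h. h z * (f (inv z \<otimes> x) + g (inv z \<otimes> x))) =
       (\<Sum>z\<in>supp h. h z * f (inv z \<otimes> x)) + (\<Sum>z\<in>supp h. h z * g (inv z \<otimes> x))"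
      by (simp add: distrib_left sum.distrib)
    also have "[(\<Sum>z\<in>supp h. h z * f (inv z \<otimes> x)) + (\<Sum>z\<in>supp h. h z * g (inv z \<otimes> x)) = (h \<otimes>\<^bsub>R\<^esub> f) x + (h \<otimes>\<^bsub>R\<^esub> g) x] (mod q)"
      using c x by (intro cong_add cong_sym[OF R_mult_cong])
    also have "[(h \<otimes>\<^bsub>R\<^esub> f) x + (h \<otimes>\<^bsub>R\<^esub> g) x = (h \<otimes>\<^bsub>R\<^esub> f \<oplus>\<^bsub>R\<^esub> h \<otimes>\<^bsub>R\<^esub> g) x] (mod q)"
      using x by (intro cong_sym[OF R_add_cong])
    finally show "[(h \<otimes>\<^bsub>R\<^esub> (f \<oplus>\<^bsub>R\<^esub> g)) x = (h \<otimes>\<^bsub>R\<^esub> f \<oplus>\<^bsub>R\<^esub> h \<otimes>\<^bsub>R\<^esub> g) x] (mod q)" .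
  qed (use c cl in auto)
qed

section \<open>Clopen subsets of a group\<close>

abbreviation FIN :: "'a set set" where "FIN \<equiv> finite_index_normal G"
abbreviation Mo where "Mo \<equiv> completed_group_ring_module K G"
abbreviation scale_Mo (infixl "\<bullet>" 70) where "f \<bullet> u \<equiv> f \<odot>\<^bsub>Mo\<^esub> u"
abbreviation add_Mo (infixl "\<boxplus>" 65) where "u \<boxplus> v \<equiv> u \<oplus>\<^bsub>Mo\<^esub> v"

text \<open>Clopen sets are the preimages in \<open>G\<close> of the open and closed subsets of the profinite completion.
  They are unions of cosets of one normal subgroup \<open>N\<close> of finite index.\<close>

definition saturated :: "'a set \<Rightarrow> 'a set \<Rightarrow> bool" where
  "saturated N A \<longleftrightarrow> A \<subseteq> carrier G \<and> (\<forall>a\<in>A. N #> a \<subseteq> A)"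

definition clopen :: "'a set \<Rightarrow> bool" where
  "clopen A \<longleftrightarrow> (\<exists>N\<in>FIN. saturated N A)"

definition cosets_in :: "'a set \<Rightarrow> 'a set \<Rightarrow> 'a set set" where
  "cosets_in N A = {C \<in> rcosets N. C \<subseteq> A}"

lemma FIN_normal: "N \<in> FIN \<Longrightarrow> N \<lhd> G" by (simp add: finite_index_normal_def)
lemma FIN_subgroup: "N \<in> FIN \<Longrightarrow> subgroup N G" using FIN_normal normal_imp_subgroup by blast
lemma FIN_finite: "N \<in> FIN \<Longrightarrow> finite (rcosets N)" by (simp add: finite_index_normal_def)
lemma finite_cosets_in: "N \<in> FIN \<Longrightarrow> finite (cosets_in N A)"
  using FIN_finite by (simp add: cosets_in_def)

lemma subgroup_rcosetsI: "subgroup N G \<Longrightarrow> x \<in> carrier G \<Longrightarrow> N #> x \<in> rcosets N"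
  using rcosetsI subgroup.subset by blast

lemma rcoset_eq:
  assumes "subgroup N G" "C \<in> rcosets N" "x \<in> C"
  shows "C = N #> x" "x \<in> carrier G"
proof -
  obtain y where y: "y \<in> carrier G" "C = N #> y" using assms(2) by (auto simp: RCOSETS_def)
  show "x \<in> carrier G" using assms y r_coset_subset_G subgroup.subset by blast
  show "C = N #> x" using repr_independence[of x N y] assms y by simp
qed

lemma rcoset_nonempty:
  assumes "subgroup N G" "C \<in> rcosets N" obtains x where "x \<in> C" "x \<in> carrier G" "C = N #> x"
  using assms rcos_self by (auto simp: RCOSETS_def)

lemma rcoset_subset: "subgroup N G \<Longrightarrow> C \<in> rcosets N \<Longrightarrow> C \<subseteq> carrier G"
  using rcoset_eq(2) by blast

lemma saturated_rcoset_cases: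
  "subgroup N G \<Longrightarrow> saturated N A \<Longrightarrow> C \<in> rcosets N \<Longrightarrow> x \<in> C \<Longrightarrow> x \<in> A \<Longrightarrow> C \<subseteq> A"
  unfolding saturated_def using rcoset_eq by metis

lemma Union_cosets_in:
  assumes "subgroup N G" "saturated N A" shows "\<Union> (cosets_in N A) = A"
proof
  show "\<Union> (cosets_in N A) \<subseteq> A" by (auto simp: cosets_in_def)
  show "A \<subseteq> \<Union> (cosets_in N A)"
  proof
    fix x assume x: "x \<in> A"
    then have xc: "x \<in> carrier G" and s: "N #> x \<subseteq> A" using assms by (auto simp: saturated_def)
    then show "x \<in> \<Union> (cosets_in N A)"
      using subgroup_rcosetsI[OF assms(1) xc] rcos_self[OF xc assms(1)]
      by (auto simp: cosets_in_def)
  qed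
qed

lemma saturated_mono: "N' \<subseteq> N \<Longrightarrow> saturated N A \<Longrightarrow> saturated N' A"
  unfolding saturated_def r_coset_def by blast

lemma saturated_rcoset: "subgroup N G \<Longrightarrow> C \<in> rcosets N \<Longrightarrow> saturated N C"
  unfolding saturated_def using rcoset_eq rcoset_subset by blast

lemma clopen_rcoset: "N \<in> FIN \<Longrightarrow> C \<in> rcosets N \<Longrightarrow> clopen C"
  using saturated_rcoset FIN_subgroup unfolding clopen_def by blast

lemma clopen_carrier: "clopen A \<Longrightarrow> A \<subseteq> carrier G"
  by (auto simp: clopen_def saturated_def)

lemma cosets_in_rcoset:
  assumes "subgroup N G" "C \<in> rcosets N" shows "cosets_in N C = {C}"
proof -
  have "D = C" if D: "D \<in> rcosets N" "D \<subseteq> C" for D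
  proof -
    obtain x where "x \<in> D" "D = N #> x" using rcoset_nonempty[OF assms(1) D(1)] by blast
    then show ?thesis using rcoset_eq[OF assms] D(2) by blast
  qed
  then show ?thesis using assms by (auto simp: cosets_in_def)
qed

lemma FIN_Int:
  assumes "N \<in> FIN" "M \<in> FIN" shows "N \<inter> M \<in> FIN"
proof -
  have sN: "subgroup N G" and sM: "subgroup M G" using assms FIN_subgroup by auto
  have "rcosets (N \<inter> M) \<subseteq> (\<lambda>(C, D). C \<inter> D) ` ((rcosets N) \<times> (rcosets M))"
  proof
    fix E assume "E \<in> rcosets (N \<inter> M)"
    then obtain x where x: "x \<in> carrier G" "E = (N \<inter> M) #> x" by (auto simp: RCOSETS_def)
    have "E = (N #> x) \<inter> (M #> x)"
    proof
      show "E \<subseteq> (N #> x) \<inter> (M #> x)" using x by (auto simp: r_coset_def)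
      show "(N #> x) \<inter> (M #> x) \<subseteq> E"
      proof
        fix y assume "y \<in> (N #> x) \<inter> (M #> x)"
        then obtain n m where nm: "n \<in> N" "m \<in> M" "y = n \<otimes> x" "y = m \<otimes> x" by (auto simp: r_coset_def)
        then have "n = m" using x(1) sN sM subgroup.mem_carrier by (metis right_cancel)
        then show "y \<in> E" using nm x by (auto simp: r_coset_def)
      qed
    qed
    then show "E \<in> (\<lambda>(C, D). C \<inter> D) ` ((rcosets N) \<times> (rcosets M))"
      using subgroup_rcosetsI[OF sN x(1)] subgroup_rcosetsI[OF sM x(1)] by auto
  qed
  then have "finite (rcosets (N \<inter> M))" using assms FIN_finite by (meson finite_SigmaI finite_imageI finite_subset)
  moreover have "N \<inter> M \<lhd> G" using assms FIN_normal normal_subgroup_intersect by blast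
  ultimately show ?thesis by (simp add: finite_index_normal_def)
qed

lemma clopen_common:
  assumes "clopen A" "clopen A'" obtains N where "N \<in> FIN" "saturated N A" "saturated N A'"
proof -
  obtain N M where "N \<in> FIN" "M \<in> FIN" "saturated N A" "saturated M A'"
    using assms by (auto simp: clopen_def)
  then show ?thesis using that[of "N \<inter> M"] FIN_Int saturated_mono by blast
qed

lemma saturated_Un: "saturated N A \<Longrightarrow> saturated N A' \<Longrightarrow> saturated N (A \<union> A')"
  unfolding saturated_def by blast

lemma clopen_Un: "clopen A \<Longrightarrow> clopen A' \<Longrightarrow> clopen (A \<union> A')"
proof -
  assume "clopen A" "clopen A'"
  then obtain N where "N \<in> FIN" "saturated N A" "saturated N A'" by (rule clopen_common)
  then show ?thesis using saturated_Un unfolding clopen_def by blast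
qed

lemma saturated_Int: "saturated N A \<Longrightarrow> saturated N A' \<Longrightarrow> saturated N (A \<inter> A')"
  by (auto simp: saturated_def)

lemma clopen_Int: "clopen A \<Longrightarrow> clopen A' \<Longrightarrow> clopen (A \<inter> A')"
proof -
  assume "clopen A" "clopen A'"
  then obtain N where "N \<in> FIN" "saturated N A" "saturated N A'" by (rule clopen_common)
  then show ?thesis using saturated_Int unfolding clopen_def by blast
qed

lemma clopen_Diff:
  assumes "clopen A" "clopen A'" shows "clopen (A - A')"
proof -
  obtain N where N: "N \<in> FIN" "saturated N A" "saturated N A'" using clopen_common[OF assms] .
  have s: "subgroup N G" using N FIN_subgroup by blast
  have "saturated N (A - A')" unfolding saturated_def
  proof (intro conjI ballI subsetI)
    fix a b assume a: "a \<in> A - A'" and b: "b \<in> N #> a"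
    have ac: "a \<in> carrier G" using a N by (auto simp: saturated_def)
    have "b \<in> A" using a b N by (auto simp: saturated_def)
    moreover have "b \<notin> A'"
    proof
      assume "b \<in> A'"
      then have "N #> a \<subseteq> A'"
        using saturated_rcoset_cases[OF s N(3) subgroup_rcosetsI[OF s ac] b] by blast
      then show False using a rcos_self[OF ac s] by blast
    qed
    ultimately show "b \<in> A - A'" by blast
  qed (use N in \<open>auto simp: saturated_def\<close>)
  then show ?thesis using N by (auto simp: clopen_def)
qed

lemma carrier_FIN: "carrier G \<in> FIN"
proof -
  have s: "subgroup (carrier G) G" by (rule subgroup_self)
  have "carrier G \<lhd> G" by (intro normalI s) (simp add: coset_join2[OF _ s] coset_join3[OF _ s])
  moreover have "rcosets (carrier G) \<subseteq> {carrier G}"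
    using s coset_join2 by (auto simp: RCOSETS_def)
  ultimately show ?thesis by (auto simp: finite_index_normal_def dest: finite_subset)
qed

lemma clopen_empty: "clopen {}"
  using carrier_FIN by (auto simp: clopen_def saturated_def)

lemma clopen_UN: "finite I \<Longrightarrow> (\<And>i. i \<in> I \<Longrightarrow> clopen (A i)) \<Longrightarrow> clopen (\<Union>i\<in>I. A i)"
  by (induct I rule: finite_induct) (auto simp: clopen_empty clopen_Un)

lemma mem_translate: "x \<in> carrier G \<Longrightarrow> A \<subseteq> carrier G \<Longrightarrow> y \<in> x <# A \<longleftrightarrow> y \<in> carrier G \<and> inv x \<otimes> y \<in> A"
proof -
  assume x: "x \<in> carrier G" and A: "A \<subseteq> carrier G"
  show ?thesis
  proof
    assume "y \<in> x <# A"
    then obtain a where "a \<in> A" "y = x \<otimes> a" by (auto simp: l_coset_def)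
    then show "y \<in> carrier G \<and> inv x \<otimes> y \<in> A" using x A by (auto simp flip: m_assoc)
  next
    assume "y \<in> carrier G \<and> inv x \<otimes> y \<in> A"
    then show "y \<in> x <# A" using x unfolding l_coset_def
      by (auto intro!: bexI[of _ "inv x \<otimes> y"] simp flip: m_assoc)
  qed
qed

lemma translate_rcoset:
  assumes N: "N \<lhd> G" and "x \<in> carrier G" "g \<in> carrier G"
  shows "x <# (N #> g) = N #> (x \<otimes> g)"
proof -
  have s: "N \<subseteq> carrier G" using N normal_imp_subgroup subgroup.subset by blast
  have "x <# (N #> g) = (x <# N) #> g" using coset_assoc[of x g N] assms s by simp
  also have "x <# N = N #> x" using normal.coset_eq[OF N] assms by simp
  also have "(N #> x) #> g = N #> (x \<otimes> g)" using s assms by (simp add: coset_mult_assoc)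
  finally show ?thesis .
qed

lemma translate_in_rcosets:
  assumes N: "N \<lhd> G" and "x \<in> carrier G" "C \<in> rcosets N"
  shows "x <# C \<in> rcosets N"
proof -
  have s: "subgroup N G" using N normal_imp_subgroup by blast
  then obtain g where g: "g \<in> carrier G" "C = N #> g" using rcoset_nonempty[OF s assms(3)] by blast
  then show ?thesis using translate_rcoset[OF N assms(2) g(1)] subgroup_rcosetsI[OF s] assms by simp
qed

lemma saturated_translate:
  assumes N: "N \<lhd> G" and x: "x \<in> carrier G" and A: "saturated N A"
  shows "saturated N (x <# A)"
  unfolding saturated_def
proof (intro conjI ballI)
  have Ac: "A \<subseteq> carrier G" using A by (simp add: saturated_def)
  show "x <# A \<subseteq> carrier G" using l_coset_subset_G Ac x by blast
  fix b assume "b \<in> x <# A"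
  then obtain a where a: "a \<in> A" "b = x \<otimes> a" by (auto simp: l_coset_def)
  then have "N #> b = x <# (N #> a)" using translate_rcoset[OF N x] Ac by auto
  moreover have "N #> a \<subseteq> A" using A a by (simp add: saturated_def)
  ultimately show "N #> b \<subseteq> x <# A" by (auto simp: l_coset_def)
qed

lemma clopen_translate: "clopen A \<Longrightarrow> x \<in> carrier G \<Longrightarrow> clopen (x <# A)"
  unfolding clopen_def using saturated_translate FIN_normal by blast

lemma translate_translate: "A \<subseteq> carrier G \<Longrightarrow> x \<in> carrier G \<Longrightarrow> y \<in> carrier G \<Longrightarrow> x <# (y <# A) = (x \<otimes> y) <# A"
  by (rule lcos_m_assoc)

lemma translate_Un: "x <# (A \<union> A') = (x <# A) \<union> (x <# A')"
  by (auto simp: l_coset_def)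

lemma translate_Int: "x \<in> carrier G \<Longrightarrow> A \<subseteq> carrier G \<Longrightarrow> A' \<subseteq> carrier G \<Longrightarrow> (x <# A) \<inter> (x <# A') = x <# (A \<inter> A')"
  by (auto simp: mem_translate le_infI1)

text \<open>An element of the inverse limit without the compatibility condition.\<close>

definition coefficient_family :: "('a set \<Rightarrow> 'a set \<Rightarrow> int) \<Rightarrow> bool" where
  "coefficient_family u \<longleftrightarrow> u \<in> (\<Pi>\<^sub>E N\<in>FIN. (rcosets N) \<rightarrow>\<^sub>E carrier K)"

lemma carrier_quotient_ring: "N \<in> FIN \<Longrightarrow> carrier (group_ring K (G Mod N)) = (rcosets N) \<rightarrow>\<^sub>E carrier K"
  using FIN_finite by (auto simp: group_ring_def FactGroup_def)

lemma refine_rcoset: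
  assumes "subgroup N G" "subgroup M G" "N \<subseteq> M" "x \<in> carrier G"
  shows "M <#> (N #> x) = M #> x"
proof -
  have "M <#> N = M"
  proof
    show "M <#> N \<subseteq> M" using assms subgroup.m_closed[OF assms(2)] by (auto simp: set_mult_def)
    show "M \<subseteq> M <#> N"
    proof
      fix x assume "x \<in> M"
      then have "x = x \<otimes> \<one>" using subgroup.mem_carrier[OF assms(2)] by simp
      then show "x \<in> M <#> N" using \<open>x \<in> M\<close> subgroup.one_closed[OF assms(1)] unfolding set_mult_def by blast
    qed
  qed
  then show ?thesis using assms by (simp add: setmult_rcos_assoc subgroup.subset)
qed

text \<open>For cosets the equation \<open>M <#> C = D\<close> just means \<open>C \<subseteq> D\<close>.\<close>

lemma push_forward:
  assumes u: "coefficient_family u" and N: "N \<in> FIN" and M: "M \<in> FIN" and NM: "N \<subseteq> M"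
  shows "group_ring_map K (G Mod N) (G Mod M) (\<lambda>C. M <#> C) (u N) =
    (\<lambda>D\<in>rcosets M. (\<Sum>C\<in>cosets_in N D. u N C) mod q)"
proof -
  have s: "subgroup N G" "subgroup M G" using N M FIN_subgroup by auto
  have eq: "M <#> C = D \<longleftrightarrow> C \<subseteq> D" if C: "C \<in> rcosets N" and D: "D \<in> rcosets M" for C D
  proof -
    obtain x where x: "x \<in> C" "x \<in> carrier G" "C = N #> x" using rcoset_nonempty[OF s(1) C] .
    have "M <#> C = M #> x" using refine_rcoset[OF s NM x(2)] x(3) by simp
    moreover have "C \<subseteq> M #> x" using x(3) NM by (auto simp: r_coset_def)
    moreover have "D = M #> x" if "C \<subseteq> D" using rcoset_eq[OF s(2) D] x that by blast
    ultimately show ?thesis by auto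
  qed
  show ?thesis unfolding group_ring_map_def FactGroup_def partial_object.simps
  proof (rule restrict_ext)
    fix D assume D: "D \<in> rcosets M"
    have val: "u N C \<in> carrier K" if "C \<in> rcosets N" for C
      using u N that unfolding coefficient_family_def by (metis PiE_mem)
    have "finsum K (u N) {x \<in> rcosets N. u N x \<noteq> \<zero>\<^bsub>K\<^esub> \<and> M <#> x = D}
      = (\<Sum>C\<in>{x \<in> rcosets N. u N x \<noteq> \<zero>\<^bsub>K\<^esub> \<and> M <#> x = D}. u N C) mod q"
      using val by (intro finsum_K) auto
    also have "(\<Sum>C\<in>{x \<in> rcosets N. u N x \<noteq> \<zero>\<^bsub>K\<^esub> \<and> M <#> x = D}. u N C) = (\<Sum>C\<in>cosets_in N D. u N C)"
      using FIN_finite[OF N] eq D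
      by (intro sum.mono_neutral_left) (auto simp: cosets_in_def K_simps)
    finally show "finsum K (u N) {x \<in> rcosets N. u N x \<noteq> \<zero>\<^bsub>K\<^esub> \<and> M <#> x = D} 
      = (\<Sum>C\<in>cosets_in N D. u N C) mod q" .
  qed
qed

lemma Mo_simps:
  "carrier Mo = carrier (completed_group_ring K G)" "\<zero>\<^bsub>Mo\<^esub> = \<zero>\<^bsub>completed_group_ring K G\<^esub>"
  "x \<oplus>\<^bsub>Mo\<^esub> y = x \<oplus>\<^bsub>completed_group_ring K G\<^esub> y"
  "f \<odot>\<^bsub>Mo\<^esub> u = to_completed_group_ring K G f \<otimes>\<^bsub>completed_group_ring K G\<^esub> u"
  by (simp_all add: completed_group_ring_module_def ring.defs module.defs)

text \<open>Compatibility of the components is finite additivity on cosets.\<close>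

lemma Mo_carrier:
  "u \<in> carrier Mo \<longleftrightarrow> coefficient_family u \<and> (\<forall>N\<in>FIN. \<forall>M\<in>FIN. N \<subseteq> M \<longrightarrow> (\<forall>D\<in>rcosets M.
     u M D = (\<Sum>C\<in>cosets_in N D. u N C) mod q))"
proof -
  have P: "(u \<in> (\<Pi>\<^sub>E N\<in>FIN. carrier (group_ring K (G Mod N)))) = coefficient_family u"
    unfolding coefficient_family_def using carrier_quotient_ring by (metis (mono_tags, lifting) PiE_cong)
  have ext: "u M = (\<lambda>D\<in>rcosets M. u M D)" if "coefficient_family u" "M \<in> FIN" for M
    using that unfolding coefficient_family_def by (metis PiE_mem PiE_restrict)
  have eq: "group_ring_map K (G Mod N) (G Mod M) (\<lambda>C. M <#> C) (u N) = u M \<longleftrightarrow> 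
     (\<forall>D\<in>rcosets M. u M D = (\<Sum>C\<in>cosets_in N D. u N C) mod q)"
    if a: "coefficient_family u" "N \<in> FIN" "M \<in> FIN" "N \<subseteq> M" for N M
    unfolding push_forward[OF a]
  proof
    assume h: "(\<lambda>D\<in>rcosets M. (\<Sum>C\<in>cosets_in N D. u N C) mod q) = u M"
    show "\<forall>D\<in>rcosets M. u M D = (\<Sum>C\<in>cosets_in N D. u N C) mod q"
      unfolding h[symmetric] by simp
  next
    assume h: "\<forall>D\<in>rcosets M. u M D = (\<Sum>C\<in>cosets_in N D. u N C) mod q"
    have "(\<lambda>D\<in>rcosets M. (\<Sum>C\<in>cosets_in N D. u N C) mod q) = (\<lambda>D\<in>rcosets M. u M D)"
      by (rule restrict_ext) (use h in simp)
    then show "(\<lambda>D\<in>rcosets M. (\<Sum>C\<in>cosets_in N D. u N C) mod q) = u M" 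
      using ext[OF a(1,3)] by (rule trans[OF _ sym])
  qed
  show ?thesis unfolding Mo_simps completed_group_ring_def partial_object.simps mem_Collect_eq P
    by (intro conj_cong ball_cong imp_cong refl) (rule eq)
qed

section \<open>Elements of the completed group ring as measures\<close>

text \<open>The measure of \<open>A\<close> is the sum of the coefficients of the cosets contained in \<open>A\<close>, for any \<open>N\<close> that
  saturates \<open>A\<close>; by compatibility the choice of \<open>N\<close> does not matter (\<open>mass_eq\<close>).\<close>

definition mass :: "('a set \<Rightarrow> 'a set \<Rightarrow> int) \<Rightarrow> 'a set \<Rightarrow> int" where
  "mass u A = (let N = SOME N. N \<in> FIN \<and> saturated N A in (\<Sum>C\<in>cosets_in N A. u N C) mod q)"

text \<open>Measures are integer valued here and matter only modulo \<open>p\<close> and on clopen sets, so that they can be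
  built by integer arithmetic. The map \<open>family\<close> turns them into elements of the inverse limit.\<close>

definition is_measure :: "('a set \<Rightarrow> int) \<Rightarrow> bool" where
  "is_measure \<mu> \<longleftrightarrow> (\<forall>A A'. clopen A \<longrightarrow> clopen A' \<longrightarrow> A \<inter> A' = {} \<longrightarrow>
     [\<mu> (A \<union> A') = \<mu> A + \<mu> A'] (mod q))"

definition family :: "('a set \<Rightarrow> int) \<Rightarrow> 'a set \<Rightarrow> 'a set \<Rightarrow> int" where
  "family \<mu> = (\<lambda>N\<in>FIN. \<lambda>C\<in>rcosets N. \<mu> C mod q)"

lemma Mo_val: "u \<in> carrier Mo \<Longrightarrow> N \<in> FIN \<Longrightarrow> C \<in> rcosets N \<Longrightarrow> u N C \<in> carrier K"
  unfolding Mo_carrier coefficient_family_def by (metis PiE_mem)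

lemma cosets_in_refine:
  assumes "subgroup N' G" "subgroup N G" "N' \<subseteq> N" "saturated N A"
  shows "cosets_in N' A = (\<Union>D\<in>cosets_in N A. cosets_in N' D)"
proof
  show "(\<Union>D\<in>cosets_in N A. cosets_in N' D) \<subseteq> cosets_in N' A" by (auto simp: cosets_in_def)
  show "cosets_in N' A \<subseteq> (\<Union>D\<in>cosets_in N A. cosets_in N' D)"
  proof
    fix C assume "C \<in> cosets_in N' A"
    then have C: "C \<in> rcosets N'" "C \<subseteq> A" by (auto simp: cosets_in_def)
    obtain x where x: "x \<in> C" "x \<in> carrier G" "C = N' #> x" using rcoset_nonempty[OF assms(1) C(1)] .
    then have "N #> x \<in> cosets_in N A"
      using C assms subgroup_rcosetsI by (auto simp: cosets_in_def saturated_def)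
    moreover have "C \<in> cosets_in N' (N #> x)"
      using C x assms(3) by (auto simp: cosets_in_def r_coset_def)
    ultimately show "C \<in> (\<Union>D\<in>cosets_in N A. cosets_in N' D)" by blast
  qed
qed

lemma sum_cosets_refine:
  fixes \<mu> :: "'a set \<Rightarrow> int"
  assumes N: "N' \<in> FIN" "N \<in> FIN" "N' \<subseteq> N" "saturated N A"
  shows "(\<Sum>C\<in>cosets_in N' A. \<mu> C) = (\<Sum>D\<in>cosets_in N A. \<Sum>C\<in>cosets_in N' D. \<mu> C)"
proof -
  have s: "subgroup N' G" "subgroup N G" using N FIN_subgroup by auto
  show ?thesis unfolding cosets_in_refine[OF s N(3,4)]
  proof (rule sum.UNION_disjoint)
    show "\<forall>D\<in>cosets_in N A. \<forall>D'\<in>cosets_in N A. D \<noteq> D' \<longrightarrow> cosets_in N' D \<inter> cosets_in N' D' = {}"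
    proof (intro ballI impI equals0I)
      fix D D' C assume D: "D \<in> cosets_in N A" "D' \<in> cosets_in N A" "D \<noteq> D'"
        and C: "C \<in> cosets_in N' D \<inter> cosets_in N' D'"
      then have "C \<in> rcosets N'" by (simp add: cosets_in_def)
      then obtain x where "x \<in> C" by (rule rcoset_nonempty[OF s(1)])
      then have "x \<in> D" "x \<in> D'" using C by (auto simp: cosets_in_def)
      then show False using D rcoset_eq[OF s(2)] unfolding cosets_in_def by blast
    qed
  qed (use N finite_cosets_in in auto)
qed

lemma mass_refine:
  assumes u: "u \<in> carrier Mo" and N: "N' \<in> FIN" "N \<in> FIN" "N' \<subseteq> N" "saturated N A"
  shows "(\<Sum>C\<in>cosets_in N' A. u N' C) mod q = (\<Sum>C\<in>cosets_in N A. u N C) mod q"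
proof -
  have "(\<Sum>C\<in>cosets_in N A. u N C) = (\<Sum>D\<in>cosets_in N A. (\<Sum>C\<in>cosets_in N' D. u N' C) mod q)"
  proof (rule sum.cong)
    fix D assume "D \<in> cosets_in N A"
    then have "D \<in> rcosets N" by (simp add: cosets_in_def)
    then show "u N D = (\<Sum>C\<in>cosets_in N' D. u N' C) mod q"
      using u[unfolded Mo_carrier, THEN conjunct2, rule_format, OF N(1,2,3)] by simp
  qed simp
  then show ?thesis using sum_cosets_refine[OF N] by (simp add: mod_sum_eq)
qed

lemma mass_eq:
  assumes u: "u \<in> carrier Mo" and N: "N \<in> FIN" "saturated N A"
  shows "mass u A = (\<Sum>C\<in>cosets_in N A. u N C) mod q"
proof -
  define M where "M = (SOME N. N \<in> FIN \<and> saturated N A)"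
  have M: "M \<in> FIN" "saturated M A"
    using someI[of "\<lambda>N. N \<in> FIN \<and> saturated N A", OF conjI[OF N]] by (auto simp: M_def)
  have I: "N \<inter> M \<in> FIN" using FIN_Int N M by blast
  have "(\<Sum>C\<in>cosets_in N A. u N C) mod q = (\<Sum>C\<in>cosets_in M A. u M C) mod q"
    using mass_refine[OF u I N(1) _ N(2)] mass_refine[OF u I M(1) _ M(2)] by simp
  then show ?thesis by (simp add: mass_def M_def Let_def)
qed

lemma mass_mod: "mass u A mod q = mass u A"
  by (simp add: mass_def Let_def)

lemma mass_rcoset:
  assumes "u \<in> carrier Mo" "N \<in> FIN" "C \<in> rcosets N" shows "mass u C = u N C"
  using assms mass_eq[OF assms(1,2) saturated_rcoset] FIN_subgroup cosets_in_rcoset Mo_val[OF assms] carrier_mod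
  by simp

lemma mass_measure: "u \<in> carrier Mo \<Longrightarrow> is_measure (mass u)"
  unfolding is_measure_def
proof (intro allI impI)
  fix A A' assume u: "u \<in> carrier Mo" and A: "clopen A" "clopen A'" "A \<inter> A' = {}"
  obtain N where N: "N \<in> FIN" "saturated N A" "saturated N A'" using clopen_common[OF A(1,2)] .
  have s: "subgroup N G" using N FIN_subgroup by blast
  have "cosets_in N (A \<union> A') = cosets_in N A \<union> cosets_in N A'"
  proof
    show "cosets_in N (A \<union> A') \<subseteq> cosets_in N A \<union> cosets_in N A'"
    proof
      fix C assume "C \<in> cosets_in N (A \<union> A')"
      then have C: "C \<in> rcosets N" "C \<subseteq> A \<union> A'" by (auto simp: cosets_in_def)
      obtain x where x: "x \<in> C" using C(1) by (rule rcoset_nonempty[OF s])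
      then have "C \<subseteq> A \<or> C \<subseteq> A'" using C saturated_rcoset_cases[OF s _ C(1) x] N by blast
      then show "C \<in> cosets_in N A \<union> cosets_in N A'" using C by (auto simp: cosets_in_def)
    qed
  qed (auto simp: cosets_in_def)
  moreover have "cosets_in N A \<inter> cosets_in N A' = {}"
  proof (intro equals0I)
    fix C assume C: "C \<in> cosets_in N A \<inter> cosets_in N A'"
    then have "C \<in> rcosets N" by (simp add: cosets_in_def)
    then obtain x where "x \<in> C" by (rule rcoset_nonempty[OF s])
    then show False using C A(3) by (auto simp: cosets_in_def)
  qed
  ultimately have "(\<Sum>C\<in>cosets_in N (A \<union> A'). u N C) = (\<Sum>C\<in>cosets_in N A. u N C) + (\<Sum>C\<in>cosets_in N A'. u N C)"
    using finite_cosets_in[OF N(1)] by (simp add: sum.union_disjoint)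
  then show "[mass u (A \<union> A') = mass u A + mass u A'] (mod q)"
    using mass_eq[OF u N(1)] N saturated_Un by (simp add: cong_def mod_add_eq)
qed

lemma measure_empty: "is_measure \<mu> \<Longrightarrow> [\<mu> {} = 0] (mod q)"
proof -
  assume "is_measure \<mu>"
  then have "[\<mu> ({} \<union> {}) = \<mu> {} + \<mu> {}] (mod q)"
    unfolding is_measure_def using clopen_empty by blast
  then have "[\<mu> {} + 0 = \<mu> {} + \<mu> {}] (mod q)" by simp
  then show ?thesis using cong_add_lcancel cong_sym by blast
qed

lemma measure_UN:
  assumes \<mu>: "is_measure \<mu>"
  shows "finite I \<Longrightarrow> (\<And>i. i \<in> I \<Longrightarrow> clopen (A i)) \<Longrightarrow> (\<And>i j. i \<in> I \<Longrightarrow> j \<in> I \<Longrightarrow> i \<noteq> j \<Longrightarrow> A i \<inter> A j = {})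
    \<Longrightarrow> [\<mu> (\<Union>i\<in>I. A i) = (\<Sum>i\<in>I. \<mu> (A i))] (mod q)"
proof (induct I rule: finite_induct)
  case empty
  then show ?case using measure_empty[OF \<mu>] by simp
next
  case (insert i I)
  have "A i \<inter> (\<Union>j\<in>I. A j) = {}" using insert by blast
  moreover have "clopen (A i)" "clopen (\<Union>j\<in>I. A j)"
    using insert(1,4) by (simp, intro clopen_UN) auto
  ultimately have "[\<mu> (A i \<union> (\<Union>j\<in>I. A j)) = \<mu> (A i) + \<mu> (\<Union>j\<in>I. A j)] (mod q)"
    using \<mu> by (simp add: is_measure_def)
  moreover have "[\<mu> (A i) + \<mu> (\<Union>j\<in>I. A j) = \<mu> (A i) + (\<Sum>j\<in>I. \<mu> (A j))] (mod q)"
    using insert by (intro cong_add cong_refl) auto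
  ultimately show ?case using insert by (simp add: cong_trans)
qed

lemma rcosets_disjoint:
  "subgroup N G \<Longrightarrow> C \<in> rcosets N \<Longrightarrow> D \<in> rcosets N \<Longrightarrow> C \<noteq> D \<Longrightarrow> C \<inter> D = {}"
  using rcoset_eq(1) by blast

lemma measure_saturated:
  assumes \<mu>: "is_measure \<mu>" and N: "N \<in> FIN" "saturated N A"
  shows "[\<mu> A = (\<Sum>C\<in>cosets_in N A. \<mu> C)] (mod q)"
proof -
  have s: "subgroup N G" using N FIN_subgroup by blast
  have "[\<mu> (\<Union>C\<in>cosets_in N A. C) = (\<Sum>C\<in>cosets_in N A. \<mu> C)] (mod q)"
    using finite_cosets_in[OF N(1)] clopen_rcoset[OF N(1)] rcosets_disjoint[OF s]
    by (intro measure_UN[OF \<mu>]) (auto simp: cosets_in_def)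
  then show ?thesis using Union_cosets_in[OF s N(2)] by simp
qed

lemma family_val: "N \<in> FIN \<Longrightarrow> C \<in> rcosets N \<Longrightarrow> family \<mu> N C = \<mu> C mod q"
  by (simp add: family_def)

lemma family_carrier:
  assumes \<mu>: "is_measure \<mu>" shows "family \<mu> \<in> carrier Mo"
  unfolding Mo_carrier
proof (intro conjI ballI impI)
  show "coefficient_family (family \<mu>)" using modq by (auto simp: coefficient_family_def family_def)
  fix N M D assume N: "N \<in> FIN" "M \<in> FIN" "N \<subseteq> M" and D: "D \<in> rcosets M"
  have "saturated N D" using saturated_mono[OF N(3)] saturated_rcoset[OF FIN_subgroup[OF N(2)] D] by blast
  then have "[\<mu> D = (\<Sum>C\<in>cosets_in N D. \<mu> C)] (mod q)" using measure_saturated[OF \<mu> N(1)] by blast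
  moreover have "(\<Sum>C\<in>cosets_in N D. family \<mu> N C) = (\<Sum>C\<in>cosets_in N D. \<mu> C mod q)"
    using N by (intro sum.cong) (auto simp: family_val cosets_in_def)
  ultimately show "family \<mu> M D = (\<Sum>C\<in>cosets_in N D. family \<mu> N C) mod q"
    using family_val[OF N(2) D] by (simp add: cong_def mod_sum_eq)
qed

lemma mass_family:
  assumes \<mu>: "is_measure \<mu>" and A: "clopen A" shows "mass (family \<mu>) A = \<mu> A mod q"
proof -
  obtain N where N: "N \<in> FIN" "saturated N A" using A by (auto simp: clopen_def)
  have "(\<Sum>C\<in>cosets_in N A. family \<mu> N C) = (\<Sum>C\<in>cosets_in N A. \<mu> C mod q)"
    using N by (intro sum.cong) (auto simp: family_val cosets_in_def)
  then show ?thesis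
    using mass_eq[OF family_carrier[OF \<mu>] N] measure_saturated[OF \<mu> N] by (simp add: cong_def mod_sum_eq)
qed

lemma family_eqI: "(\<And>A. clopen A \<Longrightarrow> [\<mu> A = \<nu> A] (mod q)) \<Longrightarrow> family \<mu> = family \<nu>"
  unfolding family_def using clopen_rcoset by (intro restrict_ext) (auto simp: cong_def)

lemma family_mass: "u \<in> carrier Mo \<Longrightarrow> family (mass u) = u"
proof -
  assume u: "u \<in> carrier Mo"
  then have P: "u \<in> (\<Pi>\<^sub>E N\<in>FIN. (rcosets N) \<rightarrow>\<^sub>E carrier K)" by (simp add: Mo_carrier coefficient_family_def)
  show ?thesis
  proof
    fix N show "family (mass u) N = u N"
    proof (cases "N \<in> FIN")
      case True
      show ?thesis
      proof
        fix C show "family (mass u) N C = u N C"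
          using True P mass_rcoset[OF u True] mass_mod[of u C]
          by (cases "C \<in> rcosets N") (auto simp: family_def PiE_def extensional_def Pi_def)
      qed
    next
      case False
      then show ?thesis using P by (auto simp: family_def PiE_def extensional_def)
    qed
  qed
qed

lemma Mo_eqI: "u \<in> carrier Mo \<Longrightarrow> v \<in> carrier Mo \<Longrightarrow> (\<And>A. clopen A \<Longrightarrow> [mass u A = mass v A] (mod q)) \<Longrightarrow> u = v"
  using family_eqI[of "mass u" "mass v"] family_mass by metis

lemma Mo_add:
  assumes "u \<in> carrier Mo" "v \<in> carrier Mo"
  shows "u \<boxplus> v = family (\<lambda>A. mass u A + mass v A)"
  unfolding Mo_simps completed_group_ring_def ring.simps family_def
proof (rule restrict_ext)
  fix N assume N: "N \<in> FIN"
  show "u N \<oplus>\<^bsub>group_ring K (G Mod N)\<^esub> v N = (\<lambda>C\<in>rcosets N. (mass u C + mass v C) mod q)"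
    using N assms by (auto simp: group_ring_def FactGroup_def K_simps mass_rcoset intro!: restrict_ext)
qed

lemma measure_add: "is_measure \<mu> \<Longrightarrow> is_measure \<nu> \<Longrightarrow> is_measure (\<lambda>A. \<mu> A + \<nu> A)"
  unfolding is_measure_def
proof (intro allI impI)
  fix A A' assume m: "\<forall>A A'. clopen A \<longrightarrow> clopen A' \<longrightarrow> A \<inter> A' = {} \<longrightarrow> [\<mu> (A \<union> A') = \<mu> A + \<mu> A'] (mod q)"
    "\<forall>A A'. clopen A \<longrightarrow> clopen A' \<longrightarrow> A \<inter> A' = {} \<longrightarrow> [\<nu> (A \<union> A') = \<nu> A + \<nu> A'] (mod q)"
    "clopen A" "clopen A'" "A \<inter> A' = {}"
  then have "[\<mu> (A \<union> A') + \<nu> (A \<union> A') = (\<mu> A + \<mu> A') + (\<nu> A + \<nu> A')] (mod q)" by (intro cong_add) auto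
  then show "[\<mu> (A \<union> A') + \<nu> (A \<union> A') = \<mu> A + \<nu> A + (\<mu> A' + \<nu> A')] (mod q)" by (simp add: algebra_simps)
qed

lemma measure_scale: "is_measure \<mu> \<Longrightarrow> is_measure (\<lambda>A. c * \<mu> A)"
  unfolding is_measure_def by (metis cong_scalar_left distrib_left)

lemma measure_zero: "is_measure (\<lambda>A. 0)" by (simp add: is_measure_def)

lemma measure_sum: "(\<And>i. i \<in> I \<Longrightarrow> is_measure (\<mu> i)) \<Longrightarrow> is_measure (\<lambda>A. \<Sum>i\<in>I. \<mu> i A)"
  by (induct I rule: infinite_finite_induct) (auto simp: measure_zero measure_add)

lemma measure_translate:
  assumes \<mu>: "is_measure \<mu>" and x: "x \<in> carrier G" shows "is_measure (\<lambda>A. \<mu> (x <# A))"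
  unfolding is_measure_def
proof (intro allI impI)
  fix A A' assume A: "clopen A" "clopen A'" "A \<inter> A' = {}"
  have "(x <# A) \<inter> (x <# A') = {}"
    using A translate_Int[OF x clopen_carrier clopen_carrier] by (simp add: l_coset_def)
  then show "[\<mu> (x <# (A \<union> A')) = \<mu> (x <# A) + \<mu> (x <# A')] (mod q)"
    using \<mu> A clopen_translate[OF _ x] by (simp add: translate_Un is_measure_def)
qed

lemma measure_smult:
  assumes "is_measure \<mu>"
  shows "is_measure (\<lambda>A. \<Sum>x\<in>supp f. f x * \<mu> (inv x <# A))"
  using assms by (intro measure_sum measure_scale measure_translate) auto

text \<open>Grouping the support of \<open>f\<close> by the cosets of \<open>N\<close> computes the product with the image of \<open>f\<close> in the
  group ring of the quotient.\<close>

lemma Mo_smult_val: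
  assumes f: "f \<in> carrier R" and u: "u \<in> carrier Mo" and N: "N \<in> FIN" and C: "C \<in> rcosets N"
  shows "(f \<bullet> u) N C = (\<Sum>x\<in>supp f. f x * u N (inv x <# C)) mod q"
proof -
  interpret N: normal N G using N by (rule FIN_normal)
  have s: "subgroup N G" by (rule N.subgroup_axioms)
  interpret Q: group "G Mod N" by (rule N.factorgroup_is_group)
  define a where "a = group_ring_map K G (G Mod N) (\<lambda>x. N #> x) f"
  have aD: "a D = (\<Sum>x | x \<in> supp f \<and> N #> x = D. f x) mod q" if "D \<in> rcosets N" for D
  proof -
    have "a D = finsum K f {x \<in> carrier G. f x \<noteq> 0 \<and> N #> x = D}"
      using that by (simp add: a_def group_ring_map_def FactGroup_def K_simps)
    also have "\<dots> = sum f {x \<in> carrier G. f x \<noteq> 0 \<and> N #> x = D} mod q"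
      using R_val[OF f] by (intro finsum_K) auto
    also have "{x \<in> carrier G. f x \<noteq> 0 \<and> N #> x = D} = {x. x \<in> supp f \<and> N #> x = D}"
      by (auto simp: supp_def)
    finally show ?thesis .
  qed
  have QC: "carrier (G Mod N) = rcosets N" by (simp add: FactGroup_def)
  let ?v = "\<lambda>D. u N (inv\<^bsub>G Mod N\<^esub> D \<otimes>\<^bsub>G Mod N\<^esub> C)"
  have vK: "?v D \<in> carrier K" if "D \<in> rcosets N" for D
  proof -
    have "inv\<^bsub>G Mod N\<^esub> D \<otimes>\<^bsub>G Mod N\<^esub> C \<in> carrier (G Mod N)"
      using that C QC by (intro Q.m_closed Q.inv_closed) auto
    then show ?thesis using Mo_val[OF u N] QC by simp
  qed
  have aK: "a D \<in> carrier K" if "D \<in> rcosets N" for D using aD[OF that] modq by simp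
  have "(f \<bullet> u) N = a \<otimes>\<^bsub>group_ring K (G Mod N)\<^esub> u N"
    using N by (simp add: Mo_simps completed_group_ring_def to_completed_group_ring_def a_def)
  then have "(f \<bullet> u) N C = finsum K (\<lambda>D. a D \<otimes>\<^bsub>K\<^esub> ?v D) {D \<in> rcosets N. a D \<noteq> 0}"
    using C QC by (simp add: group_ring_def K_simps)
  also have "\<dots> = (\<Sum>D\<in>{D \<in> rcosets N. a D \<noteq> 0}. a D \<otimes>\<^bsub>K\<^esub> ?v D) mod q"
    using aK vK by (intro finsum_K K.m_closed) auto
  also have "\<dots> = (\<Sum>D\<in>{D \<in> rcosets N. a D \<noteq> 0}. a D * ?v D) mod q"
    by (simp add: K_simps mod_sum_eq)
  also have "(\<Sum>D\<in>{D \<in> rcosets N. a D \<noteq> 0}. a D * ?v D) = (\<Sum>D\<in>rcosets N. a D * ?v D)"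
    using FIN_finite[OF N] by (intro sum.mono_neutral_left) auto
  also have "(\<Sum>D\<in>rcosets N. a D * ?v D) mod q
      = (\<Sum>D\<in>rcosets N. \<Sum>x | x \<in> supp f \<and> N #> x = D. f x * u N (inv x <# C)) mod q"
  proof -
    have "[a D * ?v D = (\<Sum>x | x \<in> supp f \<and> N #> x = D. f x * u N (inv x <# C))] (mod q)"
      if D: "D \<in> rcosets N" for D
    proof -
      have "[a D * ?v D = (\<Sum>x | x \<in> supp f \<and> N #> x = D. f x) * ?v D] (mod q)"
        unfolding aD[OF D] by (intro cong_scalar_right) (simp add: cong_def)
      also have "(\<Sum>x | x \<in> supp f \<and> N #> x = D. f x) * ?v D = (\<Sum>x | x \<in> supp f \<and> N #> x = D. f x * u N (inv x <# C))"
        unfolding sum_distrib_right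
      proof (intro sum.cong refl arg_cong2[where f="(*)"] arg_cong[where f="u N"])
        fix x assume "x \<in> {x. x \<in> supp f \<and> N #> x = D}"
        then have x: "x \<in> carrier G" "D = N #> x" by auto
        obtain g where g: "g \<in> carrier G" "C = N #> g" using C by (rule rcoset_nonempty[OF s])
        have "inv\<^bsub>G Mod N\<^esub> D = N #> inv x"
          using D QC x N.inv_FactGroup[of D] N.rcos_inv[OF x(1)] by simp
        then show "inv\<^bsub>G Mod N\<^esub> D \<otimes>\<^bsub>G Mod N\<^esub> C = inv x <# C"
          using g x translate_rcoset[OF N.normal_axioms, of "inv x" g] N.rcos_sum[of "inv x" g]
          by (simp add: FactGroup_def)
      qed
      finally show ?thesis .
    qed
    then have "[(\<Sum>D\<in>rcosets N. a D * ?v D) = (\<Sum>D\<in>rcosets N. \<Sum>x | x \<in> supp f \<and> N #> x = D. f x * u N (inv x <# C))] (mod q)"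
      by (intro cong_sum)
    then show ?thesis by (simp add: cong_def)
  qed
  also have "(\<Sum>D\<in>rcosets N. \<Sum>x | x \<in> supp f \<and> N #> x = D. f x * u N (inv x <# C)) = (\<Sum>x\<in>supp f. f x * u N (inv x <# C))"
    using R_supp[OF f] FIN_finite[OF N] subgroup_rcosetsI[OF s] by (intro sum.group) auto
  finally show ?thesis .
qed

lemma Mo_smult:
  assumes f: "f \<in> carrier R" and u: "u \<in> carrier Mo"
  shows "f \<bullet> u = family (\<lambda>A. \<Sum>x\<in>supp f. f x * mass u (inv x <# A))"
proof -
  have "f \<bullet> u = (\<lambda>N\<in>FIN. \<lambda>C\<in>rcosets N. (f \<bullet> u) N C)"
  proof -
    have "f \<bullet> u = (\<lambda>N\<in>FIN. (f \<bullet> u) N)"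
      by (auto simp: Mo_simps completed_group_ring_def)
    also have "\<dots> = (\<lambda>N\<in>FIN. \<lambda>C\<in>rcosets N. (f \<bullet> u) N C)"
      by (rule restrict_ext) (auto simp: Mo_simps completed_group_ring_def group_ring_def FactGroup_def)
    finally show ?thesis .
  qed
  also have "\<dots> = family (\<lambda>A. \<Sum>x\<in>supp f. f x * mass u (inv x <# A))"
    unfolding family_def
  proof (intro restrict_ext)
    fix N C assume N: "N \<in> FIN" and C: "C \<in> rcosets N"
    have "u N (inv x <# C) = mass u (inv x <# C)" if "x \<in> supp f" for x
      using mass_rcoset[OF u N translate_in_rcosets[OF FIN_normal[OF N] _ C]] that by auto
    then show "(f \<bullet> u) N C = (\<Sum>x\<in>supp f. f x * mass u (inv x <# C)) mod q"
      unfolding Mo_smult_val[OF f u N C] by simp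
  qed
  finally show ?thesis .
qed

lemma Mo_add_closed: "u \<in> carrier Mo \<Longrightarrow> v \<in> carrier Mo \<Longrightarrow> u \<boxplus> v \<in> carrier Mo"
  by (simp add: Mo_add family_carrier measure_add mass_measure)

lemma mass_add: "u \<in> carrier Mo \<Longrightarrow> v \<in> carrier Mo \<Longrightarrow> clopen A \<Longrightarrow> [mass (u \<boxplus> v) A = mass u A + mass v A] (mod q)"
  by (simp add: Mo_add mass_family measure_add mass_measure cong_def)

lemma Mo_smult_closed: "f \<in> carrier R \<Longrightarrow> u \<in> carrier Mo \<Longrightarrow> f \<bullet> u \<in> carrier Mo"
  by (simp add: Mo_smult family_carrier measure_smult mass_measure)

lemma mass_smult: "f \<in> carrier R \<Longrightarrow> u \<in> carrier Mo \<Longrightarrow> clopen A \<Longrightarrow>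
   [mass (f \<bullet> u) A = (\<Sum>x\<in>supp f. f x * mass u (inv x <# A))] (mod q)"
  by (simp add: Mo_smult mass_family measure_smult mass_measure cong_def)

lemma Mo_zero: "\<zero>\<^bsub>Mo\<^esub> = family (\<lambda>_. 0)"
  by (auto simp: Mo_simps completed_group_ring_def family_def group_ring_def FactGroup_def K_simps intro!: restrict_ext)

lemma Mo_zero_closed: "\<zero>\<^bsub>Mo\<^esub> \<in> carrier Mo"
  by (simp add: Mo_zero family_carrier measure_zero)

lemma mass_zero: "clopen A \<Longrightarrow> mass \<zero>\<^bsub>Mo\<^esub> A = 0"
  by (simp add: Mo_zero mass_family measure_zero)

end

section \<open>Subgroups of finite index\<close>

context group
begin

lemma rcos_eqI: "subgroup L G \<Longrightarrow> x \<in> carrier G \<Longrightarrow> y \<in> carrier G \<Longrightarrow> x \<otimes> inv y \<in> L \<Longrightarrow> L #> x = L #> y"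
proof -
  assume a: "subgroup L G" "x \<in> carrier G" "y \<in> carrier G" "x \<otimes> inv y \<in> L"
  have "x = (x \<otimes> inv y) \<otimes> y" using a by (simp add: m_assoc)
  then have "x \<in> L #> y" using a(4) unfolding r_coset_def by blast
  then show ?thesis using repr_independence a by metis
qed

text \<open>Take the kernel of the action of \<open>G\<close> on the finite set of right cosets of \<open>H\<close>.\<close>

lemma ex_finite_index_normal_subset:
  assumes H: "subgroup H G" and fin: "finite (rcosets H)"
  obtains N where "N \<in> finite_index_normal G" "N \<subseteq> H"
proof
  let ?N = "{g \<in> carrier G. \<forall>C\<in>rcosets H. C #> g = C}"
  have Cc: "C \<subseteq> carrier G" if "C \<in> rcosets H" for C
    using that rcosets_part_G[OF H] by blast
  have move: "C #> g \<in> rcosets H" if "C \<in> rcosets H" "g \<in> carrier G" for C g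
  proof -
    obtain x where "x \<in> carrier G" "C = H #> x" using \<open>C \<in> rcosets H\<close> by (auto simp: RCOSETS_def)
    then show ?thesis using that coset_mult_assoc[of H x g] rcosetsI[of H "x \<otimes> g"] subgroup.subset[OF H] by simp
  qed
  have sub: "subgroup ?N G"
  proof (rule subgroupI)
    show "?N \<noteq> {}" using Cc by (auto intro!: exI[of _ \<one>])
    fix a b assume ab: "a \<in> ?N" "b \<in> ?N"
    show "inv a \<in> ?N"
    proof -
      have "C #> inv a = C" if C: "C \<in> rcosets H" for C
      proof -
        have "C #> inv a = (C #> a) #> inv a" using ab C by simp
        also have "\<dots> = C" using ab Cc[OF C] by (simp add: coset_mult_assoc)
        finally show ?thesis .
      qed
      then show ?thesis using ab by simp
    qed
    show "a \<otimes> b \<in> ?N" using ab Cc by (auto simp flip: coset_mult_assoc)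
  qed auto
  have nrm: "?N \<lhd> G" unfolding normal_inv_iff
  proof (intro conjI sub ballI)
    fix x h assume x: "x \<in> carrier G" and h: "h \<in> ?N"
    have "C #> (x \<otimes> h \<otimes> inv x) = C" if C: "C \<in> rcosets H" for C
    proof -
      have "C #> (x \<otimes> h \<otimes> inv x) = ((C #> x) #> h) #> inv x"
        using x h Cc[OF C] r_coset_subset_G by (simp add: coset_mult_assoc m_assoc)
      also have "(C #> x) #> h = C #> x" using h move[OF C x] by blast
      also have "(C #> x) #> inv x = C" using x Cc[OF C] by (simp add: coset_mult_assoc)
      finally show ?thesis .
    qed
    then show "x \<otimes> h \<otimes> inv x \<in> ?N" using x h by auto
  qed
  have "rcosets ?N \<subseteq> (\<lambda>f. {g \<in> carrier G. \<forall>C\<in>rcosets H. C #> g = f C}) ` ((rcosets H) \<rightarrow>\<^sub>E (rcosets H))"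
  proof
    fix D assume "D \<in> rcosets ?N"
    then obtain x where x: "x \<in> carrier G" "D = ?N #> x" by (auto simp: RCOSETS_def)
    have "D = {g \<in> carrier G. \<forall>C\<in>rcosets H. C #> g = C #> x}"
    proof (intro equalityI subsetI)
      fix g assume "g \<in> D"
      then obtain n where "n \<in> ?N" "g = n \<otimes> x" using x by (auto simp: r_coset_def)
      then show "g \<in> {g \<in> carrier G. \<forall>C\<in>rcosets H. C #> g = C #> x}"
        using x Cc by (auto simp flip: coset_mult_assoc)
    next
      fix g assume g: "g \<in> {g \<in> carrier G. \<forall>C\<in>rcosets H. C #> g = C #> x}"
      have "C #> (g \<otimes> inv x) = C" if C: "C \<in> rcosets H" for C
      proof -
        have "C #> (g \<otimes> inv x) = (C #> g) #> inv x" using g x Cc[OF C] by (simp add: coset_mult_assoc)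
        also have "\<dots> = (C #> x) #> inv x" using g C by simp
        also have "\<dots> = C" using x Cc[OF C] by (simp add: coset_mult_assoc)
        finally show ?thesis .
      qed
      then have "g \<otimes> inv x \<in> ?N" using g x by auto
      moreover have "g = (g \<otimes> inv x) \<otimes> x" using g x by (simp add: m_assoc)
      ultimately show "g \<in> D" unfolding x(2) r_coset_def by blast
    qed
    also have "\<dots> = {g \<in> carrier G. \<forall>C\<in>rcosets H. C #> g = (\<lambda>C\<in>rcosets H. C #> x) C}" by auto
    finally show "D \<in> (\<lambda>f. {g \<in> carrier G. \<forall>C\<in>rcosets H. C #> g = f C}) ` ((rcosets H) \<rightarrow>\<^sub>E (rcosets H))"
      using move x(1) by (intro image_eqI[of _ _ "\<lambda>C\<in>rcosets H. C #> x"]) auto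
  qed
  moreover have "finite ((rcosets H) \<rightarrow>\<^sub>E (rcosets H))" using fin by (intro finite_PiE) auto
  ultimately have "finite (rcosets ?N)" by (meson finite_imageI finite_subset)
  then show "?N \<in> finite_index_normal G" using nrm by (simp add: finite_index_normal_def)
  show "?N \<subseteq> H"
  proof
    fix g assume g: "g \<in> ?N"
    have "H \<in> rcosets H" using subgroup.subgroup_in_rcosets[OF H is_group] .
    then have "H #> g = H" using g by blast
    then show "g \<in> H" using rcos_self[OF _ H, of g] g by auto
  qed
qed

text \<open>The cosets of \<open>L\<close> inside one coset of \<open>F\<close> are told apart by the finitely many values of \<open>k\<close>.\<close>

lemma finite_index_by_invariant:
  assumes L: "subgroup L G" and F: "subgroup F G" and fin: "finite (rcosets F)"
    and k: "finite (k ` F)" "\<And>g h. g \<in> F \<Longrightarrow> h \<in> F \<Longrightarrow> k g = k h \<Longrightarrow> g \<otimes> inv h \<in> L"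
  shows "finite (rcosets L)"
proof -
  define r where "r D = (SOME x. x \<in> D)" for D :: "'a set"
  define s where "s w = (SOME f. f \<in> F \<and> k f = w)" for w
  have "rcosets L \<subseteq> (\<lambda>(D, w). L #> (s w \<otimes> r D)) ` ((rcosets F) \<times> k ` F)"
  proof
    fix E assume "E \<in> rcosets L"
    then obtain x where x: "x \<in> carrier G" "E = L #> x" by (auto simp: RCOSETS_def)
    let ?D = "F #> x"
    have "r ?D \<in> ?D" unfolding r_def using rcos_self[OF x(1) F] by (rule someI)
    then obtain f where f: "f \<in> F" "r ?D = f \<otimes> x" by (auto simp: r_coset_def)
    have fc: "f \<in> carrier G" using f F subgroup.mem_carrier by metis
    have fi: "inv f \<in> F" using f F subgroup.m_inv_closed by metis
    have s: "s (k (inv f)) \<in> F \<and> k (s (k (inv f))) = k (inv f)"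
      unfolding s_def by (rule someI[of "\<lambda>g. g \<in> F \<and> k g = k (inv f)" "inv f"]) (simp add: fi)
    let ?g = "s (k (inv f))"
    have gc: "?g \<in> carrier G" using s F subgroup.mem_carrier by metis
    have "inv f \<otimes> inv ?g \<in> L" using k(2)[OF fi] s by metis
    moreover have "x \<otimes> inv (?g \<otimes> r ?D) = inv f \<otimes> inv ?g"
      using x(1) fc gc f(2) by (simp add: inv_mult_group m_assoc[symmetric])
    ultimately have "L #> x = L #> (?g \<otimes> r ?D)"
      using x(1) fc gc f(2) by (intro rcos_eqI[OF L]) auto
    moreover have "?D \<in> rcosets F" using x(1) F rcosetsI subgroup.subset by blast
    ultimately show "E \<in> (\<lambda>(D, w). L #> (s w \<otimes> r D)) ` ((rcosets F) \<times> k ` F)"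
      using x(2) fi by (intro image_eqI[of _ _ "(?D, k (inv f))"]) auto
  qed
  then show ?thesis using fin k(1) by (meson finite_SigmaI finite_imageI finite_subset)
qed

end

context mod_p_group_ring
begin

lemma measure_minus: "is_measure \<mu> \<Longrightarrow> is_measure (\<lambda>A. - \<mu> A)"
  using measure_scale[of \<mu> "-1"] by simp

lemma abelian_group_Mo: "abelian_group Mo"
proof (rule abelian_groupI)
  fix u v w assume c: "u \<in> carrier Mo" "v \<in> carrier Mo" "w \<in> carrier Mo"
  note cl = Mo_add_closed
  show "u \<boxplus> v \<boxplus> w = u \<boxplus> (v \<boxplus> w)"
  proof (rule Mo_eqI)
    fix A assume A: "clopen A"
    have "[mass (u \<boxplus> v \<boxplus> w) A = mass u A + mass v A + mass w A] (mod q)"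
      by (rule cong_trans[OF mass_add[OF cl[OF c(1,2)] c(3) A] cong_add[OF mass_add[OF c(1,2) A] cong_refl]])
    moreover have "[mass (u \<boxplus> (v \<boxplus> w)) A = mass u A + (mass v A + mass w A)] (mod q)"
      by (rule cong_trans[OF mass_add[OF c(1) cl[OF c(2,3)] A] cong_add[OF cong_refl mass_add[OF c(2,3) A]]])
    ultimately show "[mass (u \<boxplus> v \<boxplus> w) A = mass (u \<boxplus> (v \<boxplus> w)) A] (mod q)"
      by (simp add: cong_def add.assoc)
  qed (use c cl in auto)
next
  fix u v assume c: "u \<in> carrier Mo" "v \<in> carrier Mo"
  show "u \<boxplus> v = v \<boxplus> u" using c by (simp add: Mo_add add.commute)
  show "u \<boxplus> v \<in> carrier Mo" using c by (rule Mo_add_closed)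
  show "\<zero>\<^bsub>Mo\<^esub> \<boxplus> u = u"
  proof (rule Mo_eqI)
    fix A assume A: "clopen A"
    show "[mass (\<zero>\<^bsub>Mo\<^esub> \<boxplus> u) A = mass u A] (mod q)"
      using mass_add[OF Mo_zero_closed c(1) A] mass_zero[OF A] by simp
  qed (use c Mo_zero_closed Mo_add_closed in auto)
  let ?v = "family (\<lambda>A. - mass u A)"
  have v: "is_measure (\<lambda>A. - mass u A)" using c mass_measure measure_minus by blast
  have "?v \<boxplus> u = \<zero>\<^bsub>Mo\<^esub>"
  proof (rule Mo_eqI)
    fix A assume A: "clopen A"
    have "[mass (?v \<boxplus> u) A = mass ?v A + mass u A] (mod q)" using mass_add[OF family_carrier[OF v] c(1) A] .
    also have "mass ?v A + mass u A = (- mass u A) mod q + mass u A" using mass_family[OF v A] by simp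
    also have "[(- mass u A) mod q + mass u A = 0] (mod q)" by (simp add: cong_def mod_add_left_eq)
    finally show "[mass (?v \<boxplus> u) A = mass \<zero>\<^bsub>Mo\<^esub> A] (mod q)" using mass_zero[OF A] by simp
  qed (use c family_carrier[OF v] Mo_zero_closed Mo_add_closed in auto)
  then show "\<exists>v\<in>carrier Mo. v \<boxplus> u = \<zero>\<^bsub>Mo\<^esub>" using family_carrier[OF v] by blast
qed (rule Mo_zero_closed)

sublocale Mo: abelian_group Mo by (rule abelian_group_Mo)

lemma mass_minus: "u \<in> carrier Mo \<Longrightarrow> clopen A \<Longrightarrow> [mass (\<ominus>\<^bsub>Mo\<^esub> u) A = - mass u A] (mod q)"
proof -
  assume u: "u \<in> carrier Mo" and A: "clopen A"
  have "[mass (\<ominus>\<^bsub>Mo\<^esub> u \<boxplus> u) A = mass (\<ominus>\<^bsub>Mo\<^esub> u) A + mass u A] (mod q)"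
    using mass_add[OF _ u A] u by simp
  then have "[mass (\<ominus>\<^bsub>Mo\<^esub> u) A + mass u A = - mass u A + mass u A] (mod q)"
    using u mass_zero[OF A] by (simp add: Mo.l_neg cong_sym)
  then show ?thesis by (rule cong_add_rcancel[THEN iffD1])
qed

lemma mass_finsum:
  "(\<And>i. i \<in> I \<Longrightarrow> u i \<in> carrier Mo) \<Longrightarrow> clopen A \<Longrightarrow> [mass (finsum Mo u I) A = (\<Sum>i\<in>I. mass (u i) A)] (mod q)"
proof (induct I rule: infinite_finite_induct)
  case (insert i I)
  have "finsum Mo u (insert i I) = u i \<boxplus> finsum Mo u I" using insert by (intro Mo.finsum_insert) auto
  then have "[mass (finsum Mo u (insert i I)) A = mass (u i) A + mass (finsum Mo u I) A] (mod q)"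
    using mass_add[of "u i" "finsum Mo u I" A] insert by (simp add: Mo.finsum_closed)
  moreover have "[mass (u i) A + mass (finsum Mo u I) A = mass (u i) A + (\<Sum>i\<in>I. mass (u i) A)] (mod q)"
    using insert by (intro cong_add cong_refl) auto
  ultimately have "[mass (finsum Mo u (insert i I)) A = mass (u i) A + (\<Sum>i\<in>I. mass (u i) A)] (mod q)"
    by (rule cong_trans)
  then show ?case using insert by simp
qed (simp_all add: mass_zero Mo.finsum_infinite)

lemma mass_multiple: "u \<in> carrier Mo \<Longrightarrow> clopen A \<Longrightarrow> [mass ([(k::nat)] \<cdot>\<^bsub>Mo\<^esub> u) A = int k * mass u A] (mod q)"
proof (induct k)
  case (Suc k)
  have "[mass ([Suc k] \<cdot>\<^bsub>Mo\<^esub> u) A = mass ([k] \<cdot>\<^bsub>Mo\<^esub> u) A + mass u A] (mod q)"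
    using Suc mass_add[of "[k] \<cdot>\<^bsub>Mo\<^esub> u" u A] by simp
  moreover have "[mass ([k] \<cdot>\<^bsub>Mo\<^esub> u) A + mass u A = int k * mass u A + mass u A] (mod q)"
    using Suc by (intro cong_add) auto
  ultimately show ?case by (simp add: algebra_simps cong_trans)
qed (simp add: mass_zero)

lemma torsion_Mo: "torsion_group Mo p"
proof (unfold_locales)
  show "prime p" by (rule p)
  fix u assume u: "u \<in> carrier Mo"
  show "[p] \<cdot>\<^bsub>Mo\<^esub> u = \<zero>\<^bsub>Mo\<^esub>"
  proof (rule Mo_eqI)
    fix A assume A: "clopen A"
    have "[int p * mass u A = 0] (mod q)" by (simp add: cong_def)
    then show "[mass ([p] \<cdot>\<^bsub>Mo\<^esub> u) A = mass \<zero>\<^bsub>Mo\<^esub> A] (mod q)"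
      unfolding mass_zero[OF A] by (rule cong_trans[OF mass_multiple[OF u A]])
  qed (use u Mo_zero_closed in auto)
qed

lemma left_module_Mo: "left_module R Mo"
proof -
  interpret R: ring R by (rule ring_R)
  note cl = Mo_smult_closed
  show ?thesis
  proof (unfold_locales)
    fix f u assume "f \<in> carrier R" "u \<in> carrier Mo"
    then show "f \<bullet> u \<in> carrier Mo" by (rule cl)
  next
    fix f g u assume c: "f \<in> carrier R" "g \<in> carrier R" "u \<in> carrier Mo"
    show "(f \<oplus>\<^bsub>R\<^esub> g) \<bullet> u = f \<bullet> u \<boxplus> g \<bullet> u"
    proof (rule Mo_eqI)
      fix A assume A: "clopen A"
      have "[mass ((f \<oplus>\<^bsub>R\<^esub> g) \<bullet> u) A = (\<Sum>x\<in>supp (f \<oplus>\<^bsub>R\<^esub> g). (f \<oplus>\<^bsub>R\<^esub> g) x * mass u (inv x <# A))] (mod q)"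
        using c A R_add_closed by (intro mass_smult) auto
      also have "[(\<Sum>x\<in>supp (f \<oplus>\<^bsub>R\<^esub> g). (f \<oplus>\<^bsub>R\<^esub> g) x * mass u (inv x <# A)) = (\<Sum>x\<in>supp f. f x * mass u (inv x <# A)) + (\<Sum>x\<in>supp g. g x * mass u (inv x <# A))] (mod q)"
        using c by (intro add_sum)
      also have "[(\<Sum>x\<in>supp f. f x * mass u (inv x <# A)) + (\<Sum>x\<in>supp g. g x * mass u (inv x <# A)) = mass (f \<bullet> u) A + mass (g \<bullet> u) A] (mod q)"
        using c A by (intro cong_add cong_sym[OF mass_smult])
      also have "[mass (f \<bullet> u) A + mass (g \<bullet> u) A = mass (f \<bullet> u \<boxplus> g \<bullet> u) A] (mod q)"
        using c A cl by (intro cong_sym[OF mass_add]) auto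
      finally show "[mass ((f \<oplus>\<^bsub>R\<^esub> g) \<bullet> u) A = mass (f \<bullet> u \<boxplus> g \<bullet> u) A] (mod q)" .
    qed (use c cl Mo_add_closed R_add_closed in auto)
    show "(f \<otimes>\<^bsub>R\<^esub> g) \<bullet> u = f \<bullet> (g \<bullet> u)"
    proof (rule Mo_eqI)
      fix A assume A: "clopen A"
      have "[mass ((f \<otimes>\<^bsub>R\<^esub> g) \<bullet> u) A = (\<Sum>x\<in>supp (f \<otimes>\<^bsub>R\<^esub> g). (f \<otimes>\<^bsub>R\<^esub> g) x * mass u (inv x <# A))] (mod q)"
        using c A R_mult_closed by (intro mass_smult) auto
      also have "[(\<Sum>x\<in>supp (f \<otimes>\<^bsub>R\<^esub> g). (f \<otimes>\<^bsub>R\<^esub> g) x * mass u (inv x <# A)) = (\<Sum>y\<in>supp f. f y * (\<Sum>z\<in>supp g. g z * mass u (inv (y \<otimes> z) <# A)))] (mod q)"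
        using c by (intro conv_sum)
      also have "(\<Sum>y\<in>supp f. f y * (\<Sum>z\<in>supp g. g z * mass u (inv (y \<otimes> z) <# A)))
        = (\<Sum>y\<in>supp f. f y * (\<Sum>z\<in>supp g. g z * mass u (inv z <# (inv y <# A))))"
        using clopen_carrier[OF A]
        by (intro sum.cong arg_cong2[where f="(*)"] arg_cong[where f="mass u"] refl)
          (simp add: inv_mult_group translate_translate supp_in)
      also have "[(\<Sum>y\<in>supp f. f y * (\<Sum>z\<in>supp g. g z * mass u (inv z <# (inv y <# A)))) = (\<Sum>y\<in>supp f. f y * mass (g \<bullet> u) (inv y <# A))] (mod q)"
        using c A by (intro cong_sum cong_scalar_left cong_sym[OF mass_smult] clopen_translate) auto
      also have "[(\<Sum>y\<in>supp f. f y * mass (g \<bullet> u) (inv y <# A)) = mass (f \<bullet> (g \<bullet> u)) A] (mod q)"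
        using c A cl by (intro cong_sym[OF mass_smult]) auto
      finally show "[mass ((f \<otimes>\<^bsub>R\<^esub> g) \<bullet> u) A = mass (f \<bullet> (g \<bullet> u)) A] (mod q)" .
    qed (use c cl R_mult_closed in auto)
  next
    fix f u v assume c: "f \<in> carrier R" "u \<in> carrier Mo" "v \<in> carrier Mo"
    show "f \<bullet> (u \<boxplus> v) = f \<bullet> u \<boxplus> f \<bullet> v"
    proof (rule Mo_eqI)
      fix A assume A: "clopen A"
      have "[mass (f \<bullet> (u \<boxplus> v)) A = (\<Sum>x\<in>supp f. f x * mass (u \<boxplus> v) (inv x <# A))] (mod q)"
        using c A Mo_add_closed by (intro mass_smult) auto
      also have "[(\<Sum>x\<in>supp f. f x * mass (u \<boxplus> v) (inv x <# A)) = (\<Sum>x\<in>supp f. f x * (mass u (inv x <# A) + mass v (inv x <# A)))] (mod q)"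
        using c A by (intro cong_sum cong_scalar_left mass_add clopen_translate) auto
      also have "(\<Sum>x\<in>supp f. f x * (mass u (inv x <# A) + mass v (inv x <# A)))
         = (\<Sum>x\<in>supp f. f x * mass u (inv x <# A)) + (\<Sum>x\<in>supp f. f x * mass v (inv x <# A))"
        by (simp add: distrib_left sum.distrib)
      also have "[(\<Sum>x\<in>supp f. f x * mass u (inv x <# A)) + (\<Sum>x\<in>supp f. f x * mass v (inv x <# A)) = mass (f \<bullet> u) A + mass (f \<bullet> v) A] (mod q)"
        using c A by (intro cong_add cong_sym[OF mass_smult])
      also have "[mass (f \<bullet> u) A + mass (f \<bullet> v) A = mass (f \<bullet> u \<boxplus> f \<bullet> v) A] (mod q)"
        using c A cl by (intro cong_sym[OF mass_add]) auto
      finally show "[mass (f \<bullet> (u \<boxplus> v)) A = mass (f \<bullet> u \<boxplus> f \<bullet> v) A] (mod q)" .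
    qed (use c cl Mo_add_closed in auto)
  next
    fix u assume c: "u \<in> carrier Mo"
    show "\<one>\<^bsub>R\<^esub> \<bullet> u = u"
    proof (rule Mo_eqI)
      fix A assume A: "clopen A"
      have "[mass (\<one>\<^bsub>R\<^esub> \<bullet> u) A = (\<Sum>x\<in>supp \<one>\<^bsub>R\<^esub>. \<one>\<^bsub>R\<^esub> x * mass u (inv x <# A))] (mod q)"
        using c A one_R by (intro mass_smult)
      then show "[mass (\<one>\<^bsub>R\<^esub> \<bullet> u) A = mass u A] (mod q)"
        using clopen_carrier[OF A] by (simp add: one_sum lcos_mult_one)
    qed (use c cl one_R in auto)
  qed
qed

sublocale LM: left_module R Mo by (rule left_module_Mo)

definition delta :: "'a \<Rightarrow> 'a \<Rightarrow> int" where
  "delta g = (\<lambda>x\<in>carrier G. if x = g then 1 else 0)"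

definition gact :: "'a \<Rightarrow> ('a set \<Rightarrow> 'a set \<Rightarrow> int) \<Rightarrow> 'a set \<Rightarrow> 'a set \<Rightarrow> int" where
  "gact g u = delta g \<bullet> u"

lemma supp_delta: "g \<in> carrier G \<Longrightarrow> supp (delta g) = {g}"
  by (auto simp: supp_def delta_def)

lemma delta_R: "g \<in> carrier G \<Longrightarrow> delta g \<in> carrier R"
  using q1 supp_delta[of g] by (auto simp: R_carrier delta_def K_simps)

lemma gact_closed: "g \<in> carrier G \<Longrightarrow> u \<in> carrier Mo \<Longrightarrow> gact g u \<in> carrier Mo"
  by (simp add: gact_def delta_R Mo_smult_closed)

lemma mass_gact: "g \<in> carrier G \<Longrightarrow> u \<in> carrier Mo \<Longrightarrow> clopen A \<Longrightarrow> mass (gact g u) A = mass u (inv g <# A)"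
proof -
  assume g: "g \<in> carrier G" and u: "u \<in> carrier Mo" and A: "clopen A"
  have "[mass (gact g u) A = mass u (inv g <# A)] (mod q)"
    using mass_smult[OF delta_R[OF g] u A] g by (simp add: gact_def supp_delta) (simp add: delta_def)
  then show ?thesis by (simp add: cong_def mass_mod)
qed

lemma gact_mult: "g \<in> carrier G \<Longrightarrow> h \<in> carrier G \<Longrightarrow> u \<in> carrier Mo \<Longrightarrow> gact (g \<otimes> h) u = gact g (gact h u)"
  by (rule Mo_eqI)
    (auto simp: gact_closed mass_gact clopen_translate inv_mult_group translate_translate clopen_carrier)

lemma gact_one: "u \<in> carrier Mo \<Longrightarrow> gact \<one> u = u"
  by (rule Mo_eqI) (auto simp: gact_closed mass_gact clopen_carrier lcos_mult_one)

lemma gact_inv: "g \<in> carrier G \<Longrightarrow> u \<in> carrier Mo \<Longrightarrow> gact (inv g) (gact g u) = u"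
  by (simp add: gact_mult[symmetric] gact_one)

lemma gact_add: "g \<in> carrier G \<Longrightarrow> u \<in> carrier Mo \<Longrightarrow> v \<in> carrier Mo \<Longrightarrow> 
  gact g (u \<boxplus> v) = gact g u \<boxplus> gact g v"
  by (simp add: gact_def delta_R LM.smult_r_distr)

end

section \<open>Counting solutions of a linear equation\<close>

context torsion_group
begin

definition sumset :: "'s set \<Rightarrow> ('s \<Rightarrow> 'a set) \<Rightarrow> 'a set" where
  "sumset T V = (\<lambda>z. finsum M z T) ` (\<Pi>\<^sub>E s\<in>T. V s)"

definition solutions :: "'s set \<Rightarrow> ('s \<Rightarrow> 'a set) \<Rightarrow> 'a \<Rightarrow> ('s \<Rightarrow> 'a) set" where
  "solutions T V c = {z \<in> (\<Pi>\<^sub>E s\<in>T. V s). finsum M z T = c}"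

context
  fixes T :: "'s set" and V :: "'s \<Rightarrow> 'a set"
  assumes T: "finite T" and V: "\<And>s. s \<in> T \<Longrightarrow> additive_subgroup (V s) M"
begin

lemma V_carrier: "s \<in> T \<Longrightarrow> v \<in> V s \<Longrightarrow> v \<in> carrier M"
  using additive_subgroup.a_subset[OF V] by blast

lemma PiE_V_carrier: "z \<in> (\<Pi>\<^sub>E s\<in>T. V s) \<Longrightarrow> z \<in> T \<rightarrow> carrier M"
  using V_carrier by fastforce

definition pointwise_add :: "('s \<Rightarrow> 'a) \<Rightarrow> ('s \<Rightarrow> 'a) \<Rightarrow> 's \<Rightarrow> 'a" where
  "pointwise_add z z' = (\<lambda>s\<in>T. z s \<oplus> z' s)"

lemma pointwise_add_in: "z \<in> (\<Pi>\<^sub>E s\<in>T. V s) \<Longrightarrow> z' \<in> (\<Pi>\<^sub>E s\<in>T. V s) \<Longrightarrow> pointwise_add z z' \<in> (\<Pi>\<^sub>E s\<in>T. V s)"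
  using additive_subgroup.a_closed[OF V] by (simp add: pointwise_add_def PiE_iff)

lemma finsum_pointwise_add:
  assumes "z \<in> (\<Pi>\<^sub>E s\<in>T. V s)" "z' \<in> (\<Pi>\<^sub>E s\<in>T. V s)"
  shows "finsum M (pointwise_add z z') T = finsum M z T \<oplus> finsum M z' T"
proof -
  have "finsum M (pointwise_add z z') T = finsum M (\<lambda>s. z s \<oplus> z' s) T"
    using PiE_V_carrier assms by (intro finsum_cong') (auto simp: pointwise_add_def Pi_def)
  then show ?thesis using PiE_V_carrier assms by (simp add: finsum_addf)
qed

lemma sumset_subgroup: "additive_subgroup (sumset T V) M"
proof (rule additive_subgroup_intro)
  show "sumset T V \<subseteq> carrier M" using PiE_V_carrier by (auto simp: sumset_def intro!: finsum_closed)
  have "(\<lambda>s\<in>T. \<zero>) \<in> (\<Pi>\<^sub>E s\<in>T. V s)" using additive_subgroup.zero_closed[OF V] by auto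
  moreover have "finsum M (\<lambda>s\<in>T. \<zero>) T = \<zero>" by (rule add.finprod_one_eqI) auto
  ultimately show "\<zero> \<in> sumset T V" unfolding sumset_def by (metis (no_types, lifting) image_eqI)
  fix x y assume "x \<in> sumset T V" "y \<in> sumset T V"
  then obtain z z' where z: "z \<in> (\<Pi>\<^sub>E s\<in>T. V s)" "z' \<in> (\<Pi>\<^sub>E s\<in>T. V s)" "x = finsum M z T" "y = finsum M z' T"
    by (auto simp: sumset_def)
  then show "x \<oplus> y \<in> sumset T V" using pointwise_add_in[OF z(1,2)] finsum_pointwise_add[OF z(1,2)] unfolding sumset_def
    by (metis (no_types, lifting) image_eqI)
qed

lemma V_sumset: "s \<in> T \<Longrightarrow> V s \<subseteq> sumset T V"
proof
  fix v assume s: "s \<in> T" and v: "v \<in> V s"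
  let ?z = "\<lambda>t\<in>T. if t = s then v else \<zero>"
  have vc: "v \<in> carrier M" using V_carrier s v .
  have z: "?z \<in> (\<Pi>\<^sub>E s\<in>T. V s)" using additive_subgroup.zero_closed[OF V] v by auto
  have "finsum M ?z T = finsum M (\<lambda>t. if s = t then v else \<zero>) T"
    using vc by (intro finsum_cong') auto
  also have "\<dots> = v" using T s vc by (intro add.finprod_singleton) auto
  finally show "v \<in> sumset T V" using z unfolding sumset_def by (metis (no_types, lifting) image_eqI)
qed

lemma sumset_subset: "additive_subgroup W M \<Longrightarrow> (\<And>s. s \<in> T \<Longrightarrow> V s \<subseteq> W) \<Longrightarrow> sumset T V \<subseteq> W"
proof
  fix x assume W: "additive_subgroup W M" and VW: "\<And>s. s \<in> T \<Longrightarrow> V s \<subseteq> W" and "x \<in> sumset T V"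
  then obtain z where z: "z \<in> (\<Pi>\<^sub>E s\<in>T. V s)" "x = finsum M z T" by (auto simp: sumset_def)
  have "finsum M z T' \<in> W" if "T' \<subseteq> T" for T'
  proof -
    have "finite T'" using that T finite_subset by blast
    then show ?thesis using that
    proof (induct T' rule: finite_induct)
      case empty
      then show ?case using additive_subgroup.zero_closed[OF W] by simp
    next
      case (insert s T')
      have "finsum M z (insert s T') = z s \<oplus> finsum M z T'"
        using insert PiE_V_carrier[OF z(1)] by (intro finsum_insert) auto
      moreover have "z s \<in> W" using insert z(1) VW by auto
      ultimately show ?case using insert additive_subgroup.a_closed[OF W] by simp
    qed
  qed
  then show "x \<in> W" using z by simp
qed

text \<open>Summation is a surjective homomorphism onto \<open>sumset T V\<close>, so all its fibres have the same size.\<close>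

lemma card_solutions:
  assumes fin: "\<And>s. s \<in> T \<Longrightarrow> finite (V s)" and c: "c \<in> sumset T V"
  shows "card (solutions T V c) * card (sumset T V) = (\<Prod>s\<in>T. card (V s))"
proof -
  let ?Z = "\<Pi>\<^sub>E s\<in>T. V s"
  have finZ: "finite ?Z" using T fin by (intro finite_PiE) auto
  have eq: "card (solutions T V d) = card (solutions T V \<zero>)" if d: "d \<in> sumset T V" for d
  proof -
    obtain z0 where z0: "z0 \<in> ?Z" "d = finsum M z0 T" using d by (auto simp: sumset_def)
    let ?m = "\<lambda>s\<in>T. \<ominus> z0 s"
    have m: "?m \<in> ?Z" using z0 additive_subgroup.a_inv_closed[OF V] by (simp add: PiE_iff)
    have "finsum M (pointwise_add z0 ?m) T = \<zero>"
      using PiE_V_carrier[OF z0(1)] by (intro add.finprod_one_eqI) (auto simp: pointwise_add_def r_neg Pi_def)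
    then have md: "d \<oplus> finsum M ?m T = \<zero>" using finsum_pointwise_add[OF z0(1) m] z0 by simp
    have dc: "d \<in> carrier M" using d sumset_subgroup additive_subgroup.a_subset by blast
    have "bij_betw (pointwise_add z0) (solutions T V \<zero>) (solutions T V d)"
    proof (rule bij_betw_byWitness[where f' = "pointwise_add ?m"])
      show "\<forall>z\<in>solutions T V \<zero>. pointwise_add ?m (pointwise_add z0 z) = z"
      proof
        fix z assume "z \<in> solutions T V \<zero>"
        then have z: "z \<in> ?Z" by (simp add: solutions_def)
        show "pointwise_add ?m (pointwise_add z0 z) = z"
        proof
          fix s show "pointwise_add ?m (pointwise_add z0 z) s = z s"
            using z z0(1) PiE_V_carrier[OF z] PiE_V_carrier[OF z0(1)]
            by (cases "s \<in> T") (auto simp: pointwise_add_def PiE_def extensional_def Pi_def r_neg1)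
        qed
      qed
      show "\<forall>z\<in>solutions T V d. pointwise_add z0 (pointwise_add ?m z) = z"
      proof
        fix z assume "z \<in> solutions T V d"
        then have z: "z \<in> ?Z" by (simp add: solutions_def)
        show "pointwise_add z0 (pointwise_add ?m z) = z"
        proof
          fix s show "pointwise_add z0 (pointwise_add ?m z) s = z s"
            using z z0(1) PiE_V_carrier[OF z] PiE_V_carrier[OF z0(1)]
            by (cases "s \<in> T") (auto simp: pointwise_add_def PiE_def extensional_def Pi_def r_neg2)
        qed
      qed
      show "pointwise_add z0 ` solutions T V \<zero> \<subseteq> solutions T V d"
      proof -
        have "pointwise_add z0 z \<in> solutions T V d" if "z \<in> solutions T V \<zero>" for z
          using that z0 dc by (simp add: solutions_def pointwise_add_in finsum_pointwise_add)
        then show ?thesis by blast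
      qed
      show "pointwise_add ?m ` solutions T V d \<subseteq> solutions T V \<zero>"
      proof -
        have mc: "finsum M ?m T \<in> carrier M" using PiE_V_carrier[OF m] by (rule finsum_closed)
        have "pointwise_add ?m z \<in> solutions T V \<zero>" if "z \<in> solutions T V d" for z
          using that m md dc mc by (simp add: solutions_def pointwise_add_in finsum_pointwise_add a_comm)
        then show ?thesis by blast
      qed
    qed
    then show ?thesis by (rule bij_betw_same_card[symmetric])
  qed
  have "card ?Z = (\<Sum>d\<in>sumset T V. card (solutions T V d))"
  proof -
    have "?Z = (\<Union>d\<in>sumset T V. solutions T V d)" by (auto simp: sumset_def solutions_def)
    moreover have "card (\<Union>d\<in>sumset T V. solutions T V d) = (\<Sum>d\<in>sumset T V. card (solutions T V d))"
      using finZ by (intro card_UN_disjoint) (auto simp: sumset_def solutions_def)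
    ultimately show ?thesis by simp
  qed
  also have "\<dots> = card (sumset T V) * card (solutions T V \<zero>)" using eq by simp
  finally have "card ?Z = card (solutions T V c) * card (sumset T V)" using eq[OF c] by simp
  then show ?thesis using T by (simp add: card_PiE)
qed

end

text \<open>With the summand at \<open>e\<close> prescribed, it can be moved to the other side.\<close>

lemma card_solutions_fixed:
  assumes T: "finite T" and V: "\<And>s. s \<in> T \<Longrightarrow> additive_subgroup (V s) M" and e: "e \<in> T" and y: "y \<in> V e"
    and c: "c \<in> carrier M"
  shows "card {z \<in> solutions T V c. z e = y} = card (solutions (T - {e}) V (c \<ominus> y))"
proof -
  have yc: "y \<in> carrier M" using y additive_subgroup.a_subset[OF V[OF e]] by blast
  have split: "finsum M z T = z e \<oplus> finsum M z (T - {e})" if "z \<in> (\<Pi>\<^sub>E s\<in>T. V s)" for z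
  proof -
    have zc: "z \<in> T \<rightarrow> carrier M" using PiE_V_carrier[OF T V that] by blast
    have "finsum M z (insert e (T - {e})) = z e \<oplus> finsum M z (T - {e})"
      using T zc e by (intro finsum_insert) auto
    then show ?thesis using e by (simp add: insert_absorb)
  qed
  have res: "finsum M (restrict z (T - {e})) (T - {e}) = finsum M z (T - {e})" 
    if "z \<in> (\<Pi>\<^sub>E s\<in>T. V s)" for z
    using PiE_V_carrier[OF T V that] by (intro finsum_cong') auto
  have upd: "finsum M (z(e := y)) (T - {e}) = finsum M z (T - {e})" if "z \<in> (\<Pi>\<^sub>E s\<in>T - {e}. V s)" for z
  proof (rule finsum_cong')
    show "z \<in> T - {e} \<rightarrow> carrier M" using that V additive_subgroup.a_subset by fastforce
  qed auto
  have updin: "z(e := y) \<in> (\<Pi>\<^sub>E s\<in>T. V s)" if "z \<in> (\<Pi>\<^sub>E s\<in>T - {e}. V s)" for z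
    using that y e by (auto simp: PiE_def extensional_def Pi_def)
  have "bij_betw (\<lambda>z. restrict z (T - {e})) {z \<in> solutions T V c. z e = y} (solutions (T - {e}) V (c \<ominus> y))"
  proof (rule bij_betw_byWitness[where f' = "\<lambda>z. z(e := y)"])
    show "\<forall>z\<in>{z \<in> solutions T V c. z e = y}. (restrict z (T - {e}))(e := y) = z"
      using e by (auto simp: solutions_def PiE_def extensional_def fun_eq_iff)
    show "\<forall>z\<in>solutions (T - {e}) V (c \<ominus> y). restrict (z(e := y)) (T - {e}) = z"
      by (auto simp: solutions_def PiE_def extensional_def fun_eq_iff)
    show "(\<lambda>z. restrict z (T - {e})) ` {z \<in> solutions T V c. z e = y} \<subseteq> solutions (T - {e}) V (c \<ominus> y)"
    proof clarify
      fix z assume z: "z \<in> solutions T V c" and ye: "y = z e"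
      then have zP: "z \<in> (\<Pi>\<^sub>E s\<in>T. V s)" and zs: "finsum M z T = c" by (auto simp: solutions_def)
      have fc: "finsum M z (T - {e}) \<in> carrier M"
        using PiE_V_carrier[OF T V zP] by (intro finsum_closed) auto
      define r where "r = finsum M z (T - {e})"
      have "c = y \<oplus> r" using split[OF zP] zs ye by (simp add: r_def)
      then have "c \<ominus> y = \<ominus> y \<oplus> (y \<oplus> r)" using yc fc by (simp add: minus_eq a_comm r_def)
      also have "\<dots> = r" using yc fc by (simp add: r_neg1 r_def)
      finally have "c \<ominus> y = finsum M z (T - {e})" by (simp add: r_def)
      then show "restrict z (T - {e}) \<in> solutions (T - {e}) V (c \<ominus> z e)"
        using zP res[OF zP] ye by (auto simp: solutions_def)
    qed
    show "(\<lambda>z. z(e := y)) ` solutions (T - {e}) V (c \<ominus> y) \<subseteq> {z \<in> solutions T V c. z e = y}"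
    proof clarify
      fix z assume "z \<in> solutions (T - {e}) V (c \<ominus> y)"
      then have z: "z \<in> (\<Pi>\<^sub>E s\<in>T - {e}. V s)" "finsum M z (T - {e}) = c \<ominus> y" by (auto simp: solutions_def)
      have "finsum M (z(e := y)) T = y \<oplus> (c \<ominus> y)"
        using split[OF updin[OF z(1)]] upd[OF z(1)] z(2) by simp
      also have "\<dots> = c" using yc c by (simp add: minus_eq a_lcomm r_neg)
      finally show "z(e := y) \<in> solutions T V c \<and> (z(e := y)) e = y"
        using updin[OF z(1)] by (simp add: solutions_def)
    qed
  qed
  then show ?thesis by (rule bij_betw_same_card)
qed

end

context letter_module
begin

lemma overlap_subgroup:
  assumes W: "additive_subgroup W M" and s: "s \<in> S"
  shows "additive_subgroup (overlap s W) M"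
proof -
  interpret W: additive_subgroup W M by fact
  show ?thesis
    using W.a_subset act_zero[OF flip_S[OF s]] act_add[OF flip_S[OF s]]
    by (intro additive_subgroup_intro) (auto simp: overlap_def subset_iff)
qed

lemma bij_overlap:
  assumes W: "additive_subgroup W M" and s: "s \<in> S"
  shows "bij_betw (act s) (overlap (flip s) W) (overlap s W)"
proof (rule bij_betw_byWitness[where f' = "act (flip s)"])
  have Wc: "W \<subseteq> carrier M" using W additive_subgroup.a_subset by blast
  have c: "overlap t W \<subseteq> carrier M" for t using Wc by (auto simp: overlap_def)
  show "\<forall>a\<in>overlap (flip s) W. act (flip s) (act s a) = a" using act_flip[OF s] c by blast
  show "\<forall>a\<in>overlap s W. act s (act (flip s) a) = a" using act_flip[OF flip_S[OF s]] c by (simp add: subset_iff)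
  show "act s ` overlap (flip s) W \<subseteq> overlap s W" using act_overlap[OF s Wc] by blast
  show "act (flip s) ` overlap s W \<subseteq> overlap (flip s) W" using act_overlap[OF flip_S[OF s] Wc] by (simp add: image_subset_iff)
qed

end

section \<open>Leaves of finite groups of measures\<close>

locale virtually_free = mod_p_group_ring G p + free_basis G F B
  for G :: "('a, 'b) monoid_scheme" (structure) and p F B +
  assumes finite_index: "finite (rcosets F)"
begin

abbreviation lact_Mo :: "'a \<times> bool \<Rightarrow> ('a set \<Rightarrow> 'a set \<Rightarrow> int) \<Rightarrow> 'a set \<Rightarrow> 'a set \<Rightarrow> int" where
  "lact_Mo s \<equiv> gact (letter s)"

text \<open>The measures concentrated on \<open>F\<close>; they form a copy of the completed group ring of \<open>F\<close>.\<close>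

definition on_F :: "('a set \<Rightarrow> 'a set \<Rightarrow> int) set" where
  "on_F = {u \<in> carrier Mo. \<forall>A. clopen A \<longrightarrow> A \<inter> F = {} \<longrightarrow> mass u A = 0}"

lemma letter_module_Mo:
  assumes "P \<subseteq> B" shows "letter_module Mo p (P \<times> UNIV) lact_Mo"
proof -
  interpret torsion_group Mo p by (rule torsion_Mo)
  show ?thesis
  proof (unfold_locales)
    fix s :: "'a \<times> bool" assume s: "s \<in> P \<times> UNIV"
    then show "flip s \<in> P \<times> UNIV" by (auto simp: flip_def)
    fix u assume u: "u \<in> carrier Mo"
    have sB: "fst s \<in> B" using s assms by auto
    show "lact_Mo s u \<in> carrier Mo" using u sB by (simp add: gact_closed)
    show "lact_Mo (flip s) (lact_Mo s u) = u" using u sB by (simp add: letter_flip gact_inv)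
    fix v assume "v \<in> carrier Mo"
    then show "lact_Mo s (u \<boxplus> v) = lact_Mo s u \<boxplus> lact_Mo s v" using u sB by (simp add: gact_add)
  qed
qed

lemma ex_FIN_subset:
  assumes "N0 \<in> FIN" "subgroup L G" "finite (rcosets L)"
  obtains N where "N \<in> FIN" "N \<subseteq> N0" "N \<subseteq> L"
proof -
  obtain M where "M \<in> FIN" "M \<subseteq> L" using ex_finite_index_normal_subset[OF assms(2,3)] .
  then show ?thesis using that[of "N0 \<inter> M"] FIN_Int assms by blast
qed

lemma saturated_F: "N \<subseteq> F \<Longrightarrow> saturated N F"
  using subgroup.m_closed[OF F] F_carrier by (auto simp: saturated_def r_coset_def)

lemma clopen_F: "clopen F"
proof -
  obtain N where "N \<in> FIN" "N \<subseteq> F" using ex_finite_index_normal_subset[OF F finite_index] .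
  then show ?thesis using saturated_F by (auto simp: clopen_def)
qed

lemma translate_cosets_in_F:
  assumes N: "N \<in> FIN" and g: "g \<in> F" and C: "C \<in> cosets_in N F"
  shows "g <# C \<in> cosets_in N F"
proof -
  have gc: "g \<in> carrier G" using g F_carrier by blast
  have "g <# C \<in> rcosets N" using translate_in_rcosets[OF FIN_normal[OF N] gc] C by (simp add: cosets_in_def)
  moreover have "g <# C \<subseteq> F" using C g subgroup.m_closed[OF F] by (auto simp: cosets_in_def l_coset_def)
  ultimately show ?thesis by (simp add: cosets_in_def)
qed

lemma translate_inv_cancel:
  assumes "A \<subseteq> carrier G" "g \<in> carrier G"
  shows "inv g <# (g <# A) = A" "g <# (inv g <# A) = A"
  using assms by (simp_all add: translate_translate lcos_mult_one)

lemma rcos_F: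
  assumes N: "N \<in> FIN" "N \<subseteq> F" and g: "g \<in> F" shows "N #> g \<in> cosets_in N F"
  using subgroup_rcosetsI[OF FIN_subgroup[OF N(1)] F_carrier[OF g]] subgroup.m_closed[OF F] g N
  by (auto simp: cosets_in_def r_coset_def)

text \<open>A state at a vertex \<open>g\<close> consists of the coset \<open>C\<close> of \<open>g\<close> and of values \<open>z s \<in> W \<inter> s W\<close> with total
  \<open>f C\<close>; here \<open>z s\<close> is the value on the edge to \<open>inv s g\<close>. The edge between \<open>g\<close> and \<open>x g\<close>
  is seen as \<open>(x, False)\<close> from \<open>g\<close> and as \<open>(x, True)\<close> from \<open>x g\<close>, and the two values have to be
  opposite up to translation by \<open>x\<close>. By the hypothesis \<open>core\<close> every value on one edge is taken by
  equally many states, whence a bijection between the states at \<open>g\<close> and those at \<open>x g\<close> that respects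
  the edge. If \<open>x\<close> is not among the finitely many generators \<open>P\<close>, its edges carry no flow and only
  the cosets have to match.\<close>

lemma ex_flow_permutations:
  assumes P: "finite P" "P \<subseteq> B"
    and W: "additive_subgroup W Mo" "finite W"
    and core: "\<And>T. finite T \<Longrightarrow> (\<exists>e. (P \<times> UNIV) - {e} \<subseteq> T) \<Longrightarrow> T \<subseteq> P \<times> UNIV \<Longrightarrow>
      torsion_group.sumset Mo T (\<lambda>s. letter_module.overlap lact_Mo s W) = W"
    and N: "N \<in> FIN" "N \<subseteq> F" and f: "\<And>C. f C \<in> W"
    and x: "x \<in> B"
  defines "V \<equiv> \<lambda>s. letter_module.overlap lact_Mo s W"
  defines "\<Omega> \<equiv> Sigma (cosets_in N F) (\<lambda>C. torsion_group.solutions Mo (P \<times> UNIV) V (f C))"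
  shows "\<exists>\<pi>. bij_betw \<pi> \<Omega> \<Omega> \<and> (\<forall>\<omega>\<in>\<Omega>. fst (\<pi> \<omega>) = x <# fst \<omega> \<and>
     (x \<in> P \<longrightarrow> snd (\<pi> \<omega>) (x, True) = \<ominus>\<^bsub>Mo\<^esub> gact x (snd \<omega> (x, False))))"
proof -
  interpret L: letter_module Mo p "P \<times> UNIV" lact_Mo by (rule letter_module_Mo[OF P(2)])
  interpret W: additive_subgroup W Mo by (rule W(1))
  let ?S = "P \<times> (UNIV :: bool set)"
  have finS: "finite ?S" using P by simp
  have VS: "V s = L.overlap s W" for s by (simp add: V_def)
  have Vsub: "additive_subgroup (V s) Mo" if "s \<in> ?S" for s
    unfolding VS using L.overlap_subgroup[OF W(1) that] .
  have VW: "V s \<subseteq> W" for s by (auto simp: VS L.overlap_def)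
  have finV: "finite (V s)" for s using VW W(2) finite_subset by blast
  have Wc: "W \<subseteq> carrier Mo" by (rule W.a_subset)
  have W0: "card W > 0" using W(2) W.zero_closed card_gt_0_iff by blast
  have xc: "x \<in> carrier G" using x BF F_carrier by blast
  have xF: "x \<in> F" using x BF by blast
  have count: "card (L.solutions T V c) * card W = (\<Prod>s\<in>T. card (V s))"
    if T: "T \<subseteq> ?S" "\<exists>e. ?S - {e} \<subseteq> T" and c: "c \<in> W" for T c
  proof -
    have fT: "finite T" using T finS finite_subset by blast
    have sT: "L.sumset T V = W" using core[OF fT T(2,1)] by (simp add: V_def)
    have "card (L.solutions T V c) * card (L.sumset T V) = (\<Prod>s\<in>T. card (V s))"
      by (rule L.card_solutions) (use fT T Vsub finV sT c in auto)
    then show ?thesis using sT by simp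
  qed
  have fixed: "card {z \<in> L.solutions ?S V c. z e = y} = card (L.solutions (?S - {e}) V (c \<ominus>\<^bsub>Mo\<^esub> y))"
    if "e \<in> ?S" "y \<in> V e" "c \<in> W" for e y c
    by (rule L.card_solutions_fixed) (use finS Vsub that Wc in auto)
  have finX: "finite (L.solutions ?S V c)" for c
    unfolding L.solutions_def by (rule finite_subset[of _ "Pi\<^sub>E ?S V"]) (use finS finV finite_PiE in blast)+
  \<comment> \<open>What a state forces on its neighbour at the other end of the edge, and what that neighbour shows there.\<close>
  define \<alpha> where "\<alpha> = (\<lambda>(C, z). (x <# C, if x \<in> P then \<ominus>\<^bsub>Mo\<^esub> gact x (z (x, False)) else \<zero>\<^bsub>Mo\<^esub>))"
  define \<beta> where "\<beta> = (\<lambda>(C :: 'a set, z). (C, if x \<in> P then z (x, True) else \<zero>\<^bsub>Mo\<^esub>))"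
  have fin\<Omega>: "finite \<Omega>" unfolding \<Omega>_def using finite_cosets_in[OF N(1)] finX by (intro finite_SigmaI) auto
  have zV: "z s \<in> V s" if "z \<in> L.solutions ?S V c" "s \<in> ?S" for z s c
    using that unfolding L.solutions_def by (auto dest: PiE_mem)
  have "card {\<omega> \<in> \<Omega>. \<alpha> \<omega> = i} = card {\<omega> \<in> \<Omega>. \<beta> \<omega> = i}" for i
  proof -
    obtain D y where i: "i = (D, y)" by (cases i)
    show ?thesis
    proof (cases "D \<in> cosets_in N F")
      case False
      have "{\<omega> \<in> \<Omega>. \<alpha> \<omega> = i} = {}" using False translate_cosets_in_F[OF N(1) xF]
        by (auto simp: \<Omega>_def \<alpha>_def i)
      moreover have "{\<omega> \<in> \<Omega>. \<beta> \<omega> = i} = {}" using False by (auto simp: \<Omega>_def \<beta>_def i)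
      ultimately show ?thesis by (simp only:)
    next
      case D: True
      let ?C = "inv x <# D"
      have Dc: "D \<subseteq> carrier G" using D F_carrier by (auto simp: cosets_in_def)
      have C: "?C \<in> cosets_in N F"
        using translate_cosets_in_F[OF N(1) _ D] subgroup.m_inv_closed[OF F xF] by blast
      have CD: "x <# C' = D \<longleftrightarrow> C' = ?C" if "C' \<in> cosets_in N F" for C'
      proof -
        have "C' \<subseteq> carrier G" using that F_carrier by (auto simp: cosets_in_def)
        then show ?thesis using translate_inv_cancel Dc xc by metis
      qed
      have "{\<omega> \<in> \<Omega>. \<alpha> \<omega> = i} = (\<lambda>z. (?C, z)) ` {z \<in> L.solutions ?S V (f ?C).
         (if x \<in> P then \<ominus>\<^bsub>Mo\<^esub> gact x (z (x, False)) else \<zero>\<^bsub>Mo\<^esub>) = y}"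
      proof (intro equalityI subsetI)
        fix \<omega> assume a: "\<omega> \<in> {\<omega> \<in> \<Omega>. \<alpha> \<omega> = i}"
        obtain C' z where \<omega>: "\<omega> = (C', z)" by (cases \<omega>)
        then have c: "C' \<in> cosets_in N F" "z \<in> L.solutions ?S V (f C')" "x <# C' = D"
          "(if x \<in> P then \<ominus>\<^bsub>Mo\<^esub> gact x (z (x, False)) else \<zero>\<^bsub>Mo\<^esub>) = y"
          using a by (auto simp only: \<Omega>_def \<alpha>_def i mem_Collect_eq mem_Sigma_iff prod.case prod.inject)
        have "C' = ?C" using CD[OF c(1)] c(3) by blast
        then show "\<omega> \<in> (\<lambda>z. (?C, z)) ` {z \<in> L.solutions ?S V (f ?C).
            (if x \<in> P then \<ominus>\<^bsub>Mo\<^esub> gact x (z (x, False)) else \<zero>\<^bsub>Mo\<^esub>) = y}" using c(2,4) \<omega> by blast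
      next
        fix \<omega> assume "\<omega> \<in> (\<lambda>z. (?C, z)) ` {z \<in> L.solutions ?S V (f ?C).
            (if x \<in> P then \<ominus>\<^bsub>Mo\<^esub> gact x (z (x, False)) else \<zero>\<^bsub>Mo\<^esub>) = y}"
        then obtain z where z: "\<omega> = (?C, z)" "z \<in> L.solutions ?S V (f ?C)"
          "(if x \<in> P then \<ominus>\<^bsub>Mo\<^esub> gact x (z (x, False)) else \<zero>\<^bsub>Mo\<^esub>) = y" by blast
        then show "\<omega> \<in> {\<omega> \<in> \<Omega>. \<alpha> \<omega> = i}" unfolding mem_Collect_eq \<Omega>_def \<alpha>_def i z(1) prod.case mem_Sigma_iff prod.inject
          using C CD[OF C] by blast
      qed
      then have 1: "card {\<omega> \<in> \<Omega>. \<alpha> \<omega> = i} = card {z \<in> L.solutions ?S V (f ?C).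
         (if x \<in> P then \<ominus>\<^bsub>Mo\<^esub> gact x (z (x, False)) else \<zero>\<^bsub>Mo\<^esub>) = y}"
        by (simp add: card_image inj_on_def)
      have "{\<omega> \<in> \<Omega>. \<beta> \<omega> = i} = (\<lambda>z. (D, z)) ` {z \<in> L.solutions ?S V (f D).
         (if x \<in> P then z (x, True) else \<zero>\<^bsub>Mo\<^esub>) = y}"
        using D by (auto simp: \<Omega>_def \<beta>_def i)
      then have 2: "card {\<omega> \<in> \<Omega>. \<beta> \<omega> = i} = card {z \<in> L.solutions ?S V (f D).
         (if x \<in> P then z (x, True) else \<zero>\<^bsub>Mo\<^esub>) = y}"
        by (simp add: card_image inj_on_def)
      show ?thesis
      proof (cases "x \<in> P")
        case False
        have "card (L.solutions ?S V (f ?C)) = card (L.solutions ?S V (f D))"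
          using count[of ?S, OF _ _ f[of ?C]] count[of ?S, OF _ _ f[of D]] W0
          by (metis Diff_subset mult_cancel2 order_refl neq0_conv)
        then show ?thesis using 1 2 False by (cases "y = \<zero>\<^bsub>Mo\<^esub>") simp_all
      next
        case xP: True
        let ?s = "(x, True)" and ?t = "(x, False)"
        have st: "?s \<in> ?S" "?t \<in> ?S" "flip ?s = ?t" "letter ?s = x" using xP by (auto simp: letter_def)
        have bij: "bij_betw (gact x) (V ?t) (V ?s)"
          using L.bij_overlap[OF W(1) st(1)] st by (simp add: VS)
        have inv_t: "gact x v \<in> V ?s \<and> gact (inv x) (gact x v) = v" if "v \<in> V ?t" for v
          using that bij bij_betwE gact_inv[OF xc] VW Wc by blast
        interpret Vs: additive_subgroup "V ?s" Mo using Vsub st by blast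
        interpret Vt: additive_subgroup "V ?t" Mo using Vsub st by blast
        show ?thesis
        proof (cases "y \<in> V ?s")
          case False
          have "{z \<in> L.solutions ?S V (f ?C). \<ominus>\<^bsub>Mo\<^esub> gact x (z ?t) = y} = {}"
            using False inv_t zV st Vs.a_inv_closed by blast
          moreover have "{z \<in> L.solutions ?S V (f D). z ?s = y} = {}" using False zV st by blast
          ultimately show ?thesis unfolding 1 2 using xP by (simp only: if_True)
        next
          case y: True
          have yc: "y \<in> carrier Mo" using y VW Wc by blast
          have "\<ominus>\<^bsub>Mo\<^esub> y \<in> gact x ` V ?t"
            using bij_betw_imp_surj_on[OF bij] Vs.a_inv_closed[OF y] by simp
          then obtain y' where "\<ominus>\<^bsub>Mo\<^esub> y = gact x y'" "y' \<in> V ?t" by (rule imageE)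
          then have y': "y' \<in> V ?t" "gact x y' = \<ominus>\<^bsub>Mo\<^esub> y" by simp_all
          have y'W: "y' \<in> W" using y' VW by blast
          have "{z \<in> L.solutions ?S V (f ?C). \<ominus>\<^bsub>Mo\<^esub> gact x (z ?t) = y}
              = {z \<in> L.solutions ?S V (f ?C). z ?t = y'}"
          proof (intro Collect_cong conj_cong refl)
            fix z assume "z \<in> L.solutions ?S V (f ?C)"
            then have zt: "z ?t \<in> V ?t" using zV st by blast
            have zc: "gact x (z ?t) \<in> carrier Mo" using zt VW Wc xc gact_closed by blast
            have "\<ominus>\<^bsub>Mo\<^esub> gact x (z ?t) = y \<longleftrightarrow> gact x (z ?t) = \<ominus>\<^bsub>Mo\<^esub> y"
              using zc yc by (metis Mo.minus_minus)
            also have "\<dots> \<longleftrightarrow> z ?t = y'" using inv_t y' zt by metis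
            finally show "(\<ominus>\<^bsub>Mo\<^esub> gact x (z ?t) = y) = (z ?t = y')" .
          qed
          then have "card {z \<in> L.solutions ?S V (f ?C). \<ominus>\<^bsub>Mo\<^esub> gact x (z ?t) = y}
             = card (L.solutions (?S - {?t}) V (f ?C \<ominus>\<^bsub>Mo\<^esub> y'))"
            using fixed[OF st(2) y'(1) f[of ?C]] by simp
          moreover have "card {z \<in> L.solutions ?S V (f D). z ?s = y}
             = card (L.solutions (?S - {?s}) V (f D \<ominus>\<^bsub>Mo\<^esub> y))"
            using fixed[OF st(1) y f[of D]] by simp
          moreover have "card (L.solutions (?S - {?t}) V (f ?C \<ominus>\<^bsub>Mo\<^esub> y'))
             = card (L.solutions (?S - {?s}) V (f D \<ominus>\<^bsub>Mo\<^esub> y))"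
          proof -
            have ex: "\<exists>e. ?S - {e} \<subseteq> ?S - {e'}" for e' by blast
            have m: "f ?C \<ominus>\<^bsub>Mo\<^esub> y' \<in> W" "f D \<ominus>\<^bsub>Mo\<^esub> y \<in> W"
              using f y'W subsetD[OF VW y] by (auto simp: Mo.minus_eq)
            have cV: "card (V ?t) = card (V ?s)" "card (V ?s) > 0"
              using bij_betw_same_card[OF bij] finV Vs.zero_closed card_gt_0_iff by blast+
            have "card (V ?t) * (\<Prod>s\<in>?S - {?t}. card (V s)) = card (V ?s) * (\<Prod>s\<in>?S - {?s}. card (V s))"
              using prod.remove[OF finS st(1), of "\<lambda>s. card (V s)"] prod.remove[OF finS st(2), of "\<lambda>s. card (V s)"]
              by simp
            then have "(\<Prod>s\<in>?S - {?t}. card (V s)) = (\<Prod>s\<in>?S - {?s}. card (V s))" using cV by simp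
            then have "card (L.solutions (?S - {?t}) V (f ?C \<ominus>\<^bsub>Mo\<^esub> y')) * card W =
               card (L.solutions (?S - {?s}) V (f D \<ominus>\<^bsub>Mo\<^esub> y)) * card W"
              using count[OF Diff_subset ex m(1)] count[OF Diff_subset ex m(2)] by simp
            then show ?thesis using W0 by simp
          qed
          ultimately show ?thesis using 1 2 xP by simp
        qed
      qed
    qed
  qed
  then obtain \<pi> where \<pi>: "bij_betw \<pi> \<Omega> \<Omega>" "\<And>\<omega>. \<omega> \<in> \<Omega> \<Longrightarrow> \<beta> (\<pi> \<omega>) = \<alpha> \<omega>"
    using ex_bij_matching_fibres[OF fin\<Omega> fin\<Omega>, of \<alpha> \<beta>] by auto
  have "fst (\<pi> \<omega>) = x <# fst \<omega> \<and> (x \<in> P \<longrightarrow> snd (\<pi> \<omega>) (x, True) = \<ominus>\<^bsub>Mo\<^esub> gact x (snd \<omega> (x, False)))"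
    if "\<omega> \<in> \<Omega>" for \<omega>
    using \<pi>(2)[OF that] by (auto simp: \<alpha>_def \<beta>_def split: prod.splits if_splits)
  then show ?thesis using \<pi>(1) by blast
qed


lemma cosets_in_F_translate_bij:
  assumes N: "N \<in> FIN" and x: "x \<in> F"
  shows "bij_betw (\<lambda>C. x <# C) (cosets_in N F) (cosets_in N F)"
proof (rule bij_betw_byWitness[where f' = "\<lambda>C. inv x <# C"])
  have c: "C \<subseteq> carrier G" if "C \<in> cosets_in N F" for C
    using that F_carrier by (auto simp: cosets_in_def)
  show "\<forall>C\<in>cosets_in N F. inv x <# (x <# C) = C" using translate_inv_cancel(1)[OF c F_carrier[OF x]] by simp
  show "\<forall>C\<in>cosets_in N F. x <# (inv x <# C) = C" using translate_inv_cancel(2)[OF c F_carrier[OF x]] by simp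
  show "(\<lambda>C. x <# C) ` cosets_in N F \<subseteq> cosets_in N F" using translate_cosets_in_F[OF N x] by blast
  show "(\<lambda>C. inv x <# C) ` cosets_in N F \<subseteq> cosets_in N F"
    using translate_cosets_in_F[OF N subgroup.m_inv_closed[OF F x]] by blast
qed

text \<open>The two values on each edge are opposite up to translation, and translation of a measure together with
  the set on which it is evaluated changes nothing.\<close>

lemma flow_total_zero:
  assumes P: "finite P" "P \<subseteq> B" and N: "N \<in> FIN" "N \<subseteq> F"
    and \<zeta>: "\<And>C s. C \<in> cosets_in N F \<Longrightarrow> s \<in> P \<times> UNIV \<Longrightarrow> \<zeta> C s \<in> carrier Mo"
    and flow: "\<And>C x. C \<in> cosets_in N F \<Longrightarrow> x \<in> P \<Longrightarrow>
       \<zeta> (x <# C) (x, True) = \<ominus>\<^bsub>Mo\<^esub> gact x (\<zeta> C (x, False))"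
  shows "[(\<Sum>C\<in>cosets_in N F. mass (finsum Mo (\<zeta> C) (P \<times> UNIV)) C) = 0] (mod q)"
proof -
  let ?\<C> = "cosets_in N F"
  define T where "T s = (\<Sum>C\<in>?\<C>. mass (\<zeta> C s) C)" for s
  have cl: "clopen C" if "C \<in> ?\<C>" for C using that clopen_rcoset[OF N(1)] by (auto simp: cosets_in_def)
  have pair: "[T (x, True) + T (x, False) = 0] (mod q)" if x: "x \<in> P" for x
  proof -
    have xF: "x \<in> F" and xc: "x \<in> carrier G" using x P BF F_carrier by blast+
    have "T (x, True) = (\<Sum>C\<in>?\<C>. mass (\<zeta> (x <# C) (x, True)) (x <# C))"
      unfolding T_def by (rule sum.reindex_bij_betw[OF cosets_in_F_translate_bij[OF N(1) xF], symmetric])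
    also have "[(\<Sum>C\<in>?\<C>. mass (\<zeta> (x <# C) (x, True)) (x <# C)) = (\<Sum>C\<in>?\<C>. - mass (\<zeta> C (x, False)) C)] (mod q)"
    proof (rule cong_sum)
      fix C assume C: "C \<in> ?\<C>"
      have z: "\<zeta> C (x, False) \<in> carrier Mo" using \<zeta> C x by auto
      have "[mass (\<zeta> (x <# C) (x, True)) (x <# C) = - mass (gact x (\<zeta> C (x, False))) (x <# C)] (mod q)"
        unfolding flow[OF C x] using z xc cl[OF C] by (intro mass_minus gact_closed clopen_translate)
      moreover have "mass (gact x (\<zeta> C (x, False))) (x <# C) = mass (\<zeta> C (x, False)) C"
        using mass_gact[OF xc z clopen_translate[OF cl[OF C] xc]]
          translate_inv_cancel(1)[OF clopen_carrier[OF cl[OF C]] xc] by simp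
      ultimately show "[mass (\<zeta> (x <# C) (x, True)) (x <# C) = - mass (\<zeta> C (x, False)) C] (mod q)" by simp
    qed
    also have "(\<Sum>C\<in>?\<C>. - mass (\<zeta> C (x, False)) C) = - T (x, False)" by (simp add: T_def sum_negf)
    finally have "[T (x, True) + T (x, False) = - T (x, False) + T (x, False)] (mod q)"
      by (intro cong_add cong_refl)
    then show ?thesis by simp
  qed
  have "[(\<Sum>C\<in>?\<C>. mass (finsum Mo (\<zeta> C) (P \<times> UNIV)) C) = (\<Sum>C\<in>?\<C>. \<Sum>s\<in>P \<times> UNIV. mass (\<zeta> C s) C)] (mod q)"
    using \<zeta> cl by (intro cong_sum mass_finsum) auto
  also have "(\<Sum>C\<in>?\<C>. \<Sum>s\<in>P \<times> UNIV. mass (\<zeta> C s) C) = (\<Sum>s\<in>P \<times> UNIV. T s)"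
    unfolding T_def by (rule sum.swap)
  also have "(\<Sum>s\<in>P \<times> UNIV. T s) = (\<Sum>x\<in>P. \<Sum>b\<in>UNIV. T (x, b))"
    by (simp add: sum.cartesian_product)
  also have "(\<Sum>x\<in>P. \<Sum>b\<in>UNIV. T (x, b)) = (\<Sum>x\<in>P. T (x, True) + T (x, False))"
    by (simp add: UNIV_bool add.commute)
  also have "[(\<Sum>x\<in>P. T (x, True) + T (x, False)) = (\<Sum>x\<in>P. 0)] (mod q)"
    by (intro cong_sum pair)
  finally show ?thesis by simp
qed

text \<open>Following one state along the action of \<open>F\<close> from \<open>ex_flow_permutations\<close> gives a flow that depends only
  on cosets of a normal subgroup \<open>N'\<close> of finite index, contained in the stabiliser of the state.
  Evaluated on these cosets it adds up to \<open>w(A \<inter> F) = w(A)\<close> by the vertex conditions and to 0 by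
  \<open>flow_total_zero\<close>.\<close>

lemma core_mass_zero:
  assumes P: "finite P" "P \<subseteq> B"
    and W: "additive_subgroup W Mo" "finite W" "W \<subseteq> on_F"
    and core: "\<And>T. finite T \<Longrightarrow> (\<exists>e. (P \<times> UNIV) - {e} \<subseteq> T) \<Longrightarrow> T \<subseteq> P \<times> UNIV \<Longrightarrow>
      torsion_group.sumset Mo T (\<lambda>s. letter_module.overlap lact_Mo s W) = W"
    and w: "w \<in> W" and A: "clopen A"
  shows "[mass w A = 0] (mod q)"
proof -
  interpret L: letter_module Mo p "P \<times> UNIV" lact_Mo by (rule letter_module_Mo[OF P(2)])
  interpret W: additive_subgroup W Mo by (rule W(1))
  let ?S = "P \<times> (UNIV :: bool set)"
  define V where "V = (\<lambda>s. L.overlap s W)"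
  have VW: "V s \<subseteq> W" for s by (auto simp: V_def L.overlap_def)
  have wc: "w \<in> carrier Mo" using w W.a_subset by blast
  obtain N0 where N0: "N0 \<in> FIN" "saturated N0 A" using A by (auto simp: clopen_def)
  obtain N where N: "N \<in> FIN" "N \<subseteq> N0" "N \<subseteq> F" using ex_FIN_subset[OF N0(1) F finite_index] .
  have satA: "saturated N A" using saturated_mono[OF N(2) N0(2)] .
  define f where "f C = (if C \<subseteq> A then w else \<zero>\<^bsub>Mo\<^esub>)" for C
  have fW: "f C \<in> W" for C using w W.zero_closed by (simp add: f_def)
  define \<Omega> where "\<Omega> = Sigma (cosets_in N F) (\<lambda>C. L.solutions ?S V (f C))"
  have "\<exists>\<pi>. \<forall>x\<in>B. bij_betw (\<pi> x) \<Omega> \<Omega> \<and> (\<forall>\<omega>\<in>\<Omega>. fst (\<pi> x \<omega>) = x <# fst \<omega> \<and>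
     (x \<in> P \<longrightarrow> snd (\<pi> x \<omega>) (x, True) = \<ominus>\<^bsub>Mo\<^esub> gact x (snd \<omega> (x, False))))"
    unfolding \<Omega>_def V_def by (intro bchoice ballI ex_flow_permutations[OF P W(1,2) core N(1,3) fW])
  then obtain \<pi> where \<pi>B: "\<forall>x\<in>B. bij_betw (\<pi> x) \<Omega> \<Omega> \<and> (\<forall>\<omega>\<in>\<Omega>. fst (\<pi> x \<omega>) = x <# fst \<omega> \<and>
     (x \<in> P \<longrightarrow> snd (\<pi> x \<omega>) (x, True) = \<ominus>\<^bsub>Mo\<^esub> gact x (snd \<omega> (x, False))))" ..
  have \<pi>: "\<And>x. x \<in> B \<Longrightarrow> bij_betw (\<pi> x) \<Omega> \<Omega>"
    and \<pi>1: "\<And>x \<omega>. x \<in> B \<Longrightarrow> \<omega> \<in> \<Omega> \<Longrightarrow> fst (\<pi> x \<omega>) = x <# fst \<omega>"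
    and \<pi>2: "\<And>x \<omega>. x \<in> P \<Longrightarrow> \<omega> \<in> \<Omega> \<Longrightarrow> snd (\<pi> x \<omega>) (x, True) = \<ominus>\<^bsub>Mo\<^esub> gact x (snd \<omega> (x, False))"
    using P(2) \<pi>B by (simp_all add: subset_iff)
  interpret act: free_action G F B \<pi> \<Omega> by unfold_locales (rule \<pi>)
  have \<Omega>D: "fst \<omega> \<in> cosets_in N F" "snd \<omega> \<in> L.solutions ?S V (f (fst \<omega>))" if "\<omega> \<in> \<Omega>" for \<omega>
    using that by (auto simp: \<Omega>_def)
  have finS: "finite ?S" using P by simp
  have "f (N #> \<one>) \<in> L.sumset ?S V"
    using core[OF finS _ order_refl] fW unfolding V_def by blast
  then obtain z0 where z0: "z0 \<in> L.solutions ?S V (f (N #> \<one>))"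
    unfolding L.sumset_def L.solutions_def by auto
  define \<omega>0 where "\<omega>0 = (N #> \<one>, z0)"
  have \<omega>0: "\<omega>0 \<in> \<Omega>" using z0 rcos_F[OF N(1,3) subgroup.one_closed[OF F]] by (simp add: \<omega>0_def \<Omega>_def)
  \<comment> \<open>The state at the vertex \<open>g\<close>.\<close>
  define st where "st g = act.\<rho> g \<omega>0" for g
  have st: "st g \<in> \<Omega>" if "g \<in> F" for g unfolding st_def using act.\<rho>_closed that \<omega>0 by blast
  have fst_lact: "fst (act.lact s \<omega>) = letter s <# fst \<omega>" if s: "fst s \<in> B" and \<omega>: "\<omega> \<in> \<Omega>" for s \<omega>
  proof (cases "snd s")
    case True
    then show ?thesis using \<pi>1[OF s \<omega>] by (simp add: act.lact_def letter_def)
  next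
    case False
    define \<omega>' where "\<omega>' = act.lact s \<omega>"
    have \<omega>': "\<omega>' \<in> \<Omega>" using act.lact_closed[OF s \<omega>] by (simp add: \<omega>'_def)
    have "\<pi> (fst s) \<omega>' = \<omega>"
      using False \<pi>[OF s] \<omega> by (simp add: \<omega>'_def act.lact_def bij_betw_inv_into_right)
    then have "fst \<omega> = fst s <# fst \<omega>'" using \<pi>1[OF s \<omega>'] by simp
    moreover have "fst \<omega>' \<subseteq> carrier G" using \<Omega>D(1)[OF \<omega>'] F_carrier by (auto simp: cosets_in_def)
    moreover have "fst s \<in> carrier G" using s BF F_carrier by blast
    ultimately show ?thesis using False translate_inv_cancel(1) by (simp add: \<omega>'_def letter_def)
  qed
  have fst_st: "fst (st g) = N #> g" if "g \<in> F" for g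
    using that
  proof (induct rule: F_induct)
    case one
    then show ?case by (simp add: st_def act.\<rho>_one \<omega>0_def)
  next
    case (step s h)
    have "fst (st (letter s \<otimes> h)) = letter s <# fst (st h)"
      using act.\<rho>_letter[OF step(2,1) \<omega>0] fst_lact[OF step(1) st[OF step(2)]] by (simp add: st_def)
    then show ?case using step translate_rcoset[OF FIN_normal[OF N(1)]] F_carrier by simp
  qed
  \<comment> \<open>The stabiliser has finite index because there are finitely many states.\<close>
  define H where "H = {g \<in> F. st g = \<omega>0}"
  have st_mult: "st (g \<otimes> h) = act.\<rho> g (st h)" if "g \<in> F" "h \<in> F" for g h
    using act.\<rho>_mult[OF that \<omega>0] by (simp add: st_def)
  have st_one: "st \<one> = \<omega>0" by (simp add: st_def act.\<rho>_one)
  have sH: "subgroup H G"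
  proof (rule subgroupI)
    show "H \<subseteq> carrier G" using F_carrier by (auto simp: H_def)
    show "H \<noteq> {}" using st_one subgroup.one_closed[OF F] by (auto simp: H_def)
    fix a b assume a: "a \<in> H" and b: "b \<in> H"
    have aF: "a \<in> F" "b \<in> F" "inv a \<in> F" using a b subgroup.m_inv_closed[OF F] by (auto simp: H_def)
    have "st (inv a \<otimes> a) = act.\<rho> (inv a) \<omega>0" using st_mult[OF aF(3,1)] a by (simp add: H_def)
    then show "inv a \<in> H" using st_one aF F_carrier by (simp add: H_def st_def)
    have "st (a \<otimes> b) = st a" using st_mult[OF aF(1,2)] b by (simp add: H_def st_def)
    then show "a \<otimes> b \<in> H" using a aF subgroup.m_closed[OF F] by (simp add: H_def)
  qed
  have fin\<Omega>: "finite \<Omega>"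
  proof -
    have finV: "finite (V s)" for s using finite_subset[OF VW W(2)] .
    have "finite (L.solutions ?S V c)" for c
      unfolding L.solutions_def
      by (rule finite_subset[of _ "Pi\<^sub>E ?S V"]) (use finS finV in \<open>auto intro!: finite_PiE\<close>)
    then show ?thesis unfolding \<Omega>_def using finite_cosets_in[OF N(1)] by (intro finite_SigmaI) auto
  qed
  have "finite (rcosets H)"
  proof (rule finite_index_by_invariant[OF sH F finite_index, where k = "\<lambda>g. st (inv g)"])
    show "finite ((\<lambda>g. st (inv g)) ` F)"
      by (rule finite_subset[OF _ fin\<Omega>]) (use st subgroup.m_inv_closed[OF F] in auto)
    fix g h assume g: "g \<in> F" "h \<in> F" "st (inv g) = st (inv h)"
    have i: "inv g \<in> F" "inv h \<in> F" using g subgroup.m_inv_closed[OF F] by auto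
    have "st (g \<otimes> inv h) = act.\<rho> g (st (inv g))" using st_mult[OF g(1) i(2)] g(3) by simp
    also have "\<dots> = st (g \<otimes> inv g)" using st_mult[OF g(1) i(1)] by simp
    finally show "g \<otimes> inv h \<in> H"
      using g i st_one F_carrier subgroup.m_closed[OF F] by (simp add: H_def)
  qed
  then obtain N' where N': "N' \<in> FIN" "N' \<subseteq> N" "N' \<subseteq> H" using ex_FIN_subset[OF N(1) sH] by blast
  have N'F: "N' \<subseteq> F" using N' by (auto simp: H_def)
  have st_coset: "st g = st h" if gh: "g \<in> F" "h \<in> F" "N' #> g = N' #> h" for g h
  proof -
    have c: "g \<in> carrier G" "h \<in> carrier G" using gh F_carrier by auto
    have "h \<in> g <# N'"
      using normal.coset_eq[OF FIN_normal[OF N'(1)]] gh(3) c rcos_self[OF c(2) FIN_subgroup[OF N'(1)]] by blast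
    then obtain n where n: "n \<in> N'" "h = g \<otimes> n" by (auto simp: l_coset_def)
    then have "n \<in> F" "st n = \<omega>0" using N'(3) by (auto simp: H_def)
    then have "st h = act.\<rho> g \<omega>0" using st_mult[OF gh(1)] n by simp
    then show ?thesis by (simp add: st_def)
  qed
  let ?\<C> = "cosets_in N' F"
  define rep where "rep C = (SOME g. g \<in> C)" for C :: "'a set"
  have rep: "rep C \<in> C" "rep C \<in> F" "C = N' #> rep C" if C: "C \<in> ?\<C>" for C
  proof -
    have CN: "C \<in> rcosets N'" using C by (simp add: cosets_in_def)
    obtain g where "g \<in> C" using CN by (rule rcoset_nonempty[OF FIN_subgroup[OF N'(1)]])
    then show r: "rep C \<in> C" unfolding rep_def by (rule someI)
    then show "rep C \<in> F" using C by (auto simp: cosets_in_def)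
    show "C = N' #> rep C" using rcoset_eq(1)[OF FIN_subgroup[OF N'(1)] CN r] .
  qed
  \<comment> \<open>The flow at the vertices in the coset \<open>C\<close>, all of which have the same state.\<close>
  define \<zeta> where "\<zeta> C = snd (st (rep C))" for C
  have \<zeta>sol: "\<zeta> C \<in> L.solutions ?S V (f (N #> rep C))" if "C \<in> ?\<C>" for C
    using \<Omega>D(2)[OF st[OF rep(2)[OF that]]] fst_st[OF rep(2)[OF that]] by (simp add: \<zeta>_def)
  have \<zeta>c: "\<zeta> C s \<in> carrier Mo" if "C \<in> ?\<C>" "s \<in> ?S" for C s
  proof -
    have "\<zeta> C s \<in> V s" using \<zeta>sol[OF that(1)] that(2) unfolding L.solutions_def by (auto dest: PiE_mem)
    then show ?thesis using VW W.a_subset by blast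
  qed
  have flow: "\<zeta> (x <# C) (x, True) = \<ominus>\<^bsub>Mo\<^esub> gact x (\<zeta> C (x, False))" if C: "C \<in> ?\<C>" and x: "x \<in> P" for C x
  proof -
    have xB: "x \<in> B" and xF: "x \<in> F" and xc: "x \<in> carrier G" using x P BF F_carrier by blast+
    let ?g = "rep C"
    have g: "?g \<in> F" "?g \<in> carrier G" using rep(2)[OF C] F_carrier by auto
    have D: "x <# C \<in> ?\<C>" using translate_cosets_in_F[OF N'(1) xF C] .
    have "x <# C = N' #> (x \<otimes> ?g)"
      using translate_rcoset[OF FIN_normal[OF N'(1)] xc g(2)] rep(3)[OF C] by simp
    then have "st (rep (x <# C)) = st (x \<otimes> ?g)"
      using rep[OF D] g xF subgroup.m_closed[OF F] by (intro st_coset) auto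
    also have "\<dots> = \<pi> x (st ?g)"
      using act.\<rho>_letter[of ?g "(x, True)", OF g(1) _ \<omega>0] xB by (simp add: st_def letter_def act.lact_def)
    finally show ?thesis using \<pi>2[OF x st[OF g(1)]] by (simp add: \<zeta>_def)
  qed
  have satA': "saturated N' A" using saturated_mono[OF N'(2) satA] .
  have fsum: "finsum Mo (\<zeta> C) ?S = (if C \<subseteq> A then w else \<zero>\<^bsub>Mo\<^esub>)" if C: "C \<in> ?\<C>" for C
  proof -
    have rA: "N #> rep C \<subseteq> A \<longleftrightarrow> C \<subseteq> A"
    proof
      assume "N #> rep C \<subseteq> A"
      moreover have "N' #> rep C \<subseteq> N #> rep C" using N'(2) by (auto simp: r_coset_def)
      ultimately have "N' #> rep C \<subseteq> A" by blast
      then show "C \<subseteq> A" using rep(3)[OF C] by metis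
    next
      assume "C \<subseteq> A"
      then show "N #> rep C \<subseteq> A" using satA rep(1)[OF C] by (auto simp: saturated_def)
    qed
    show ?thesis using \<zeta>sol[OF C] rA by (simp add: L.solutions_def f_def)
  qed
  have zero: "[(\<Sum>C\<in>?\<C>. mass (finsum Mo (\<zeta> C) ?S) C) = 0] (mod q)"
    by (rule flow_total_zero[OF P N'(1) N'F \<zeta>c flow])
  have "(\<Sum>C\<in>?\<C>. mass (finsum Mo (\<zeta> C) ?S) C) = (\<Sum>C\<in>?\<C>. if C \<subseteq> A then mass w C else 0)"
  proof (rule sum.cong)
    fix C assume C: "C \<in> ?\<C>"
    have "clopen C" using C clopen_rcoset[OF N'(1)] by (auto simp: cosets_in_def)
    then show "mass (finsum Mo (\<zeta> C) ?S) C = (if C \<subseteq> A then mass w C else 0)"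
      using fsum[OF C] mass_zero by simp
  qed simp
  also have "\<dots> = (\<Sum>C\<in>cosets_in N' (A \<inter> F). mass w C)"
    using finite_cosets_in[OF N'(1)] by (intro sum.mono_neutral_cong_right) (auto simp: cosets_in_def)
  finally have "[(\<Sum>C\<in>cosets_in N' (A \<inter> F). mass w C) = 0] (mod q)" using zero by simp
  moreover have "[mass w (A \<inter> F) = (\<Sum>C\<in>cosets_in N' (A \<inter> F). mass w C)] (mod q)"
    using satA' saturated_F[OF N'F] by (intro measure_saturated mass_measure wc N'(1) saturated_Int)
  ultimately have AF: "[mass w (A \<inter> F) = 0] (mod q)" using cong_trans by blast
  have "mass w (A - F) = 0" using w W(3) clopen_Diff[OF A clopen_F] unfolding on_F_def by blast
  moreover have "[mass w ((A \<inter> F) \<union> (A - F)) = mass w (A \<inter> F) + mass w (A - F)] (mod q)"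
    using mass_measure[OF wc] clopen_Int[OF A clopen_F] clopen_Diff[OF A clopen_F]
    unfolding is_measure_def by blast
  moreover have "(A \<inter> F) \<union> (A - F) = A" by blast
  ultimately show ?thesis using AF cong_trans by fastforce
qed

text \<open>Without a leaf the sum of all \<open>W \<inter> s W\<close> but one cannot be a proper subgroup, so \<open>core_mass_zero\<close>
  applies and all measures in \<open>W\<close> vanish.\<close>

lemma leaf:
  assumes P: "finite P" "P \<subseteq> B"
    and W: "additive_subgroup W Mo" "finite W" "W \<subseteq> on_F" "W \<noteq> {\<zero>\<^bsub>Mo\<^esub>}"
  shows "letter_module.has_leaf Mo (P \<times> UNIV) lact_Mo W"
proof (rule ccontr)
  interpret L: letter_module Mo p "P \<times> UNIV" lact_Mo by (rule letter_module_Mo[OF P(2)])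
  interpret W: additive_subgroup W Mo by (rule W(1))
  assume no: "\<not> L.has_leaf W"
  have core: "L.sumset T (\<lambda>s. L.overlap s W) = W"
    if T: "finite T" "\<exists>e. (P \<times> UNIV) - {e} \<subseteq> T" "T \<subseteq> P \<times> UNIV" for T
  proof (rule ccontr)
    assume ne: "L.sumset T (\<lambda>s. L.overlap s W) \<noteq> W"
    have Vs: "additive_subgroup (L.overlap s W) Mo" if "s \<in> T" for s
      using L.overlap_subgroup[OF W(1)] that T by blast
    have sub: "L.sumset T (\<lambda>s. L.overlap s W) \<subseteq> W"
      by (rule L.sumset_subset[OF T(1) Vs W(1)]) (auto simp: L.overlap_def)
    obtain e where e: "(P \<times> UNIV) - {e} \<subseteq> T" using T by blast
    have "\<forall>s\<in>(P \<times> UNIV) - {e}. L.overlap s W \<subseteq> L.sumset T (\<lambda>s. L.overlap s W)"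
    proof
      fix s assume "s \<in> (P \<times> UNIV) - {e}"
      then have "s \<in> T" using e by blast
      then show "L.overlap s W \<subseteq> L.sumset T (\<lambda>s. L.overlap s W)"
        using L.V_sumset[OF T(1), where V = "\<lambda>s. L.overlap s W"] Vs by simp
    qed
    moreover have "additive_subgroup (L.sumset T (\<lambda>s. L.overlap s W)) Mo"
      by (rule L.sumset_subgroup[OF T(1)]) (rule Vs)
    moreover have "L.sumset T (\<lambda>s. L.overlap s W) \<subset> W" using sub ne by (rule psubsetI)
    ultimately have "L.has_leaf W" unfolding L.has_leaf_def
      by (intro exI[of _ "L.sumset T (\<lambda>s. L.overlap s W)"] exI[of _ e] conjI)
    then show False using no by blast
  qed
  have "w = \<zero>\<^bsub>Mo\<^esub>" if w: "w \<in> W" for w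
  proof (rule Mo_eqI)
    fix A assume A: "clopen A"
    show "[mass w A = mass \<zero>\<^bsub>Mo\<^esub> A] (mod q)"
      using core_mass_zero[OF P W(1,2,3) core w A] mass_zero[OF A] by simp
  qed (use w W.a_subset in auto)
  then show False using W(4) W.zero_closed by blast
qed

end

section \<open>Spans and linear independence\<close>

text \<open>Additive groups are ring records, which explains the type.\<close>

definition modfun :: "int \<Rightarrow> 'w set \<Rightarrow> ('w \<Rightarrow> int) ring" where
  "modfun m \<Omega> = \<lparr>carrier = \<Omega> \<rightarrow>\<^sub>E {0..<m}, monoid.mult = (\<lambda>f g. f), one = (\<lambda>\<omega>\<in>\<Omega>. 0),
     zero = (\<lambda>\<omega>\<in>\<Omega>. 0), add = (\<lambda>f g. \<lambda>\<omega>\<in>\<Omega>. (f \<omega> + g \<omega>) mod m)\<rparr>"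

lemma torsion_group_modfun:
  assumes p: "prime p" shows "torsion_group (modfun (int p) \<Omega>) p"
proof -
  let ?X = "modfun (int p) \<Omega>"
  have p0: "int p > 0" using prime_gt_0_nat[OF p] by simp
  have ab: "abelian_group ?X"
  proof (rule abelian_groupI)
    fix f assume f: "f \<in> carrier ?X"
    show "\<zero>\<^bsub>?X\<^esub> \<oplus>\<^bsub>?X\<^esub> f = f"
      using f by (auto simp: modfun_def PiE_def extensional_def Pi_def fun_eq_iff)
    have "(\<lambda>\<omega>\<in>\<Omega>. (- f \<omega>) mod int p) \<in> carrier ?X" using p0 by (auto simp: modfun_def)
    moreover have "(\<lambda>\<omega>\<in>\<Omega>. (- f \<omega>) mod int p) \<oplus>\<^bsub>?X\<^esub> f = \<zero>\<^bsub>?X\<^esub>"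
      by (auto simp: modfun_def mod_add_left_eq fun_eq_iff)
    ultimately show "\<exists>g\<in>carrier ?X. g \<oplus>\<^bsub>?X\<^esub> f = \<zero>\<^bsub>?X\<^esub>" by blast
  qed (use p0 in \<open>auto simp: modfun_def fun_eq_iff mod_add_left_eq mod_add_right_eq add_ac\<close>)
  interpret X: abelian_group ?X by (rule ab)
  have mult: "f \<in> carrier ?X \<Longrightarrow> [(k::nat)] \<cdot>\<^bsub>?X\<^esub> f = (\<lambda>\<omega>\<in>\<Omega>. (int k * f \<omega>) mod int p)" for f k
  proof (induct k)
    case (Suc k)
    have "[Suc k] \<cdot>\<^bsub>?X\<^esub> f = (\<lambda>\<omega>\<in>\<Omega>. (int k * f \<omega>) mod int p) \<oplus>\<^bsub>?X\<^esub> f"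
      by (simp only: X.add.nat_pow_Suc Suc(1)[OF Suc(2)])
    also have "\<dots> = (\<lambda>\<omega>\<in>\<Omega>. (int (Suc k) * f \<omega>) mod int p)"
      by (auto simp: modfun_def fun_eq_iff mod_add_left_eq mod_add_right_eq algebra_simps)
    finally show ?case .
  next
    case 0
    have "[(0::nat)] \<cdot>\<^bsub>?X\<^esub> f = \<zero>\<^bsub>?X\<^esub>" by simp
    also have "\<dots> = (\<lambda>\<omega>\<in>\<Omega>. (int 0 * f \<omega>) mod int p)" by (auto simp: modfun_def fun_eq_iff)
    finally show ?case .
  qed
  show ?thesis
  proof (unfold_locales)
    show "prime p" by (rule p)
    fix f assume "f \<in> carrier ?X"
    then have "[p] \<cdot>\<^bsub>?X\<^esub> f = (\<lambda>\<omega>\<in>\<Omega>. (int p * f \<omega>) mod int p)" by (rule mult)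
    also have "\<dots> = \<zero>\<^bsub>?X\<^esub>" by (auto simp: modfun_def fun_eq_iff)
    finally show "[p] \<cdot>\<^bsub>?X\<^esub> f = \<zero>\<^bsub>?X\<^esub>" .
  qed
qed

lemma finsum_modfun:
  assumes p: "prime p" and f: "\<And>i. i \<in> I \<Longrightarrow> f i \<in> carrier (modfun (int p) \<Omega>)" and \<omega>: "\<omega> \<in> \<Omega>"
  shows "finsum (modfun (int p) \<Omega>) f I \<omega> = (\<Sum>i\<in>I. f i \<omega>) mod int p"
  using f
proof (induct I rule: infinite_finite_induct)
  let ?X = "modfun (int p) \<Omega>"
  interpret X: torsion_group ?X p by (rule torsion_group_modfun[OF p])
  {
    case (insert i I)
    have "finsum ?X f (insert i I) = f i \<oplus>\<^bsub>?X\<^esub> finsum ?X f I" using insert by (intro X.finsum_insert) auto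
    moreover have "(f i \<oplus>\<^bsub>?X\<^esub> finsum ?X f I) \<omega> = (f i \<omega> + finsum ?X f I \<omega>) mod int p"
      using \<omega> by (simp add: modfun_def)
    ultimately show ?case using insert by (simp add: mod_add_right_eq)
  next
    case empty
    then show ?case using \<omega> by (simp) (simp add: modfun_def)
  next
    case (infinite I)
    then show ?case using \<omega> by (simp add: X.finsum_infinite) (simp add: modfun_def)
  }
qed

context mod_p_group_ring
begin

abbreviation comb where
  "comb c X \<equiv> (\<Oplus>\<^bsub>Mo\<^esub>b\<in>X. c b \<bullet> b)"

text \<open>Coefficients are restricted to a set \<open>C\<close> in order to treat the group rings of \<open>F\<close> and \<open>G\<close>, as well as
  coefficients supported on a finite set, as subsets of the same ring.\<close>

definition span :: "('a \<Rightarrow> int) set \<Rightarrow> ('a set \<Rightarrow> 'a set \<Rightarrow> int) set \<Rightarrow> ('a set \<Rightarrow> 'a set \<Rightarrow> int) set" where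
  "span C X = (\<lambda>c. comb c X) ` (X \<rightarrow> C)"

lemma spanI: "c \<in> X \<rightarrow> C \<Longrightarrow> comb c X \<in> span C X"
  unfolding span_def by (rule imageI)

definition independent :: "('a \<Rightarrow> int) set \<Rightarrow> ('a set \<Rightarrow> 'a set \<Rightarrow> int) set \<Rightarrow> bool" where
  "independent C X \<longleftrightarrow> (\<forall>c\<in>X \<rightarrow> C. comb c X = \<zero>\<^bsub>Mo\<^esub> \<longrightarrow> (\<forall>b\<in>X. c b = \<zero>\<^bsub>R\<^esub>))"

definition additive_coeffs :: "('a \<Rightarrow> int) set \<Rightarrow> bool" where
  "additive_coeffs C \<longleftrightarrow> C \<subseteq> carrier R \<and> \<zero>\<^bsub>R\<^esub> \<in> C \<and> (\<forall>f\<in>C. \<forall>g\<in>C. f \<oplus>\<^bsub>R\<^esub> g \<in> C)"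

lemma smult_l_zero: "u \<in> carrier Mo \<Longrightarrow> \<zero>\<^bsub>R\<^esub> \<bullet> u = \<zero>\<^bsub>Mo\<^esub>"
proof -
  assume u: "u \<in> carrier Mo"
  have "\<zero>\<^bsub>R\<^esub> \<bullet> u \<boxplus> \<zero>\<^bsub>R\<^esub> \<bullet> u = \<zero>\<^bsub>R\<^esub> \<bullet> u"
    using LM.smult_l_distr[OF zero_R zero_R u] by simp
  then show ?thesis using Mo_smult_closed[OF zero_R u] by simp
qed

lemma comb_term_closed: "C \<subseteq> carrier R \<Longrightarrow> X \<subseteq> carrier Mo \<Longrightarrow> c \<in> X \<rightarrow> C \<Longrightarrow> b \<in> X \<Longrightarrow> c b \<bullet> b \<in> carrier Mo"
  by (rule Mo_smult_closed) auto

lemma span_carrier: "C \<subseteq> carrier R \<Longrightarrow> X \<subseteq> carrier Mo \<Longrightarrow> span C X \<subseteq> carrier Mo"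
  unfolding span_def using comb_term_closed by (auto intro!: Mo.finsum_closed)

lemma comb_add:
  assumes C: "C \<subseteq> carrier R" and X: "X \<subseteq> carrier Mo" and c: "c \<in> X \<rightarrow> C" "d \<in> X \<rightarrow> C"
  shows "(\<Oplus>\<^bsub>Mo\<^esub>b\<in>X. (c b \<oplus>\<^bsub>R\<^esub> d b) \<bullet> b) = comb c X \<boxplus> comb d X"
proof -
  have cl: "c b \<bullet> b \<in> carrier Mo" "d b \<bullet> b \<in> carrier Mo" if "b \<in> X" for b
    using comb_term_closed[OF C X c(1) that] comb_term_closed[OF C X c(2) that] .
  have "(\<Oplus>\<^bsub>Mo\<^esub>b\<in>X. (c b \<oplus>\<^bsub>R\<^esub> d b) \<bullet> b) = (\<Oplus>\<^bsub>Mo\<^esub>b\<in>X. c b \<bullet> b \<boxplus> d b \<bullet> b)"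
  proof (rule Mo.finsum_cong')
    fix b assume b: "b \<in> X"
    have "c b \<in> carrier R" "d b \<in> carrier R" "b \<in> carrier Mo" using b c C X by auto
    then show "(c b \<oplus>\<^bsub>R\<^esub> d b) \<bullet> b = c b \<bullet> b \<boxplus> d b \<bullet> b" by (rule LM.smult_l_distr)
  qed (use cl in auto)
  also have "\<dots> = comb c X \<boxplus> comb d X"
    by (rule Mo.finsum_addf) (use cl in auto)
  finally show ?thesis .
qed

lemma comb_zero: "X \<subseteq> carrier Mo \<Longrightarrow> (\<Oplus>\<^bsub>Mo\<^esub>b\<in>X. \<zero>\<^bsub>R\<^esub> \<bullet> b) = \<zero>\<^bsub>Mo\<^esub>"
  using smult_l_zero by (intro Mo.add.finprod_one_eqI) auto

lemma span_subgroup: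
  assumes C: "additive_coeffs C" and X: "X \<subseteq> carrier Mo"
  shows "additive_subgroup (span C X) Mo"
proof -
  interpret torsion_group Mo p by (rule torsion_Mo)
  have Cc: "C \<subseteq> carrier R" using C by (simp add: additive_coeffs_def)
  show ?thesis
  proof (rule additive_subgroup_intro)
    show "span C X \<subseteq> carrier Mo" using span_carrier[OF Cc X] .
    have "(\<lambda>_. \<zero>\<^bsub>R\<^esub>) \<in> X \<rightarrow> C" using C by (simp add: additive_coeffs_def)
    from spanI[OF this] show "\<zero>\<^bsub>Mo\<^esub> \<in> span C X" unfolding comb_zero[OF X] .
    fix u v assume "u \<in> span C X" "v \<in> span C X"
    then obtain c d where cd: "c \<in> X \<rightarrow> C" "d \<in> X \<rightarrow> C"
      "u = comb c X" "v = comb d X"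
      by (auto simp: span_def)
    have "(\<lambda>b. c b \<oplus>\<^bsub>R\<^esub> d b) \<in> X \<rightarrow> C" using cd(1,2) C by (simp add: additive_coeffs_def Pi_iff)
    then show "u \<boxplus> v \<in> span C X" unfolding span_def cd(3,4) comb_add[OF Cc X cd(1,2), symmetric]
      by (rule imageI)
  qed
qed

lemma finsum_in_subgroup:
  assumes W: "additive_subgroup W Mo" and u: "\<And>i. i \<in> I \<Longrightarrow> u i \<in> W"
  shows "finsum Mo u I \<in> W"
  using u
proof (induct I rule: infinite_finite_induct)
  case (insert i I)
  have "finsum Mo u (insert i I) = u i \<boxplus> finsum Mo u I"
    using insert additive_subgroup.a_subset[OF W] by (intro Mo.finsum_insert) auto
  then show ?case using insert additive_subgroup.a_closed[OF W] by simp
qed (simp_all add: Mo.finsum_infinite additive_subgroup.zero_closed[OF W])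

lemma span_base:
  assumes C: "additive_coeffs C" "\<one>\<^bsub>R\<^esub> \<in> C" and X: "X \<subseteq> carrier Mo" "finite X" and b: "b \<in> X"
  shows "b \<in> span C X"
proof -
  let ?c = "\<lambda>a. if a = b then \<one>\<^bsub>R\<^esub> else \<zero>\<^bsub>R\<^esub>"
  have c: "?c \<in> X \<rightarrow> C" using C by (auto simp: additive_coeffs_def)
  have "comb ?c X = (\<Oplus>\<^bsub>Mo\<^esub>a\<in>X. if b = a then a else \<zero>\<^bsub>Mo\<^esub>)"
    using X smult_l_zero LM.smult_one by (intro Mo.finsum_cong') auto
  also have "\<dots> = b" using X b by (intro Mo.add.finprod_singleton) auto
  finally have eq: "comb ?c X = b" .
  show ?thesis using spanI[OF c] unfolding eq .
qed

definition subring_coeffs :: "('a \<Rightarrow> int) set \<Rightarrow> bool" where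
  "subring_coeffs C \<longleftrightarrow> additive_coeffs C \<and> \<one>\<^bsub>R\<^esub> \<in> C \<and> (\<forall>f\<in>C. \<forall>g\<in>C. f \<otimes>\<^bsub>R\<^esub> g \<in> C)"

lemma smult_finsum:
  assumes f: "f \<in> carrier R"
  shows "(\<And>i. i \<in> I \<Longrightarrow> u i \<in> carrier Mo) \<Longrightarrow> f \<bullet> finsum Mo u I = (\<Oplus>\<^bsub>Mo\<^esub>i\<in>I. f \<bullet> u i)"
proof (induct I rule: infinite_finite_induct)
  case (insert i I)
  have "f \<bullet> finsum Mo u (insert i I) = f \<bullet> (u i \<boxplus> finsum Mo u I)"
    using insert by (subst Mo.finsum_insert) auto
  also have "\<dots> = f \<bullet> u i \<boxplus> f \<bullet> finsum Mo u I"
    using insert f by (intro LM.smult_r_distr) auto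
  also have "\<dots> = (\<Oplus>\<^bsub>Mo\<^esub>i\<in>insert i I. f \<bullet> u i)"
    using insert f Mo_smult_closed by (subst Mo.finsum_insert) auto
  finally show ?case .
next
  case empty
  have "f \<bullet> \<zero>\<^bsub>Mo\<^esub> \<boxplus> f \<bullet> \<zero>\<^bsub>Mo\<^esub> = f \<bullet> \<zero>\<^bsub>Mo\<^esub>"
    using LM.smult_r_distr[OF f Mo.zero_closed Mo.zero_closed] by simp
  then show ?case using Mo_smult_closed[OF f Mo.zero_closed] by simp
next
  case (infinite I)
  have "f \<bullet> \<zero>\<^bsub>Mo\<^esub> \<boxplus> f \<bullet> \<zero>\<^bsub>Mo\<^esub> = f \<bullet> \<zero>\<^bsub>Mo\<^esub>"
    using LM.smult_r_distr[OF f Mo.zero_closed Mo.zero_closed] by simp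
  then show ?case using infinite Mo_smult_closed[OF f Mo.zero_closed] by (simp add: Mo.finsum_infinite)
qed

lemma span_smult:
  assumes C: "subring_coeffs C" and X: "X \<subseteq> carrier Mo" and f: "f \<in> C" and u: "u \<in> span C X"
  shows "f \<bullet> u \<in> span C X"
proof -
  have Cc: "C \<subseteq> carrier R" using C by (simp add: subring_coeffs_def additive_coeffs_def)
  obtain c where c: "c \<in> X \<rightarrow> C" "u = comb c X" using u by (auto simp: span_def)
  have fR: "f \<in> carrier R" using f Cc by blast
  have "f \<bullet> u = (\<Oplus>\<^bsub>Mo\<^esub>b\<in>X. f \<bullet> (c b \<bullet> b))"
    unfolding c(2) by (rule smult_finsum[OF fR comb_term_closed[OF Cc X c(1)]])
  also have "\<dots> = (\<Oplus>\<^bsub>Mo\<^esub>b\<in>X. (f \<otimes>\<^bsub>R\<^esub> c b) \<bullet> b)"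
  proof (rule Mo.finsum_cong')
    fix b assume b: "b \<in> X"
    have "c b \<in> carrier R" "b \<in> carrier Mo" using b c Cc X by auto
    then show "f \<bullet> (c b \<bullet> b) = (f \<otimes>\<^bsub>R\<^esub> c b) \<bullet> b" using LM.smult_assoc[OF fR] by simp
  next
    show "(\<lambda>b. (f \<otimes>\<^bsub>R\<^esub> c b) \<bullet> b) \<in> X \<rightarrow> carrier Mo"
      using c Cc X fR R_mult_closed by (auto intro!: Mo_smult_closed)
  qed simp
  finally have eq: "f \<bullet> u = (\<Oplus>\<^bsub>Mo\<^esub>b\<in>X. (f \<otimes>\<^bsub>R\<^esub> c b) \<bullet> b)" .
  have "(\<lambda>b. f \<otimes>\<^bsub>R\<^esub> c b) \<in> X \<rightarrow> C" using c f C by (simp add: subring_coeffs_def Pi_iff)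
  from spanI[OF this] show ?thesis unfolding eq .
qed

lemma span_trans:
  assumes C: "subring_coeffs C" and Y: "Y \<subseteq> carrier Mo" and X: "X \<subseteq> span C Y"
  shows "span C X \<subseteq> span C Y"
proof
  fix u assume "u \<in> span C X"
  then obtain c where c: "c \<in> X \<rightarrow> C" "u = comb c X" by (auto simp: span_def)
  have sub: "additive_subgroup (span C Y) Mo" using C Y span_subgroup by (simp add: subring_coeffs_def)
  show "u \<in> span C Y" unfolding c(2)
    using c(1) X by (intro finsum_in_subgroup[OF sub] span_smult[OF C Y]) auto
qed

lemma subring_coeffs_R: "subring_coeffs (carrier R)"
  by (simp add: subring_coeffs_def additive_coeffs_def zero_R one_R R_add_closed R_mult_closed)

end

context virtually_free
begin

text \<open>For \<open>T = F\<close> this is the group ring of \<open>F\<close>.\<close>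

definition ring_on :: "'a set \<Rightarrow> ('a \<Rightarrow> int) set" where
  "ring_on T = {f \<in> carrier R. supp f \<subseteq> T}"

lemma supp_zero: "supp \<zero>\<^bsub>R\<^esub> = {}" by (auto simp: supp_def R_zero)
lemma supp_one: "supp \<one>\<^bsub>R\<^esub> \<subseteq> {\<one>}" by (auto simp: supp_def R_one)

lemma subring_coeffs_ring_on_F: "subring_coeffs (ring_on F)"
  unfolding subring_coeffs_def additive_coeffs_def
proof (intro conjI ballI)
  show "\<zero>\<^bsub>R\<^esub> \<in> ring_on F" by (simp add: ring_on_def zero_R supp_zero)
  show "\<one>\<^bsub>R\<^esub> \<in> ring_on F" using supp_one subgroup.one_closed[OF F] by (auto simp: ring_on_def one_R)
  fix f g assume fg: "f \<in> ring_on F" "g \<in> ring_on F"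
  then show "f \<oplus>\<^bsub>R\<^esub> g \<in> ring_on F" using supp_add[of f g] by (auto simp: ring_on_def R_add_closed)
  have c: "f \<in> carrier R" "g \<in> carrier R" using fg by (auto simp: ring_on_def)
  have "supp (f \<otimes>\<^bsub>R\<^esub> g) \<subseteq> F"
  proof
    fix x assume "x \<in> supp (f \<otimes>\<^bsub>R\<^esub> g)"
    then obtain y z where "x = y \<otimes> z" "y \<in> supp f" "z \<in> supp g" using supp_mult[OF c] by auto
    moreover have "supp f \<subseteq> F" "supp g \<subseteq> F" using fg by (simp_all add: ring_on_def)
    ultimately show "x \<in> F" using subgroup.m_closed[OF F] by blast
  qed
  then show "f \<otimes>\<^bsub>R\<^esub> g \<in> ring_on F" using c R_mult_closed by (simp add: ring_on_def)
qed (auto simp: ring_on_def)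

lemma on_F_subgroup: "additive_subgroup on_F Mo"
proof -
  interpret torsion_group Mo p by (rule torsion_Mo)
  show ?thesis
  proof (rule additive_subgroup_intro)
    show "on_F \<subseteq> carrier Mo" by (auto simp: on_F_def)
    show "\<zero>\<^bsub>Mo\<^esub> \<in> on_F" by (simp add: on_F_def mass_zero)
    fix u v assume uv: "u \<in> on_F" "v \<in> on_F"
    have "mass (u \<boxplus> v) A = 0" if A: "clopen A" "A \<inter> F = {}" for A
    proof -
      have "[mass (u \<boxplus> v) A = mass u A + mass v A] (mod q)"
        using uv A by (intro mass_add) (auto simp: on_F_def)
      moreover have "mass u A = 0" "mass v A = 0" using uv A by (auto simp: on_F_def)
      ultimately show ?thesis using mass_mod[of "u \<boxplus> v" A] by (simp add: cong_def)
    qed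
    then show "u \<boxplus> v \<in> on_F" using uv by (simp add: on_F_def)
  qed
qed

lemma on_F_smult:
  assumes f: "f \<in> ring_on F" and u: "u \<in> on_F" shows "f \<bullet> u \<in> on_F"
proof -
  have fR: "f \<in> carrier R" and uc: "u \<in> carrier Mo" using f u by (auto simp: ring_on_def on_F_def)
  have "mass (f \<bullet> u) A = 0" if A: "clopen A" "A \<inter> F = {}" for A
  proof -
    have "mass u (inv x <# A) = 0" if x: "x \<in> supp f" for x
    proof -
      have xF: "x \<in> F" using x f by (auto simp: ring_on_def)
      have xc: "x \<in> carrier G" using xF F_carrier by blast
      have "(inv x <# A) \<inter> F = {}"
      proof (rule equals0I)
        fix y assume y: "y \<in> (inv x <# A) \<inter> F"
        have "inv (inv x) \<otimes> y \<in> A"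
          using y mem_translate[OF inv_closed[OF xc] clopen_carrier[OF A(1)]] by blast
        then have "x \<otimes> y \<in> A" using xc by simp
        moreover have "x \<otimes> y \<in> F" using y xF subgroup.m_closed[OF F] by blast
        ultimately show False using A(2) by blast
      qed
      then show ?thesis using u clopen_translate[OF A(1) inv_closed[OF xc]] unfolding on_F_def by blast
    qed
    then have "[mass (f \<bullet> u) A = 0] (mod q)" using mass_smult[OF fR uc A(1)] by simp
    then show ?thesis using mass_mod[of "f \<bullet> u" A] by (simp add: cong_def)
  qed
  then show ?thesis using Mo_smult_closed[OF fR uc] by (simp add: on_F_def)
qed

lemma span_on_F:
  assumes "X \<subseteq> on_F" "C \<subseteq> ring_on F" shows "span C X \<subseteq> on_F"
  unfolding span_def using assms
  by (auto intro!: finsum_in_subgroup[OF on_F_subgroup] on_F_smult simp: subset_iff Pi_iff)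


text \<open>Coefficients modulo \<open>p\<close> act as multiples, so additive maps that commute with group elements respect
  linear combinations.\<close>

lemma smult_as_multiples:
  assumes f: "f \<in> carrier R" "supp f \<subseteq> T" and T: "finite T" "T \<subseteq> carrier G" and u: "u \<in> carrier Mo"
  shows "f \<bullet> u = (\<Oplus>\<^bsub>Mo\<^esub>g\<in>T. [(nat (f g))] \<cdot>\<^bsub>Mo\<^esub> gact g u)"
proof (rule Mo_eqI)
  have gc: "gact g u \<in> carrier Mo" if "g \<in> T" for g using that T u gact_closed by blast
  show "f \<bullet> u \<in> carrier Mo" using f u Mo_smult_closed by blast
  show "(\<Oplus>\<^bsub>Mo\<^esub>g\<in>T. [(nat (f g))] \<cdot>\<^bsub>Mo\<^esub> gact g u) \<in> carrier Mo"
    using gc by (intro Mo.finsum_closed) auto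
  fix A assume A: "clopen A"
  have nn: "int (nat (f g)) = f g" if "g \<in> T" for g
    using R_val[OF f(1), of g] that T by (auto simp: K_simps)
  have "[mass (\<Oplus>\<^bsub>Mo\<^esub>g\<in>T. [(nat (f g))] \<cdot>\<^bsub>Mo\<^esub> gact g u) A = (\<Sum>g\<in>T. mass ([(nat (f g))] \<cdot>\<^bsub>Mo\<^esub> gact g u) A)] (mod q)"
    using gc by (intro mass_finsum A) auto
  also have "[(\<Sum>g\<in>T. mass ([(nat (f g))] \<cdot>\<^bsub>Mo\<^esub> gact g u) A) = (\<Sum>g\<in>T. int (nat (f g)) * mass (gact g u) A)] (mod q)"
    using gc by (intro cong_sum mass_multiple A) auto
  also have "(\<Sum>g\<in>T. int (nat (f g)) * mass (gact g u) A) = (\<Sum>g\<in>T. f g * mass u (inv g <# A))"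
    using nn T u A by (intro sum.cong refl) (simp add: mass_gact subset_iff)
  also have "(\<Sum>g\<in>T. f g * mass u (inv g <# A)) = (\<Sum>g\<in>supp f. f g * mass u (inv g <# A))"
    using f(2) T by (intro sum_supp) auto
  also have "[(\<Sum>g\<in>supp f. f g * mass u (inv g <# A)) = mass (f \<bullet> u) A] (mod q)"
    using f u A by (intro cong_sym[OF mass_smult])
  finally show "[mass (f \<bullet> u) A = mass (\<Oplus>\<^bsub>Mo\<^esub>g\<in>T. [(nat (f g))] \<cdot>\<^bsub>Mo\<^esub> gact g u) A] (mod q)"
    by (rule cong_sym)
qed

text \<open>Left multiplication by \<open>x\<close> is injective where it stays inside the finite set \<open>T\<close>, so it extends to a
  permutation of \<open>T\<close>.\<close>

lemma ex_translation_permutations: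
  assumes T: "finite T" "suffix_closed T"
  obtains \<pi> where "\<And>x. x \<in> B \<Longrightarrow> bij_betw (\<pi> x) T T"
    "\<And>x g. x \<in> B \<Longrightarrow> g \<in> T \<Longrightarrow> x \<otimes> g \<in> T \<Longrightarrow> \<pi> x g = x \<otimes> g"
proof -
  have Tc: "T \<subseteq> carrier G" using T(2) F_carrier by (auto simp: suffix_closed_def)
  have "\<exists>\<pi>. bij_betw \<pi> T T \<and> (\<forall>g\<in>T. x \<otimes> g \<in> T \<longrightarrow> \<pi> g = x \<otimes> g)" if x: "x \<in> B" for x
  proof -
    have xc: "x \<in> carrier G" using x BF F_carrier by blast
    obtain \<pi> where "bij_betw \<pi> T T" "\<And>g. g \<in> {g \<in> T. x \<otimes> g \<in> T} \<Longrightarrow> \<pi> g = x \<otimes> g"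
    proof (rule extend_partial_injection[OF T(1), of "{g \<in> T. x \<otimes> g \<in> T}" "(\<otimes>) x"])
      show "inj_on ((\<otimes>) x) {g \<in> T. x \<otimes> g \<in> T}" using xc Tc by (intro inj_onI) (auto simp: subset_iff)
    qed auto
    then show ?thesis by blast
  qed
  then obtain \<pi> where "\<forall>x\<in>B. bij_betw (\<pi> x) T T \<and> (\<forall>g\<in>T. x \<otimes> g \<in> T \<longrightarrow> \<pi> x g = x \<otimes> g)"
    using bchoice[of B "\<lambda>x \<pi>. bij_betw \<pi> T T \<and> (\<forall>g\<in>T. x \<otimes> g \<in> T \<longrightarrow> \<pi> g = x \<otimes> g)"] by blast
  then show ?thesis using that by blast
qed

lemma additive_coeffs_ring_on: "additive_coeffs (ring_on T)"
  using supp_add by (fastforce simp: additive_coeffs_def ring_on_def zero_R supp_zero R_add_closed)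

lemma finite_ring_on:
  assumes "finite T" shows "finite (ring_on T)"
proof -
  have "ring_on T \<subseteq> (\<lambda>h. \<lambda>x\<in>carrier G. if x \<in> T then h x else 0) ` (T \<rightarrow>\<^sub>E carrier K)"
  proof
    fix f assume "f \<in> ring_on T"
    then have f: "f \<in> carrier G \<rightarrow>\<^sub>E carrier K" "supp f \<subseteq> T" by (auto simp: ring_on_def R_carrier)
    have K0: "0 \<in> carrier K" using q1 by (simp add: K_simps)
    let ?h = "\<lambda>x\<in>T. if x \<in> carrier G then f x else 0"
    have "?h \<in> T \<rightarrow>\<^sub>E carrier K" using f K0 by auto
    moreover have "f = (\<lambda>x\<in>carrier G. if x \<in> T then ?h x else 0)"
    proof
      fix x show "f x = (\<lambda>x\<in>carrier G. if x \<in> T then ?h x else 0) x"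
        using f by (cases "x \<in> carrier G") (auto simp: supp_def PiE_def extensional_def)
    qed
    ultimately show "f \<in> (\<lambda>h. \<lambda>x\<in>carrier G. if x \<in> T then h x else 0) ` (T \<rightarrow>\<^sub>E carrier K)" by blast
  qed
  moreover have "finite (T \<rightarrow>\<^sub>E carrier K)" using assms by (intro finite_PiE) (auto simp: K_simps)
  ultimately show ?thesis by (meson finite_imageI finite_subset)
qed

lemma finite_span:
  assumes "finite C" "finite X" "C \<subseteq> carrier R" "X \<subseteq> carrier Mo" shows "finite (span C X)"
proof -
  have "span C X \<subseteq> (\<lambda>c. comb c X) ` (X \<rightarrow>\<^sub>E C)"
  proof
    fix u assume "u \<in> span C X"
    then obtain c where c: "c \<in> X \<rightarrow> C" "u = comb c X" by (auto simp: span_def)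
    have "comb (restrict c X) X = u" unfolding c(2)
      using comb_term_closed[OF assms(3,4) c(1)] by (intro Mo.finsum_cong') auto
    moreover have "restrict c X \<in> X \<rightarrow>\<^sub>E C" using c(1) by auto
    ultimately show "u \<in> (\<lambda>c. comb c X) ` (X \<rightarrow>\<^sub>E C)" by blast
  qed
  then show ?thesis using finite_PiE[OF assms(2)] assms(1) by (meson finite_imageI finite_subset)
qed

end

lemma additive_on_finsum:
  assumes M: "abelian_group M" and X: "abelian_group X" and W: "additive_subgroup W M"
    and \<phi>: "additive_on M X W \<phi>"
  shows "(\<And>i. i \<in> I \<Longrightarrow> u i \<in> W) \<Longrightarrow> finsum M u I \<in> W \<and> \<phi> (finsum M u I) = finsum X (\<lambda>i. \<phi> (u i)) I"
proof (induct I rule: infinite_finite_induct)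
  interpret M: abelian_group M by fact
  interpret X: abelian_group X by fact
  interpret W: additive_subgroup W M by fact
  {
    case (insert i I)
    have "finsum M u (insert i I) = u i \<oplus>\<^bsub>M\<^esub> finsum M u I"
      using insert W.a_subset by (intro M.finsum_insert) auto
    moreover have "finsum X (\<lambda>i. \<phi> (u i)) (insert i I) = \<phi> (u i) \<oplus>\<^bsub>X\<^esub> finsum X (\<lambda>i. \<phi> (u i)) I"
      using insert \<phi> by (intro X.finsum_insert) (auto simp: additive_on_def)
    ultimately show ?case using insert \<phi> by (simp add: additive_on_def)
  next
    case empty
    then show ?case using additive_on_zero[OF M X \<phi>] by simp
  next
    case (infinite I)
    then show ?case using additive_on_zero[OF M X \<phi>] by (simp add: M.finsum_infinite X.finsum_infinite)
  }
qed

section \<open>A finite module that detects relations\<close>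

text \<open>The functions on the finite set \<open>T\<close> become a module over the free group. It distinguishes the elements
  of \<open>T\<close>, because \<open>g\<close> moves the unit to \<open>g\<close> (\<open>\<rho>_base\<close>); this is how residual finiteness of free
  groups enters.\<close>

locale finite_model = virtually_free G p F B + free_action G F B \<pi> T
  for G :: "('a, 'b) monoid_scheme" (structure) and p F B and \<pi> :: "'a \<Rightarrow> 'a \<Rightarrow> 'a" and T +
  assumes T: "finite T" "suffix_closed T"
    and translate: "x \<in> B \<Longrightarrow> g \<in> T \<Longrightarrow> x \<otimes> g \<in> T \<Longrightarrow> \<pi> x g = x \<otimes> g"
begin

abbreviation FunT :: "('a \<Rightarrow> int) ring" where "FunT \<equiv> modfun q T"

definition actX :: "'a \<times> bool \<Rightarrow> ('a \<Rightarrow> int) \<Rightarrow> 'a \<Rightarrow> int" where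
  "actX s \<xi> = (\<lambda>\<omega>\<in>T. \<xi> (lact (flip s) \<omega>))"

lemma TF: "T \<subseteq> F" using T(2) by (simp add: suffix_closed_def)
lemma Tc: "T \<subseteq> carrier G" using TF F_carrier by blast
lemma one_T: "\<one> \<in> T" using T(2) by (simp add: suffix_closed_def)
lemma FunT_carrier: "carrier FunT = T \<rightarrow>\<^sub>E {0..<q}" by (simp add: modfun_def)

lemma letter_module_FunT:
  assumes "P \<subseteq> B" shows "letter_module FunT p (P \<times> UNIV) actX"
proof -
  interpret torsion_group FunT p by (rule torsion_group_modfun[OF p])
  show ?thesis
  proof (unfold_locales)
    fix s :: "'a \<times> bool" assume s: "s \<in> P \<times> UNIV"
    then show "flip s \<in> P \<times> UNIV" by (auto simp: flip_def)
    have sB: "fst s \<in> B" "fst (flip s) \<in> B" using s assms by (auto simp: flip_def)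
    fix \<xi> assume \<xi>: "\<xi> \<in> carrier FunT"
    show "actX s \<xi> \<in> carrier FunT"
      using \<xi> lact_closed[OF sB(2)] by (simp add: actX_def FunT_carrier PiE_iff)
    show "actX (flip s) (actX s \<xi>) = \<xi>"
    proof
      fix \<omega> show "actX (flip s) (actX s \<xi>) \<omega> = \<xi> \<omega>"
        using \<xi> lact_closed[OF sB(1)] lact_flip[OF sB(2)]
        by (cases "\<omega> \<in> T") (auto simp: actX_def FunT_carrier PiE_def extensional_def)
    qed
    fix \<eta> assume \<eta>: "\<eta> \<in> carrier FunT"
    show "actX s (\<xi> \<oplus>\<^bsub>FunT\<^esub> \<eta>) = actX s \<xi> \<oplus>\<^bsub>FunT\<^esub> actX s \<eta>"
      using lact_closed[OF sB(2)] by (auto simp: actX_def modfun_def fun_eq_iff)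
  qed
qed

lemma \<rho>_base: assumes "g \<in> T" shows "\<rho> g \<one> = g"
  using T(2) assms
proof (induct rule: suffix_closed_induct)
  case one
  then show ?case by (rule \<rho>_one)
next
  case (step s h)
  have hF: "h \<in> F" "h \<in> carrier G" using step TF Tc by auto
  have sc: "fst s \<in> carrier G" using step(1) BF F_carrier by blast
  have "\<rho> (letter s \<otimes> h) \<one> = lact s h" using \<rho>_letter[OF hF(1) step(1) one_T] step by simp
  also have "lact s h = letter s \<otimes> h"
  proof (cases "snd s")
    case True
    then show ?thesis using translate[OF step(1,3)] step(4) by (simp add: lact_def letter_def)
  next
    case False
    have "fst s \<otimes> (inv (fst s) \<otimes> h) = h" using sc hF by (simp flip: m_assoc)
    then have "\<pi> (fst s) (inv (fst s) \<otimes> h) = h"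
      using translate[OF step(1), of "inv (fst s) \<otimes> h"] step(3,4) False by (simp add: letter_def)
    then show ?thesis
      using bij_betw_inv_into_left[OF \<pi>[OF step(1)], of "inv (fst s) \<otimes> h"] step(4) False
      by (simp add: lact_def letter_def)
  qed
  finally show ?case .
qed

lemma \<rho>_inv_eq_one: "g \<in> T \<Longrightarrow> h \<in> T \<Longrightarrow> \<rho> (inv g) h = \<one> \<longleftrightarrow> g = h"
proof -
  assume g: "g \<in> T" and h: "h \<in> T"
  have gF: "g \<in> F" "inv g \<in> F" "g \<in> carrier G" using g TF subgroup.m_inv_closed[OF F] F_carrier by auto
  have "\<rho> g (\<rho> (inv g) h) = h" using \<rho>_mult[OF gF(1,2) h] gF by (simp add: \<rho>_one)
  moreover have "\<rho> (inv g) (\<rho> g \<one>) = \<one>" using \<rho>_mult[OF gF(2,1) one_T] gF by (simp add: \<rho>_one)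
  ultimately show ?thesis using \<rho>_base[OF g] by metis
qed

text \<open>Induction along the letters of \<open>g\<close>: since \<open>T\<close> is closed under suffixes, all intermediate translates of
  \<open>u\<close> lie in \<open>W\<close>, where equivariance is available.\<close>

lemma partially_equivariant_translate:
  assumes \<phi>: "partially_equivariant Mo lact_Mo FunT actX (P \<times> UNIV) W \<phi>"
    and P: "\<And>g. g \<in> T \<Longrightarrow> fst ` set (word g) \<subseteq> P"
    and u: "u \<in> carrier Mo" "\<And>g. g \<in> T \<Longrightarrow> gact g u \<in> W" and g: "g \<in> T"
  shows "\<forall>\<omega>\<in>T. \<phi> (gact g u) \<omega> = \<phi> u (\<rho> (inv g) \<omega>)"
  using T(2) g
proof (induct rule: suffix_closed_induct)
  case one
  then show ?case using u by (simp add: gact_one \<rho>_one)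
next
  case (step s h)
  have hF: "h \<in> F" "h \<in> carrier G" "inv h \<in> F" using step TF Tc subgroup.m_inv_closed[OF F] by auto
  have sc: "letter s \<in> carrier G" using step(1) by simp
  have sf: "fst (flip s) \<in> B" using step(1) by (simp add: flip_def)
  have sP: "s \<in> P \<times> UNIV" using P[OF step(4)] step(2) by (cases s) force
  have eq: "gact (letter s \<otimes> h) u = lact_Mo s (gact h u)" using gact_mult[OF sc hF(2) u(1)] .
  have "\<phi> (gact (letter s \<otimes> h) u) = actX s (\<phi> (gact h u))"
    using \<phi> sP u(2)[OF step(3)] u(2)[OF step(4)] unfolding partially_equivariant_def eq by blast
  moreover have "actX s (\<phi> (gact h u)) \<omega> = \<phi> u (\<rho> (inv (letter s \<otimes> h)) \<omega>)" if \<omega>: "\<omega> \<in> T" for \<omega>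
  proof -
    have "actX s (\<phi> (gact h u)) \<omega> = \<phi> u (\<rho> (inv h) (lact (flip s) \<omega>))"
      using step(5) lact_closed[OF sf \<omega>] \<omega> by (simp add: actX_def)
    also have "lact (flip s) \<omega> = \<rho> (letter (flip s)) \<omega>"
      using \<rho>_letter[OF subgroup.one_closed[OF F] sf \<omega>] sf by (simp add: \<rho>_one)
    also have "\<rho> (inv h) (\<rho> (letter (flip s)) \<omega>) = \<rho> (inv h \<otimes> letter (flip s)) \<omega>"
      using \<rho>_mult[OF hF(3) letter_F[OF sf] \<omega>] by simp
    also have "inv h \<otimes> letter (flip s) = inv (letter s \<otimes> h)"
      using step(1) hF sc by (simp add: letter_flip inv_mult_group)
    finally show ?thesis .
  qed
  ultimately show ?case by simp
qed

lemma gact_in_span: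
  assumes X: "finite X" "X \<subseteq> carrier Mo" and b: "b \<in> X" and g: "g \<in> T"
  shows "gact g b \<in> span (ring_on T) X"
proof -
  have gc: "g \<in> carrier G" using g Tc by blast
  let ?c = "\<lambda>a. if a = b then delta g else \<zero>\<^bsub>R\<^esub>"
  have c: "?c \<in> X \<rightarrow> ring_on T" using g gc by (auto simp: ring_on_def delta_R supp_delta zero_R supp_zero)
  have "comb ?c X = (\<Oplus>\<^bsub>Mo\<^esub>a\<in>X. if b = a then gact g a else \<zero>\<^bsub>Mo\<^esub>)"
    using X gc smult_l_zero gact_closed by (intro Mo.finsum_cong') (auto simp: gact_def)
  also have "\<dots> = gact g b" using X b gc gact_closed by (intro Mo.add.finprod_singleton) auto
  finally have eq: "comb ?c X = gact g b" .
  show ?thesis using spanI[OF c] unfolding eq .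
qed

lemma partially_equivariant_comb:
  assumes X: "finite X" "X \<subseteq> carrier Mo"
    and P: "\<And>g. g \<in> T \<Longrightarrow> fst ` set (word g) \<subseteq> P"
    and \<phi>: "partially_equivariant Mo lact_Mo FunT actX (P \<times> UNIV) (span (ring_on T) X) \<phi>"
    and d: "d \<in> X \<rightarrow> ring_on T" and \<omega>: "\<omega> \<in> T"
  shows "\<phi> (comb d X) \<omega> = (\<Sum>b\<in>X. \<Sum>g\<in>T. d b g * \<phi> b (\<rho> (inv g) \<omega>)) mod q"
proof -
  let ?W = "span (ring_on T) X"
  interpret FunT: torsion_group FunT p by (rule torsion_group_modfun[OF p])
  have W: "additive_subgroup ?W Mo" using span_subgroup[OF additive_coeffs_ring_on X(2)] .
  have add: "additive_on Mo FunT ?W \<phi>" using \<phi> by (simp add: partially_equivariant_def)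
  have \<phi>c: "\<phi> w \<in> carrier FunT" if "w \<in> ?W" for w using add that by (auto simp: additive_on_def)
  have gW: "gact g b \<in> ?W" if "b \<in> X" "g \<in> T" for b g using gact_in_span[OF X that] .
  have mW: "[(k::nat)] \<cdot>\<^bsub>Mo\<^esub> gact g b \<in> ?W \<and> \<phi> ([k] \<cdot>\<^bsub>Mo\<^esub> gact g b) = [k] \<cdot>\<^bsub>FunT\<^esub> \<phi> (gact g b)"
    if "b \<in> X" "g \<in> T" for b g k
    using additive_on_multiple[OF Mo.abelian_group_axioms FunT.abelian_group_axioms add W gW[OF that]] .
  have multX: "([(k::nat)] \<cdot>\<^bsub>FunT\<^esub> \<xi>) \<omega> = (int k * \<xi> \<omega>) mod q" if \<xi>: "\<xi> \<in> carrier FunT" for \<xi> k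
  proof (induct k)
    case 0
    have "[(0::nat)] \<cdot>\<^bsub>FunT\<^esub> \<xi> = \<zero>\<^bsub>FunT\<^esub>" by simp
    then show ?case using \<omega> by (simp only:) (simp add: modfun_def)
  next
    case (Suc k)
    have "([Suc k] \<cdot>\<^bsub>FunT\<^esub> \<xi>) \<omega> = (([k] \<cdot>\<^bsub>FunT\<^esub> \<xi>) \<omega> + \<xi> \<omega>) mod q"
      using \<omega> by (simp only: FunT.add.nat_pow_Suc) (simp add: modfun_def)
    then show ?case using Suc by (simp add: mod_add_left_eq mod_add_right_eq algebra_simps)
  qed
  have summand: "d b \<bullet> b \<in> ?W \<and> [\<phi> (d b \<bullet> b) \<omega> = (\<Sum>g\<in>T. d b g * \<phi> b (\<rho> (inv g) \<omega>))] (mod q)"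
    if b: "b \<in> X" for b
  proof -
    have db: "d b \<in> carrier R" "supp (d b) \<subseteq> T" using d b by (auto simp: ring_on_def)
    have bc: "b \<in> carrier Mo" using b X by blast
    have eq: "d b \<bullet> b = (\<Oplus>\<^bsub>Mo\<^esub>g\<in>T. [(nat (d b g))] \<cdot>\<^bsub>Mo\<^esub> gact g b)"
      by (rule smult_as_multiples[OF db T(1) Tc bc])
    have mW1: "[(nat (d b g))] \<cdot>\<^bsub>Mo\<^esub> gact g b \<in> ?W" if "g \<in> T" for g using mW[OF b that] by blast
    have ae: "d b \<bullet> b \<in> ?W \<and>
        \<phi> (d b \<bullet> b) = (\<Oplus>\<^bsub>FunT\<^esub>g\<in>T. \<phi> ([(nat (d b g))] \<cdot>\<^bsub>Mo\<^esub> gact g b))"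
      unfolding eq
      by (rule additive_on_finsum[OF Mo.abelian_group_axioms FunT.abelian_group_axioms W add]) (rule mW1)
    note in1 = conjunct1[OF ae] and e1 = conjunct2[OF ae]
    have "\<phi> (d b \<bullet> b) \<omega> = (\<Sum>g\<in>T. \<phi> ([(nat (d b g))] \<cdot>\<^bsub>Mo\<^esub> gact g b) \<omega>) mod q"
      unfolding e1 by (rule finsum_modfun[OF p _ \<omega>]) (rule \<phi>c[OF mW1])
    also have "(\<Sum>g\<in>T. \<phi> ([(nat (d b g))] \<cdot>\<^bsub>Mo\<^esub> gact g b) \<omega>) = (\<Sum>g\<in>T. (d b g * \<phi> b (\<rho> (inv g) \<omega>)) mod q)"
    proof (rule sum.cong)
      fix g assume g: "g \<in> T"
      have nn: "int (nat (d b g)) = d b g"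
        using R_val[OF db(1), of g] g Tc by (auto simp: K_simps)
      have "\<phi> ([(nat (d b g))] \<cdot>\<^bsub>Mo\<^esub> gact g b) \<omega> = ([(nat (d b g))] \<cdot>\<^bsub>FunT\<^esub> \<phi> (gact g b)) \<omega>"
        using mW[OF b g] by simp
      also have "\<dots> = (d b g * \<phi> (gact g b) \<omega>) mod q" using multX[OF \<phi>c[OF gW[OF b g]]] nn by simp
      also have "\<phi> (gact g b) \<omega> = \<phi> b (\<rho> (inv g) \<omega>)"
        using partially_equivariant_translate[OF \<phi> P bc gW[OF b] g] \<omega> by blast
      finally show "\<phi> ([(nat (d b g))] \<cdot>\<^bsub>Mo\<^esub> gact g b) \<omega> = (d b g * \<phi> b (\<rho> (inv g) \<omega>)) mod q" .
    qed simp
    finally show ?thesis using in1 by (simp add: cong_def mod_sum_eq)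
  qed
  have e2: "\<phi> (comb d X) = (\<Oplus>\<^bsub>FunT\<^esub>b\<in>X. \<phi> (d b \<bullet> b))"
    by (rule conjunct2[OF additive_on_finsum[OF Mo.abelian_group_axioms FunT.abelian_group_axioms W add]])
      (rule conjunct1[OF summand])
  have "\<phi> (comb d X) \<omega> = (\<Sum>b\<in>X. \<phi> (d b \<bullet> b) \<omega>) mod q"
    unfolding e2 by (rule finsum_modfun[OF p _ \<omega>]) (rule \<phi>c[OF conjunct1[OF summand]])
  moreover have "[(\<Sum>b\<in>X. \<phi> (d b \<bullet> b) \<omega>) = (\<Sum>b\<in>X. \<Sum>g\<in>T. d b g * \<phi> b (\<rho> (inv g) \<omega>))] (mod q)"
    by (rule cong_sum) (rule conjunct2[OF summand])
  ultimately show ?thesis by (simp add: cong_def)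
qed


text \<open>The set \<open>X'\<close> is the partial basis of \<open>W = span (ring_on T) X\<close>. A partially equivariant map on \<open>W\<close> is
  determined by its values on \<open>X\<close> (\<open>partially_equivariant_comb\<close>), and the values on \<open>X'\<close> are free.
  So restriction to \<open>X\<close> injects the functions on \<open>X'\<close> into those on \<open>X\<close>; if the cardinalities
  agree, this injection of finite sets is onto.\<close>

lemma exchange:
  assumes X: "finite X" "X \<subseteq> on_F"
    and P: "finite P" "P \<subseteq> B" "\<And>g. g \<in> T \<Longrightarrow> fst ` set (word g) \<subseteq> P"
  obtains X' where "finite X'" "X' \<subseteq> on_F" "X \<subseteq> span (ring_on F) X'" "card X' \<le> card X"
    "card X' = card X \<Longrightarrow> \<forall>\<xi>\<in>X \<rightarrow>\<^sub>E carrier FunT. \<exists>\<phi>.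
       partially_equivariant Mo lact_Mo FunT actX (P \<times> UNIV) (span (ring_on T) X) \<phi> \<and> (\<forall>b\<in>X. \<phi> b = \<xi> b)"
proof -
  let ?W = "span (ring_on T) X"
  let ?pe = "partially_equivariant Mo lact_Mo FunT actX (P \<times> UNIV) ?W"
  have Xc: "X \<subseteq> carrier Mo" using X by (auto simp: on_F_def)
  have TringF: "ring_on T \<subseteq> ring_on F" using TF by (auto simp: ring_on_def ring_on_def)
  have TringR: "ring_on T \<subseteq> carrier R" by (auto simp: ring_on_def)
  have W: "additive_subgroup ?W Mo" using span_subgroup[OF additive_coeffs_ring_on Xc] .
  have finW: "finite ?W" using finite_span[OF finite_ring_on[OF T(1)] X(1) TringR Xc] .
  have WMF: "?W \<subseteq> on_F" using span_on_F[OF X(2) TringF] .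
  have one: "\<one>\<^bsub>R\<^esub> \<in> ring_on T" using one_R supp_one one_T by (auto simp: ring_on_def)
  have XW: "X \<subseteq> ?W" using span_base[OF additive_coeffs_ring_on one Xc X(1)] by blast
  have leafW: "letter_module.has_leaf Mo (P \<times> UNIV) lact_Mo V"
    if "additive_subgroup V Mo" "V \<subseteq> ?W" "V \<noteq> {\<zero>\<^bsub>Mo\<^esub>}" for V
    using leaf[OF P(1,2) that(1) finite_subset[OF that(2) finW] order_trans[OF that(2) WMF] that(3)] .
  obtain X' where X': "X' \<subseteq> ?W"
    and gen: "\<forall>U. additive_subgroup U Mo \<and> (\<forall>s\<in>P \<times> UNIV. \<forall>u\<in>U. lact_Mo s u \<in> U) \<and> X' \<subseteq> U \<longrightarrow> ?W \<subseteq> U"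
    and ext: "\<forall>\<beta>\<in>X' \<rightarrow> carrier FunT. \<exists>\<phi>. ?pe \<phi> \<and> (\<forall>b\<in>X'. \<phi> b = \<beta> b)"
    using partial_basis[OF letter_module_Mo[OF P(2)] letter_module_FunT[OF P(2)] W finW] leafW
    by (elim meta_impE exE conjE) (assumption | rule that)+
  have finX': "finite X'" using X' finW finite_subset by blast
  have X'MF: "X' \<subseteq> on_F" using X' WMF by blast
  have X'c: "X' \<subseteq> carrier Mo" using X'MF by (auto simp: on_F_def)
  have RFadd: "additive_coeffs (ring_on F)" and RF1: "\<one>\<^bsub>R\<^esub> \<in> ring_on F" using subring_coeffs_ring_on_F by (auto simp: subring_coeffs_def)
  have "?W \<subseteq> span (ring_on F) X'"
  proof (rule gen[rule_format], intro conjI ballI)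
    show "additive_subgroup (span (ring_on F) X') Mo" using span_subgroup[OF RFadd X'c] .
    show "X' \<subseteq> span (ring_on F) X'" using span_base[OF RFadd RF1 X'c finX'] by blast
    fix s :: "'a \<times> bool" and u assume s: "s \<in> P \<times> UNIV" and u: "u \<in> span (ring_on F) X'"
    have sB: "fst s \<in> B" using s P by auto
    have "delta (letter s) \<in> ring_on F" using delta_R supp_delta letter_F[OF sB] F_carrier by (simp add: ring_on_def)
    then show "lact_Mo s u \<in> span (ring_on F) X'" unfolding gact_def by (rule span_smult[OF subring_coeffs_ring_on_F X'c _ u])
  qed
  then have Xspan: "X \<subseteq> span (ring_on F) X'" using XW by blast
  have "\<exists>\<Phi>. \<forall>\<beta>\<in>X' \<rightarrow>\<^sub>E carrier FunT. ?pe (\<Phi> \<beta>) \<and> (\<forall>b\<in>X'. \<Phi> \<beta> b = \<beta> b)"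
  proof (rule bchoice, rule ballI)
    fix \<beta> assume "\<beta> \<in> X' \<rightarrow>\<^sub>E carrier FunT"
    then have "\<beta> \<in> X' \<rightarrow> carrier FunT" by auto
    then show "\<exists>\<phi>. ?pe \<phi> \<and> (\<forall>b\<in>X'. \<phi> b = \<beta> b)" by (rule ext[rule_format])
  qed
  then obtain \<Phi> where \<Phi>: "\<forall>\<beta>\<in>X' \<rightarrow>\<^sub>E carrier FunT. ?pe (\<Phi> \<beta>) \<and> (\<forall>b\<in>X'. \<Phi> \<beta> b = \<beta> b)" ..
  \<comment> \<open>The values on \<open>X\<close> of the chosen extension of \<open>\<beta>\<close> from \<open>X'\<close> to \<open>W\<close>.\<close>
  define E where "E \<beta> = restrict (\<Phi> \<beta>) X" for \<beta>
  have val: "\<Phi> \<beta> w \<in> carrier FunT" if "\<beta> \<in> X' \<rightarrow>\<^sub>E carrier FunT" "w \<in> ?W" for \<beta> w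
    using \<Phi> that unfolding partially_equivariant_def additive_on_def by blast
  have Eto: "E ` (X' \<rightarrow>\<^sub>E carrier FunT) \<subseteq> X \<rightarrow>\<^sub>E carrier FunT"
    using val XW by (auto simp: E_def)
  have inj: "inj_on E (X' \<rightarrow>\<^sub>E carrier FunT)"
  proof (rule inj_onI)
    fix \<beta> \<gamma> assume \<beta>: "\<beta> \<in> X' \<rightarrow>\<^sub>E carrier FunT" and \<gamma>: "\<gamma> \<in> X' \<rightarrow>\<^sub>E carrier FunT" and eq: "E \<beta> = E \<gamma>"
    have eqX: "\<Phi> \<beta> b = \<Phi> \<gamma> b" if "b \<in> X" for b using fun_cong[OF eq, of b] that by (simp add: E_def)
    have "\<Phi> \<beta> w = \<Phi> \<gamma> w" if w: "w \<in> ?W" for w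
    proof
      fix \<omega>
      obtain d where d: "d \<in> X \<rightarrow> ring_on T" "w = comb d X" using w by (auto simp: span_def)
      show "\<Phi> \<beta> w \<omega> = \<Phi> \<gamma> w \<omega>"
      proof (cases "\<omega> \<in> T")
        case True
        have "\<Phi> \<beta> w \<omega> = (\<Sum>b\<in>X. \<Sum>g\<in>T. d b g * \<Phi> \<beta> b (\<rho> (inv g) \<omega>)) mod q"
          unfolding d(2) using \<Phi> \<beta> by (intro partially_equivariant_comb[OF X(1) Xc P(3) _ d(1) True]) auto
        moreover have "\<Phi> \<gamma> w \<omega> = (\<Sum>b\<in>X. \<Sum>g\<in>T. d b g * \<Phi> \<gamma> b (\<rho> (inv g) \<omega>)) mod q"
          unfolding d(2) using \<Phi> \<gamma> by (intro partially_equivariant_comb[OF X(1) Xc P(3) _ d(1) True]) auto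
        ultimately show ?thesis using eqX by simp
      next
        case False
        then show ?thesis using val[OF \<beta> w] val[OF \<gamma> w] by (simp add: FunT_carrier PiE_def extensional_def)
      qed
    qed
    then have ext': "\<beta> b = \<gamma> b" if "b \<in> X'" for b using \<Phi> \<beta> \<gamma> that X' by (metis subsetD)
    show "\<beta> = \<gamma>" by (rule PiE_ext[OF \<beta> \<gamma> ext'])
  qed
  have finXm: "finite (carrier FunT)" using T(1) by (simp add: FunT_carrier finite_PiE)
  have cXm: "card (carrier FunT) > 1"
  proof -
    have "card (carrier FunT) = nat q ^ card T" using T(1) by (simp add: FunT_carrier card_PiE)
    moreover have "card T > 0" using T(1) one_T card_gt_0_iff by blast
    moreover have "p > 1" using prime_gt_1_nat[OF p] .
    ultimately show ?thesis using one_less_power[of p "card T"] by simp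
  qed
  have fin2: "finite (X \<rightarrow>\<^sub>E carrier FunT)" using X(1) finXm by (intro finite_PiE)
  have cards: "card (X' \<rightarrow>\<^sub>E carrier FunT) = card (carrier FunT) ^ card X'"
    "card (X \<rightarrow>\<^sub>E carrier FunT) = card (carrier FunT) ^ card X"
    using finX' X(1) by (simp_all add: card_PiE)
  have "card (X' \<rightarrow>\<^sub>E carrier FunT) \<le> card (X \<rightarrow>\<^sub>E carrier FunT)"
    by (rule card_inj_on_le[OF inj Eto fin2])
  then have le: "card X' \<le> card X" unfolding cards using cXm by (rule power_le_imp_le_exp[rotated])
  have surj: "\<forall>\<xi>\<in>X \<rightarrow>\<^sub>E carrier FunT. \<exists>\<phi>. ?pe \<phi> \<and> (\<forall>b\<in>X. \<phi> b = \<xi> b)" if "card X' = card X"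
  proof
    fix \<xi> assume \<xi>: "\<xi> \<in> X \<rightarrow>\<^sub>E carrier FunT"
    have "card (E ` (X' \<rightarrow>\<^sub>E carrier FunT)) = card (X \<rightarrow>\<^sub>E carrier FunT)"
      using card_image[OF inj] cards that by simp
    then have "E ` (X' \<rightarrow>\<^sub>E carrier FunT) = X \<rightarrow>\<^sub>E carrier FunT" by (rule card_subset_eq[OF fin2 Eto])
    then obtain \<beta> where \<beta>: "\<beta> \<in> X' \<rightarrow>\<^sub>E carrier FunT" "\<xi> = E \<beta>" using \<xi> by blast
    have "?pe (\<Phi> \<beta>)" using \<Phi> \<beta>(1) by blast
    moreover have "\<forall>b\<in>X. \<Phi> \<beta> b = \<xi> b" using \<beta>(2) by (simp add: E_def)
    ultimately show "\<exists>\<phi>. ?pe \<phi> \<and> (\<forall>b\<in>X. \<phi> b = \<xi> b)" by blast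
  qed
  show ?thesis using that[OF finX' X'MF Xspan le surj] .
qed

text \<open>If no smaller spanning set existed, \<open>exchange\<close> would provide a partially equivariant map \<open>\<phi>\<close> that sends
  \<open>b0\<close> to the indicator function of the unit and the rest of \<open>X\<close> to 0. It sends the relation to
  the function \<open>c b0\<close> on \<open>T\<close>, which would have to vanish.\<close>

lemma dependence_not_minimal:
  assumes X: "finite X" "X \<subseteq> on_F"
    and c: "c \<in> X \<rightarrow> ring_on T" "comb c X = \<zero>\<^bsub>Mo\<^esub>"
    and b0: "b0 \<in> X" "c b0 \<noteq> \<zero>\<^bsub>R\<^esub>"
  obtains X' where "finite X'" "X' \<subseteq> on_F" "X \<subseteq> span (ring_on F) X'" "card X' < card X"
proof -
  define P where "P = (\<Union>g\<in>T. fst ` set (word g))"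
  have P: "finite P" "P \<subseteq> B" "\<And>g. g \<in> T \<Longrightarrow> fst ` set (word g) \<subseteq> P"
  proof -
    show "finite P" using T(1) by (simp add: P_def)
    show "P \<subseteq> B" using TF word_reduced unfolding P_def reduced_words_def by blast
  qed (auto simp: P_def)
  obtain X' where X': "finite X'" "X' \<subseteq> on_F" "X \<subseteq> span (ring_on F) X'" "card X' \<le> card X"
    and surj: "card X' = card X \<Longrightarrow> \<forall>\<xi>\<in>X \<rightarrow>\<^sub>E carrier FunT. \<exists>\<phi>.
       partially_equivariant Mo lact_Mo FunT actX (P \<times> UNIV) (span (ring_on T) X) \<phi> \<and> (\<forall>b\<in>X. \<phi> b = \<xi> b)"
    using exchange[OF X P] by blast
  have "card X' \<noteq> card X"
  proof
    assume eq: "card X' = card X"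
    have Xc: "X \<subseteq> carrier Mo" using X by (auto simp: on_F_def)
    have cR: "c b0 \<in> carrier R" "supp (c b0) \<subseteq> T" using c(1) b0(1) by (auto simp: ring_on_def)
    obtain g0 where g0: "g0 \<in> carrier G" "c b0 g0 \<noteq> 0"
    proof -
      have "\<exists>x\<in>carrier G. c b0 x \<noteq> 0"
      proof (rule ccontr)
        assume "\<not> (\<exists>x\<in>carrier G. c b0 x \<noteq> 0)"
        then have "c b0 = \<zero>\<^bsub>R\<^esub>" by (intro R_eqI cR(1) zero_R) (simp add: R_zero)
        then show False using b0(2) by simp
      qed
      then show ?thesis using that by blast
    qed
    have g0T: "g0 \<in> T" using g0 cR(2) by (auto simp: supp_def)
    \<comment> \<open>The indicator function of the unit for \<open>b0\<close>, and 0 for the rest of \<open>X\<close>.\<close>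
    define \<xi> where "\<xi> = (\<lambda>b\<in>X. \<lambda>\<omega>\<in>T. if b = b0 \<and> \<omega> = \<one> then 1 else (0::int))"
    have \<xi>: "\<xi> \<in> X \<rightarrow>\<^sub>E carrier FunT" using q1 by (auto simp: \<xi>_def FunT_carrier)
    obtain \<phi> where \<phi>: "partially_equivariant Mo lact_Mo FunT actX (P \<times> UNIV) (span (ring_on T) X) \<phi>" "\<And>b. b \<in> X \<Longrightarrow> \<phi> b = \<xi> b"
      using surj[OF eq] \<xi> by blast
    interpret FunT: torsion_group FunT p by (rule torsion_group_modfun[OF p])
    have add: "additive_on Mo FunT (span (ring_on T) X) \<phi>" using \<phi>(1) by (simp add: partially_equivariant_def)
    have z: "\<phi> \<zero>\<^bsub>Mo\<^esub> = \<zero>\<^bsub>FunT\<^esub>"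
      using additive_on_zero[OF Mo.abelian_group_axioms FunT.abelian_group_axioms add]
        additive_subgroup.zero_closed[OF span_subgroup[OF additive_coeffs_ring_on Xc]] by blast
    have \<rho>T: "\<rho> (inv g) g0 \<in> T" if "g \<in> T" for g
      using \<rho>_closed[OF subgroup.m_inv_closed[OF F] g0T] that TF by blast
    have "0 = \<phi> (comb c X) g0" using z g0T unfolding c(2) by (simp add: modfun_def)
    also have "\<dots> = (\<Sum>b\<in>X. \<Sum>g\<in>T. c b g * \<phi> b (\<rho> (inv g) g0)) mod q"
      by (rule partially_equivariant_comb[OF X(1) Xc P(3) \<phi>(1) c(1) g0T])
    also have "(\<Sum>b\<in>X. \<Sum>g\<in>T. c b g * \<phi> b (\<rho> (inv g) g0)) = (\<Sum>b\<in>X. if b = b0 then c b0 g0 else 0)"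
    proof (rule sum.cong)
      fix b assume b: "b \<in> X"
      have "(\<Sum>g\<in>T. c b g * \<phi> b (\<rho> (inv g) g0)) = (\<Sum>g\<in>T. if g = g0 then (if b = b0 then c b g0 else 0) else 0)"
        using \<rho>T \<phi>(2)[OF b] b \<rho>_inv_eq_one[OF _ g0T] by (intro sum.cong refl) (auto simp: \<xi>_def)
      also have "\<dots> = (if b = b0 then c b g0 else 0)" using T(1) g0T by simp
      finally show "(\<Sum>g\<in>T. c b g * \<phi> b (\<rho> (inv g) g0)) = (if b = b0 then c b0 g0 else 0)" by simp
    qed simp
    also have "\<dots> = c b0 g0" using X(1) b0(1) by simp
    also have "c b0 g0 mod q = c b0 g0" using R_mod[OF cR(1) g0(1)] .
    finally show False using g0(2) by simp
  qed
  then show ?thesis using that[OF X'(1-3)] X'(4) by simp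
qed

end

context virtually_free
begin

lemma ex_independent_over_F:
  assumes Y: "finite Y" "Y \<subseteq> on_F"
  obtains X where "finite X" "X \<subseteq> on_F" "Y \<subseteq> span (ring_on F) X" "independent (ring_on F) X"
proof -
  let ?good = "\<lambda>X. finite X \<and> X \<subseteq> on_F \<and> Y \<subseteq> span (ring_on F) X"
  have MFc: "on_F \<subseteq> carrier Mo" by (auto simp: on_F_def)
  have RFadd: "additive_coeffs (ring_on F)" and RF1: "\<one>\<^bsub>R\<^esub> \<in> ring_on F" using subring_coeffs_ring_on_F by (auto simp: subring_coeffs_def)
  have "?good Y" using Y span_base[OF RFadd RF1 order_trans[OF Y(2) MFc] Y(1)] by blast
  then obtain X where X: "?good X" and least: "\<And>X'. ?good X' \<Longrightarrow> card X \<le> card X'"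
    using ex_has_least_nat[of ?good Y card] by blast
  have "independent (ring_on F) X" unfolding independent_def
  proof (intro ballI impI, rule ccontr)
    fix c b0 assume c: "c \<in> X \<rightarrow> ring_on F" "comb c X = \<zero>\<^bsub>Mo\<^esub>" and b0: "b0 \<in> X" "c b0 \<noteq> \<zero>\<^bsub>R\<^esub>"
    have cb: "c b \<in> carrier R" "supp (c b) \<subseteq> F" if "b \<in> X" for b using c(1) that by (auto simp: ring_on_def)
    obtain T where T: "finite T" "(\<Union>b\<in>X. supp (c b)) \<subseteq> T" "suffix_closed T"
    proof (rule ex_suffix_closed)
      show "finite (\<Union>b\<in>X. supp (c b))" using X cb(1) R_supp by blast
      show "(\<Union>b\<in>X. supp (c b)) \<subseteq> F" using cb(2) by blast
    qed
    obtain \<pi> where \<pi>: "\<And>x. x \<in> B \<Longrightarrow> bij_betw (\<pi> x) T T"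
      "\<And>x g. x \<in> B \<Longrightarrow> g \<in> T \<Longrightarrow> x \<otimes> g \<in> T \<Longrightarrow> \<pi> x g = x \<otimes> g"
      using ex_translation_permutations[OF T(1,3)] by blast
    interpret fm: finite_model G p F B \<pi> T by unfold_locales (use \<pi> T in auto)
    have cT: "c \<in> X \<rightarrow> ring_on T" using cb(1) T(2) by (auto simp: ring_on_def)
    obtain X' where X': "finite X'" "X' \<subseteq> on_F" "X \<subseteq> span (ring_on F) X'" "card X' < card X"
      using fm.dependence_not_minimal[OF _ _ cT c(2) b0] X by blast
    have "Y \<subseteq> span (ring_on F) X'"
      using span_trans[OF subring_coeffs_ring_on_F order_trans[OF X'(2) MFc] X'(3)] X by blast
    then show False using least[of X'] X' by simp
  qed
  then show ?thesis using that X by blast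
qed

section \<open>From the free subgroup to the whole group\<close>

lemma comb_mass:
  assumes X: "X \<subseteq> carrier Mo" and c: "c \<in> X \<rightarrow> carrier R" and A: "clopen A"
  shows "[mass (comb c X) A = (\<Sum>b\<in>X. \<Sum>x\<in>supp (c b). c b x * mass b (inv x <# A))] (mod q)"
proof -
  have "[mass (comb c X) A = (\<Sum>b\<in>X. mass (c b \<bullet> b) A)] (mod q)"
    by (rule mass_finsum[OF comb_term_closed[OF order_refl X c] A])
  also have "[(\<Sum>b\<in>X. mass (c b \<bullet> b) A) = (\<Sum>b\<in>X. \<Sum>x\<in>supp (c b). c b x * mass b (inv x <# A))] (mod q)"
    using X c by (intro cong_sum mass_smult A) auto
  finally show ?thesis .
qed

text \<open>If \<open>c b0\<close> does not vanish at \<open>t\<close>, restrict the relation to the left coset \<open>t F\<close> and translate it back to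
  \<open>F\<close>. As the elements of \<open>X\<close> are concentrated on \<open>F\<close>, only the values of the coefficients on \<open>t F\<close>
  contribute there, and one obtains a relation over the group ring of \<open>F\<close> with coefficients \<open>d\<close>.\<close>

lemma independent_F_imp_independent:
  assumes X: "finite X" "X \<subseteq> on_F" and ind: "independent (ring_on F) X"
  shows "independent (carrier R) X"
  unfolding independent_def
proof (intro ballI impI, rule ccontr)
  fix c b0 assume c: "c \<in> X \<rightarrow> carrier R" and c0: "comb c X = \<zero>\<^bsub>Mo\<^esub>"
    and b0: "b0 \<in> X" "c b0 \<noteq> \<zero>\<^bsub>R\<^esub>"
  have Xc: "X \<subseteq> carrier Mo" using X by (auto simp: on_F_def)
  have cR: "c b \<in> carrier R" if "b \<in> X" for b using c that by auto
  have "\<exists>x\<in>carrier G. c b0 x \<noteq> 0"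
  proof (rule ccontr)
    assume "\<not> (\<exists>x\<in>carrier G. c b0 x \<noteq> 0)"
    then have "c b0 = \<zero>\<^bsub>R\<^esub>" by (intro R_eqI cR b0(1) zero_R) (simp add: R_zero)
    then show False using b0(2) by simp
  qed
  then obtain t where t: "t \<in> carrier G" "c b0 t \<noteq> 0" by blast
  define d where "d b = (\<lambda>y\<in>carrier G. if y \<in> F then c b (t \<otimes> y) else 0)" for b
  have shift: "bij_betw ((\<otimes>) t) (supp (d b)) {x \<in> supp (c b). inv t \<otimes> x \<in> F}" for b
  proof (rule bij_betw_byWitness[where f' = "(\<otimes>) (inv t)"])
    show "\<forall>y\<in>supp (d b). inv t \<otimes> (t \<otimes> y) = y" using t by (auto simp flip: m_assoc)
    show "\<forall>x\<in>{x \<in> supp (c b). inv t \<otimes> x \<in> F}. t \<otimes> (inv t \<otimes> x) = x" using t by (auto simp flip: m_assoc)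
    show "(\<otimes>) t ` supp (d b) \<subseteq> {x \<in> supp (c b). inv t \<otimes> x \<in> F}"
      using t by (auto simp: supp_def d_def split: if_splits simp flip: m_assoc)
    show "(\<otimes>) (inv t) ` {x \<in> supp (c b). inv t \<otimes> x \<in> F} \<subseteq> supp (d b)"
    proof
      fix y assume "y \<in> (\<otimes>) (inv t) ` {x \<in> supp (c b). inv t \<otimes> x \<in> F}"
      then obtain x where x: "x \<in> supp (c b)" "inv t \<otimes> x \<in> F" "y = inv t \<otimes> x" by blast
      have "t \<otimes> y = x" using x t by (auto simp flip: m_assoc)
      then show "y \<in> supp (d b)" using x t by (auto simp: supp_def d_def)
    qed
  qed
  have dRF: "d b \<in> ring_on F" if b: "b \<in> X" for b
  proof -
    have "finite {x \<in> supp (c b). inv t \<otimes> x \<in> F}" using R_supp[OF cR[OF b]] by simp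
    then have "finite (supp (d b))" using bij_betw_finite[OF shift] by blast
    moreover have "0 \<in> carrier K" using q1 by (simp add: K_simps)
    then have "d b \<in> carrier G \<rightarrow>\<^sub>E carrier K" using R_val[OF cR[OF b]] t by (auto simp: d_def)
    moreover have "supp (d b) \<subseteq> F" by (auto simp: supp_def d_def split: if_splits)
    ultimately show ?thesis by (simp add: ring_on_def R_carrier)
  qed
  then have d: "d \<in> X \<rightarrow> ring_on F" "d \<in> X \<rightarrow> carrier R" by (auto simp: ring_on_def)
  let ?u = "comb d X"
  have uMF: "?u \<in> on_F" using spanI[OF d(1)] span_on_F[OF X(2) order_refl] by blast
  then have uc: "?u \<in> carrier Mo" by (simp add: on_F_def)
  have small: "[mass ?u A = 0] (mod q)" if A: "clopen A" "A \<subseteq> F" for A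
  proof -
    have Ac: "A \<subseteq> carrier G" using clopen_carrier[OF A(1)] .
    have "[mass ?u A = (\<Sum>b\<in>X. \<Sum>y\<in>supp (d b). d b y * mass b (inv y <# A))] (mod q)"
      by (rule comb_mass[OF Xc d(2) A(1)])
    also have "(\<Sum>b\<in>X. \<Sum>y\<in>supp (d b). d b y * mass b (inv y <# A))
       = (\<Sum>b\<in>X. \<Sum>x\<in>supp (c b). c b x * mass b (inv x <# (t <# A)))"
    proof (rule sum.cong)
      fix b assume b: "b \<in> X"
      have "(\<Sum>y\<in>supp (d b). d b y * mass b (inv y <# A))
         = (\<Sum>y\<in>supp (d b). c b (t \<otimes> y) * mass b (inv (t \<otimes> y) <# (t <# A)))"
      proof (rule sum.cong)
        fix y assume y: "y \<in> supp (d b)"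
        then have yc: "y \<in> carrier G" and "d b y = c b (t \<otimes> y)"
          by (auto simp: supp_def d_def split: if_splits)
        moreover have "inv (t \<otimes> y) <# (t <# A) = inv y <# A"
          using t yc Ac by (simp add: translate_translate inv_mult_group m_assoc)
        ultimately show "d b y * mass b (inv y <# A) = c b (t \<otimes> y) * mass b (inv (t \<otimes> y) <# (t <# A))" by simp
      qed simp
      also have "\<dots> = (\<Sum>x\<in>{x \<in> supp (c b). inv t \<otimes> x \<in> F}. c b x * mass b (inv x <# (t <# A)))"
        by (rule sum.reindex_bij_betw[OF shift])
      also have "\<dots> = (\<Sum>x\<in>supp (c b). c b x * mass b (inv x <# (t <# A)))"
      proof (rule sum.mono_neutral_left)
        show "finite (supp (c b))" using R_supp[OF cR[OF b]] .
        show "\<forall>x\<in>supp (c b) - {x \<in> supp (c b). inv t \<otimes> x \<in> F}. c b x * mass b (inv x <# (t <# A)) = 0"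
        proof
          fix x assume "x \<in> supp (c b) - {x \<in> supp (c b). inv t \<otimes> x \<in> F}"
          then have x: "x \<in> carrier G" "inv t \<otimes> x \<notin> F" by auto
          have "(inv x <# (t <# A)) \<inter> F = {}"
          proof (rule equals0I)
            fix y assume "y \<in> (inv x <# (t <# A)) \<inter> F"
            then obtain a where a: "a \<in> A" "y = inv x \<otimes> (t \<otimes> a)" "y \<in> F" by (auto simp: l_coset_def)
            have ac: "a \<in> carrier G" "a \<in> F" "y \<in> carrier G" using a A(2) F_carrier by auto
            have "t \<otimes> a = x \<otimes> y" using a(2) x t ac by (simp flip: m_assoc)
            then have "inv t \<otimes> x = a \<otimes> inv y"
              using x t ac by (metis inv_closed inv_solve_left inv_solve_right m_assoc m_closed)
            then show False using x(2) a(3) ac(2) subgroup.m_closed[OF F] subgroup.m_inv_closed[OF F] by simp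
          qed
          moreover have "clopen (inv x <# (t <# A))" using A(1) t x by (simp add: clopen_translate)
          ultimately have "mass b (inv x <# (t <# A)) = 0" using b X(2) unfolding on_F_def by blast
          then show "c b x * mass b (inv x <# (t <# A)) = 0" by simp
        qed
      qed auto
      finally show "(\<Sum>y\<in>supp (d b). d b y * mass b (inv y <# A))
        = (\<Sum>x\<in>supp (c b). c b x * mass b (inv x <# (t <# A)))" .
    qed simp
    also have "[(\<Sum>b\<in>X. \<Sum>x\<in>supp (c b). c b x * mass b (inv x <# (t <# A))) = mass \<zero>\<^bsub>Mo\<^esub> (t <# A)] (mod q)"
      using comb_mass[OF Xc c clopen_translate[OF A(1) t(1)]] unfolding c0 by (rule cong_sym)
    finally show ?thesis using mass_zero[OF clopen_translate[OF A(1) t(1)]] by simp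
  qed
  have "?u = \<zero>\<^bsub>Mo\<^esub>"
  proof (rule Mo_eqI[OF uc Mo_zero_closed])
    fix A assume A: "clopen A"
    have I: "clopen (A \<inter> F)" and D: "clopen (A - F)"
      using clopen_Int[OF A clopen_F] clopen_Diff[OF A clopen_F] .
    have "[mass ?u ((A \<inter> F) \<union> (A - F)) = mass ?u (A \<inter> F) + mass ?u (A - F)] (mod q)"
      using mass_measure[OF uc] I D unfolding is_measure_def by blast
    moreover have "(A \<inter> F) \<union> (A - F) = A" by blast
    moreover have "mass ?u (A - F) = 0" using uMF D unfolding on_F_def by blast
    ultimately have "[mass ?u A = mass ?u (A \<inter> F)] (mod q)" by simp
    from cong_trans[OF this small[OF I]] show "[mass ?u A = mass \<zero>\<^bsub>Mo\<^esub> A] (mod q)"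
      unfolding mass_zero[OF A] by simp
  qed
  then have "d b0 = \<zero>\<^bsub>R\<^esub>" using ind d(1) b0(1) unfolding independent_def by blast
  then have "d b0 \<one> = 0" by (simp add: R_zero)
  then show False using t subgroup.one_closed[OF F] by (simp add: d_def)
qed

definition lcosets_F :: "'a set set" where
  "lcosets_F = (\<lambda>t. t <# F) ` carrier G"

definition lrep :: "'a set \<Rightarrow> 'a" where
  "lrep D = (SOME t. t \<in> carrier G \<and> D = t <# F)"

text \<open>The restriction of a measure to the left coset \<open>t F\<close>, translated back to \<open>F\<close>.\<close>

definition part_at :: "'a \<Rightarrow> ('a set \<Rightarrow> 'a set \<Rightarrow> int) \<Rightarrow> 'a set \<Rightarrow> 'a set \<Rightarrow> int" where
  "part_at t u = family (\<lambda>A. mass u (t <# (A \<inter> F)))"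

lemma Fc: "F \<subseteq> carrier G" using F_carrier by blast

lemma lrep: "D \<in> lcosets_F \<Longrightarrow> lrep D \<in> carrier G \<and> D = lrep D <# F"
  unfolding lrep_def lcosets_F_def by (rule someI_ex) auto

lemma finite_lcosets_F: "finite lcosets_F"
proof -
  obtain N where N: "N \<in> FIN" "N \<subseteq> F" using ex_finite_index_normal_subset[OF F finite_index] .
  have "lcosets_F \<subseteq> (\<lambda>C. C <#> F) ` (rcosets N)"
  proof
    fix D assume "D \<in> lcosets_F"
    then obtain t where t: "t \<in> carrier G" "D = t <# F" by (auto simp: lcosets_F_def)
    have "D = (N #> t) <#> F"
    proof
      show "D \<subseteq> (N #> t) <#> F"
        using t rcos_self[OF t(1) FIN_subgroup[OF N(1)]] by (auto simp: l_coset_def set_mult_def)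
      show "(N #> t) <#> F \<subseteq> D"
      proof
        fix x assume "x \<in> (N #> t) <#> F"
        then obtain y f where y: "y \<in> N #> t" "f \<in> F" "x = y \<otimes> f" by (auto simp: set_mult_def)
        have "y \<in> t <# N" using y(1) normal.coset_eq[OF FIN_normal[OF N(1)]] t(1) by blast
        then obtain n where n: "n \<in> N" "y = t \<otimes> n" by (auto simp: l_coset_def)
        have "x = t \<otimes> (n \<otimes> f)" using n y t N(2) F_carrier by (simp add: m_assoc subset_iff)
        moreover have "n \<otimes> f \<in> F" using n y N(2) subgroup.m_closed[OF F] by blast
        ultimately show "x \<in> D" using t by (auto simp: l_coset_def)
      qed
    qed
    then show "D \<in> (\<lambda>C. C <#> F) ` (rcosets N)"
      using subgroup_rcosetsI[OF FIN_subgroup[OF N(1)] t(1)] by blast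
  qed
  then show ?thesis using FIN_finite[OF N(1)] by (meson finite_imageI finite_subset)
qed

lemma lcosets_F_disjoint: "D \<in> lcosets_F \<Longrightarrow> E \<in> lcosets_F \<Longrightarrow> D \<noteq> E \<Longrightarrow> D \<inter> E = {}"
proof -
  assume D: "D \<in> lcosets_F" and E: "E \<in> lcosets_F" and ne: "D \<noteq> E"
  have same: "x <# F = D" if D: "D \<in> lcosets_F" and x: "x \<in> D" for x D
  proof -
    obtain t where t: "t \<in> carrier G" "D = t <# F" using D by (auto simp: lcosets_F_def)
    then show ?thesis using l_repr_independence[of x t F] F x by simp
  qed
  show ?thesis using same[OF D] same[OF E] ne by blast
qed

lemma Union_lcosets_F: "\<Union> lcosets_F = carrier G"
proof
  show "\<Union> lcosets_F \<subseteq> carrier G" using l_coset_subset_G Fc by (auto simp: lcosets_F_def)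
  show "carrier G \<subseteq> \<Union> lcosets_F"
  proof
    fix x assume x: "x \<in> carrier G"
    then have "x \<in> x <# F" using subgroup.one_closed[OF F] r_one by (force simp: l_coset_def)
    then show "x \<in> \<Union> lcosets_F" using x by (auto simp: lcosets_F_def)
  qed
qed

lemma part_at_measure:
  assumes u: "u \<in> carrier Mo" and t: "t \<in> carrier G"
  shows "is_measure (\<lambda>A. mass u (t <# (A \<inter> F)))"
  unfolding is_measure_def
proof (intro allI impI)
  fix A A' assume A: "clopen A" "clopen A'" "A \<inter> A' = {}"
  have m: "is_measure (\<lambda>A. mass u (t <# A))" using measure_translate[OF mass_measure[OF u] t] .
  have "(A \<union> A') \<inter> F = (A \<inter> F) \<union> (A' \<inter> F)" by blast
  moreover have "(A \<inter> F) \<inter> (A' \<inter> F) = {}" using A(3) by blast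
  ultimately show "[mass u (t <# ((A \<union> A') \<inter> F)) = mass u (t <# (A \<inter> F)) + mass u (t <# (A' \<inter> F))] (mod q)"
    using m clopen_Int[OF A(1) clopen_F] clopen_Int[OF A(2) clopen_F] unfolding is_measure_def by simp
qed

lemma part_at_carrier: "u \<in> carrier Mo \<Longrightarrow> t \<in> carrier G \<Longrightarrow> part_at t u \<in> carrier Mo"
  unfolding part_at_def by (intro family_carrier part_at_measure)

lemma mass_part_at: "u \<in> carrier Mo \<Longrightarrow> t \<in> carrier G \<Longrightarrow> clopen A \<Longrightarrow> mass (part_at t u) A = mass u (t <# (A \<inter> F))"
  unfolding part_at_def using mass_family[OF part_at_measure] mass_mod by simp

lemma part_at_on_F: "u \<in> carrier Mo \<Longrightarrow> t \<in> carrier G \<Longrightarrow> part_at t u \<in> on_F"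
proof -
  assume u: "u \<in> carrier Mo" and t: "t \<in> carrier G"
  have "mass (part_at t u) A = 0" if "clopen A" "A \<inter> F = {}" for A
    using mass_part_at[OF u t that(1)] that(2) measure_empty[OF mass_measure[OF u]] mass_mod[of u "{}"]
    by (simp add: l_coset_def cong_def)
  then show ?thesis using part_at_carrier[OF u t] by (simp add: on_F_def)
qed

lemma mass_gact_part_at:
  assumes u: "u \<in> carrier Mo" and t: "t \<in> carrier G" and A: "clopen A"
  shows "mass (gact t (part_at t u)) A = mass u (A \<inter> (t <# F))"
proof -
  have "mass (gact t (part_at t u)) A = mass u (t <# ((inv t <# A) \<inter> F))"
    using mass_gact[OF t part_at_carrier[OF u t] A] mass_part_at[OF u t clopen_translate[OF A inv_closed[OF t]]]
    by simp
  also have "t <# ((inv t <# A) \<inter> F) = (t <# (inv t <# A)) \<inter> (t <# F)"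
    using translate_Int[OF t l_coset_subset_G[OF clopen_carrier[OF A] inv_closed[OF t]] Fc] by simp
  also have "t <# (inv t <# A) = A" using translate_inv_cancel(2)[OF clopen_carrier[OF A] t] .
  finally show ?thesis .
qed

lemma decompose:
  assumes u: "u \<in> carrier Mo"
  shows "u = (\<Oplus>\<^bsub>Mo\<^esub>D\<in>lcosets_F. gact (lrep D) (part_at (lrep D) u))"
proof (rule Mo_eqI[OF u])
  have c: "gact (lrep D) (part_at (lrep D) u) \<in> carrier Mo" if "D \<in> lcosets_F" for D
    using lrep[OF that] u gact_closed part_at_carrier by blast
  then show "(\<Oplus>\<^bsub>Mo\<^esub>D\<in>lcosets_F. gact (lrep D) (part_at (lrep D) u)) \<in> carrier Mo"
    by (intro Mo.finsum_closed) auto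
  fix A assume A: "clopen A"
  have "[mass u (\<Union>D\<in>lcosets_F. A \<inter> D) = (\<Sum>D\<in>lcosets_F. mass u (A \<inter> D))] (mod q)"
  proof (rule measure_UN[OF mass_measure[OF u] finite_lcosets_F])
    fix D assume "D \<in> lcosets_F"
    then have "clopen D" using lrep[of D] clopen_translate[OF clopen_F] by metis
    then show "clopen (A \<inter> D)" using clopen_Int[OF A] by blast
  qed (use lcosets_F_disjoint in blast)
  moreover have "(\<Union>D\<in>lcosets_F. A \<inter> D) = A" using Union_lcosets_F clopen_carrier[OF A] by blast
  moreover have "(\<Sum>D\<in>lcosets_F. mass u (A \<inter> D)) = (\<Sum>D\<in>lcosets_F. mass (gact (lrep D) (part_at (lrep D) u)) A)"
  proof (rule sum.cong)
    fix D assume "D \<in> lcosets_F"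
    then have "lrep D \<in> carrier G" "A \<inter> D = A \<inter> (lrep D <# F)" using lrep[of D] by auto
    then show "mass u (A \<inter> D) = mass (gact (lrep D) (part_at (lrep D) u)) A"
      using mass_gact_part_at[OF u _ A] by simp
  qed simp
  moreover have "[mass (\<Oplus>\<^bsub>Mo\<^esub>D\<in>lcosets_F. gact (lrep D) (part_at (lrep D) u)) A
     = (\<Sum>D\<in>lcosets_F. mass (gact (lrep D) (part_at (lrep D) u)) A)] (mod q)"
    by (rule mass_finsum[OF c A])
  ultimately show "[mass u A = mass (\<Oplus>\<^bsub>Mo\<^esub>D\<in>lcosets_F. gact (lrep D) (part_at (lrep D) u)) A] (mod q)"
    by (simp add: cong_def)
qed

lemma ex_independent:
  assumes Z: "finite Z" "Z \<subseteq> carrier Mo"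
  obtains X where "finite X" "X \<subseteq> carrier Mo" "Z \<subseteq> span (carrier R) X" "independent (carrier R) X"
proof -
  let ?Y = "(\<lambda>(u, D). part_at (lrep D) u) ` (Z \<times> lcosets_F)"
  have "finite ?Y" using Z(1) finite_lcosets_F by blast
  moreover have "?Y \<subseteq> on_F" using Z(2) lrep part_at_on_F by auto
  ultimately obtain X where X: "finite X" "X \<subseteq> on_F" "?Y \<subseteq> span (ring_on F) X" "independent (ring_on F) X"
    by (rule ex_independent_over_F)
  have Xc: "X \<subseteq> carrier Mo" using X(2) by (auto simp: on_F_def)
  have "span (ring_on F) X \<subseteq> span (carrier R) X" unfolding span_def by (rule image_mono) (auto simp: ring_on_def)
  then have Y: "?Y \<subseteq> span (carrier R) X" using X(3) by blast
  have addR: "additive_coeffs (carrier R)" using subring_coeffs_R by (simp add: subring_coeffs_def)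
  have "u \<in> span (carrier R) X" if u: "u \<in> Z" for u
  proof -
    have "gact (lrep D) (part_at (lrep D) u) \<in> span (carrier R) X" if "D \<in> lcosets_F" for D
      unfolding gact_def
    proof (rule span_smult[OF subring_coeffs_R Xc])
      show "delta (lrep D) \<in> carrier R" using lrep[OF that] delta_R by blast
      show "part_at (lrep D) u \<in> span (carrier R) X" using Y u that by blast
    qed
    then have "(\<Oplus>\<^bsub>Mo\<^esub>D\<in>lcosets_F. gact (lrep D) (part_at (lrep D) u)) \<in> span (carrier R) X"
      by (rule finsum_in_subgroup[OF span_subgroup[OF addR Xc]])
    moreover have "u \<in> carrier Mo" using u Z(2) by blast
    ultimately show ?thesis by (simp only: decompose[symmetric])
  qed
  then show ?thesis using that[OF X(1) Xc _ independent_F_imp_independent[OF X(1,2,4)]] by blast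
qed

lemma finsum_restrict_carrier:
  assumes U: "additive_subgroup U Mo" and f: "\<And>i. i \<in> I \<Longrightarrow> f i \<in> U" and I: "finite I"
    and ab: "abelian_group (Mo\<lparr>carrier := U\<rparr>)"
  shows "finsum (Mo\<lparr>carrier := U\<rparr>) f I = finsum Mo f I"
proof -
  interpret U: abelian_group "Mo\<lparr>carrier := U\<rparr>" by (rule ab)
  have Uc: "U \<subseteq> carrier Mo" using additive_subgroup.a_subset[OF U] .
  from I f show ?thesis
  proof (induct I rule: finite_induct)
    case empty
    have "finsum (Mo\<lparr>carrier := U\<rparr>) f {} = \<zero>\<^bsub>Mo\<lparr>carrier := U\<rparr>\<^esub>" by (rule U.finsum_empty)
    then show ?case by simp
  next
    case (insert i I)
    have "finsum (Mo\<lparr>carrier := U\<rparr>) f (insert i I) = f i \<oplus>\<^bsub>Mo\<lparr>carrier := U\<rparr>\<^esub> finsum (Mo\<lparr>carrier := U\<rparr>) f I"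
      using insert by (intro U.finsum_insert) auto
    moreover have "finsum Mo f (insert i I) = f i \<boxplus> finsum Mo f I"
      using insert Uc by (intro Mo.finsum_insert) auto
    ultimately show ?case using insert by simp
  qed
qed

text \<open>The basis criterion uses sums over the support of the coefficients only, \<open>comb\<close> sums over all of \<open>X\<close>.\<close>

lemma span_free:
  assumes X: "finite X" "X \<subseteq> carrier Mo" and ind: "independent (carrier R) X"
  shows "submodule (span (carrier R) X) R Mo \<and> free_left_module R (Mo\<lparr>carrier := span (carrier R) X\<rparr>)"
proof -
  let ?U = "span (carrier R) X"
  let ?MU = "Mo\<lparr>carrier := ?U\<rparr>"
  have addR: "additive_coeffs (carrier R)" using subring_coeffs_R by (simp add: subring_coeffs_def)
  have U: "additive_subgroup ?U Mo" using span_subgroup[OF addR X(2)] .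
  interpret U: additive_subgroup ?U Mo by (rule U)
  have sm: "f \<bullet> u \<in> ?U" if "f \<in> carrier R" "u \<in> ?U" for f u
    using span_smult[OF subring_coeffs_R X(2) that] .
  have sub: "submodule ?U R Mo"
    by (intro submodule.intro U.a_subgroup submodule_axioms.intro sm)
  have Uc: "u \<in> carrier Mo" if "u \<in> ?U" for u using that U.a_subset by blast
  have ab: "abelian_group ?MU"
  proof (rule abelian_groupI)
    fix u assume u: "u \<in> carrier ?MU"
    show "\<exists>v\<in>carrier ?MU. v \<oplus>\<^bsub>?MU\<^esub> u = \<zero>\<^bsub>?MU\<^esub>"
      using u Uc by (auto intro!: bexI[of _ "\<ominus>\<^bsub>Mo\<^esub> u"] simp: Mo.l_neg)
  qed (use Uc in \<open>auto simp: Mo.a_ac\<close>)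
  have lm: "left_module R ?MU"
  proof (intro left_module.intro ring_R ab left_module_axioms.intro)
  qed (use Uc sm LM.smult_l_distr LM.smult_r_distr LM.smult_assoc LM.smult_one in auto)
  have "left_module_basis R ?MU X" unfolding left_module_basis_def
  proof (intro conjI ballI)
    show "X \<subseteq> carrier ?MU" using span_base[OF addR one_R X(2,1)] by auto
    fix u assume "u \<in> carrier ?MU"
    then obtain c where c: "c \<in> X \<rightarrow> carrier R" "u = comb c X" by (auto simp: span_def)
    have XU: "b \<in> ?U" if "b \<in> X" for b using span_base[OF addR one_R X(2,1) that] .
    have expand: "(\<Oplus>\<^bsub>?MU\<^esub>b\<in>{b \<in> X. d b \<noteq> \<zero>\<^bsub>R\<^esub>}. d b \<odot>\<^bsub>?MU\<^esub> b) = comb d X"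
      if d: "d \<in> X \<rightarrow> carrier R" for d
    proof -
      have "(\<Oplus>\<^bsub>?MU\<^esub>b\<in>{b \<in> X. d b \<noteq> \<zero>\<^bsub>R\<^esub>}. d b \<odot>\<^bsub>?MU\<^esub> b) = (\<Oplus>\<^bsub>?MU\<^esub>b\<in>{b \<in> X. d b \<noteq> \<zero>\<^bsub>R\<^esub>}. d b \<bullet> b)"
        by simp
      also have "\<dots> = (\<Oplus>\<^bsub>Mo\<^esub>b\<in>{b \<in> X. d b \<noteq> \<zero>\<^bsub>R\<^esub>}. d b \<bullet> b)"
        using d X(1) XU by (intro finsum_restrict_carrier[OF U _ _ ab] sm) auto
      also have "\<dots> = comb d X"
        using X d smult_l_zero Mo_smult_closed
        by (intro Mo.add.finprod_mono_neutral_cong_left) (auto simp: Pi_iff subset_iff)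
      finally show ?thesis .
    qed
    show "\<exists>!c. c \<in> X \<rightarrow>\<^sub>E carrier R \<and> finite {b \<in> X. c b \<noteq> \<zero>\<^bsub>R\<^esub>} \<and>
        u = (\<Oplus>\<^bsub>?MU\<^esub>b\<in>{b \<in> X. c b \<noteq> \<zero>\<^bsub>R\<^esub>}. c b \<odot>\<^bsub>?MU\<^esub> b)"
    proof (rule ex_ex1I)
      let ?c = "restrict c X"
      have cE: "?c \<in> X \<rightarrow>\<^sub>E carrier R" using c(1) by auto
      have "comb ?c X = u" unfolding c(2)
        using comb_term_closed[OF order_refl X(2) c(1)] by (intro Mo.finsum_cong') auto
      moreover have "?c \<in> X \<rightarrow> carrier R" using c(1) by auto
      ultimately have "u = (\<Oplus>\<^bsub>?MU\<^esub>b\<in>{b \<in> X. ?c b \<noteq> \<zero>\<^bsub>R\<^esub>}. ?c b \<odot>\<^bsub>?MU\<^esub> b)"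
        using expand[of ?c] by simp
      then show "\<exists>c. c \<in> X \<rightarrow>\<^sub>E carrier R \<and> finite {b \<in> X. c b \<noteq> \<zero>\<^bsub>R\<^esub>} \<and>
        u = (\<Oplus>\<^bsub>?MU\<^esub>b\<in>{b \<in> X. c b \<noteq> \<zero>\<^bsub>R\<^esub>}. c b \<odot>\<^bsub>?MU\<^esub> b)" using cE X(1) by (intro exI[of _ ?c]) simp
    next
      fix d e
      assume d: "d \<in> X \<rightarrow>\<^sub>E carrier R \<and> finite {b \<in> X. d b \<noteq> \<zero>\<^bsub>R\<^esub>} \<and>
        u = (\<Oplus>\<^bsub>?MU\<^esub>b\<in>{b \<in> X. d b \<noteq> \<zero>\<^bsub>R\<^esub>}. d b \<odot>\<^bsub>?MU\<^esub> b)"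
        and e: "e \<in> X \<rightarrow>\<^sub>E carrier R \<and> finite {b \<in> X. e b \<noteq> \<zero>\<^bsub>R\<^esub>} \<and>
        u = (\<Oplus>\<^bsub>?MU\<^esub>b\<in>{b \<in> X. e b \<noteq> \<zero>\<^bsub>R\<^esub>}. e b \<odot>\<^bsub>?MU\<^esub> b)"
      interpret R: ring R by (rule ring_R)
      have dP: "d \<in> X \<rightarrow> carrier R" and eP: "e \<in> X \<rightarrow> carrier R" using d e by auto
      have ud: "u = comb d X" using d unfolding expand[OF dP] by blast
      have ue: "u = comb e X" using e unfolding expand[OF eP] by blast
      define f where "f b = d b \<ominus>\<^bsub>R\<^esub> e b" for b
      have fP: "f \<in> X \<rightarrow> carrier R" using dP eP ring.ring_simprules(4)[OF ring_R] by (auto simp: f_def Pi_iff)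
      have fe: "f b \<oplus>\<^bsub>R\<^esub> e b = d b" if "b \<in> X" for b
      proof -
        have "d b \<in> carrier R" "e b \<in> carrier R" using dP eP that by auto
        then show ?thesis unfolding f_def using ring_R
          by (metis LM.R.minus_eq LM.R.a_assoc LM.R.a_inv_closed LM.R.l_neg LM.R.r_zero)
      qed
      have uc: "u \<in> carrier Mo" unfolding ud using comb_term_closed[OF order_refl X(2) dP] by (intro Mo.finsum_closed) auto
      have fc: "comb f X \<in> carrier Mo"
        using comb_term_closed[OF order_refl X(2) fP] by (intro Mo.finsum_closed) auto
      have "(\<Oplus>\<^bsub>Mo\<^esub>b\<in>X. (f b \<oplus>\<^bsub>R\<^esub> e b) \<bullet> b) = u" unfolding ud
        using comb_term_closed[OF order_refl X(2) dP] fe by (intro Mo.finsum_cong') auto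
      then have "comb f X \<boxplus> u = u"
        using comb_add[OF order_refl X(2) fP eP] ue by simp
      then have "comb f X = \<zero>\<^bsub>Mo\<^esub>" using uc fc by simp
      then have f0: "f b = \<zero>\<^bsub>R\<^esub>" if "b \<in> X" for b using ind fP that unfolding independent_def by blast
      have de: "d b = e b" if "b \<in> X" for b
        using fe[OF that] f0[OF that] eP that by (auto simp: Pi_iff)
      show "d = e" by (rule PiE_ext[of d X "\<lambda>_. carrier R" e]) (use d e de in auto)
    qed
  qed
  then show ?thesis using sub lm by (auto simp: free_left_module_def)
qed

lemma direct_union: "direct_union_of_free_left_modules R Mo"
  unfolding direct_union_of_free_left_modules_def
proof (intro conjI)
  show "left_module R Mo" by (rule left_module_Mo)
  let ?\<U> = "{span (carrier R) X | X. finite X \<and> X \<subseteq> carrier Mo \<and> independent (carrier R) X}"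
  have sp: "span (carrier R) X \<subseteq> span (carrier R) Y" if "X \<subseteq> span (carrier R) Y" "Y \<subseteq> carrier Mo" for X Y
    using span_trans[OF subring_coeffs_R that(2,1)] .
  show "\<exists>\<U>. \<U> \<noteq> {} \<and>
     (\<forall>U\<in>\<U>. submodule U R Mo \<and> free_left_module R (Mo\<lparr>carrier := U\<rparr>)) \<and>
     (\<forall>U\<in>\<U>. \<forall>V\<in>\<U>. \<exists>W\<in>\<U>. U \<subseteq> W \<and> V \<subseteq> W) \<and> \<Union>\<U> = carrier Mo"
  proof (intro exI[of _ ?\<U>] conjI ballI)
    obtain X where "finite X" "X \<subseteq> carrier Mo" "{} \<subseteq> span (carrier R) X" "independent (carrier R) X"
      by (rule ex_independent[of "{}"]) auto
    then show "?\<U> \<noteq> {}" by blast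
    fix U assume "U \<in> ?\<U>"
    then obtain X where X: "finite X" "X \<subseteq> carrier Mo" "independent (carrier R) X" "U = span (carrier R) X" by blast
    then show "submodule U R Mo" "free_left_module R (Mo\<lparr>carrier := U\<rparr>)" using span_free by auto
    fix V assume "V \<in> ?\<U>"
    then obtain Y where Y: "finite Y" "Y \<subseteq> carrier Mo" "V = span (carrier R) Y" by blast
    have "finite (X \<union> Y)" "X \<union> Y \<subseteq> carrier Mo" using X Y by auto
    then obtain Z where Z: "finite Z" "Z \<subseteq> carrier Mo" "X \<union> Y \<subseteq> span (carrier R) Z" "independent (carrier R) Z"
      by (rule ex_independent)
    then show "\<exists>W\<in>?\<U>. U \<subseteq> W \<and> V \<subseteq> W"
      using sp[of X Z] sp[of Y Z] X(4) Y(3) by (intro bexI[of _ "span (carrier R) Z"]) auto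
  next
    show "\<Union>?\<U> = carrier Mo"
    proof
      show "\<Union>?\<U> \<subseteq> carrier Mo" using span_carrier[OF order_refl] by blast
      show "carrier Mo \<subseteq> \<Union>?\<U>"
      proof
        fix u assume u: "u \<in> carrier Mo"
        obtain X where "finite X" "X \<subseteq> carrier Mo" "{u} \<subseteq> span (carrier R) X" "independent (carrier R) X"
          by (rule ex_independent[of "{u}"]) (use u in auto)
        then show "u \<in> \<Union>?\<U>" by blast
      qed
    qed
  qed
qed

end

lemma virtually_free_group_locale:
  assumes G: "group G" and vf: "virtually_free_group G" and p: "prime p"
  obtains F B where "virtually_free G p F B"
proof -
  interpret group G by (rule G)
  obtain F where F: "subgroup F G" "finite (rcosets\<^bsub>G\<^esub> F)" "free_group (G\<lparr>carrier := F\<rparr>)"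
    using vf by (auto simp: virtually_free_group_def)
  obtain B where B: "B \<subseteq> F" "bij_betw (eval_word (G\<lparr>carrier := F\<rparr>)) (reduced_words B) F"
    using F(3) by (auto simp: free_group_def freely_generates_def)
  have eq: "eval_word (G\<lparr>carrier := F\<rparr>) w = eval_word G w" if "w \<in> reduced_words B" for w
    using that
  proof (induct w)
    case (Cons s w)
    have s: "fst s \<in> F" "w \<in> reduced_words B" using reduced_words_ConsD[OF Cons(2)] B(1) by auto
    then show ?case using Cons(1) m_inv_consistent[OF F(1) s(1)]
      by (cases s) (simp add: eval_word_def)
  qed (simp add: eval_word_def)
  have "bij_betw (eval_word G) (reduced_words B) F"
    using B(2) by (rule bij_betw_cong[THEN iffD1, rotated]) (rule eq)
  then have "virtually_free G p F B"
    using F B(1) p G by (intro virtually_free.intro mod_p_group_ring.intro mod_p_group_ring_axioms.intro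
        free_basis.intro free_basis_axioms.intro virtually_free_axioms.intro)
  then show ?thesis by (rule that)
qed

theorem corollary5p6:
  fixes p :: nat and G :: "('a, 'b) monoid_scheme"
  assumes "prime p"
    and "group G"
    and "finitely_generated_group G"
    and "virtually_free_group G"
  shows "\<exists>M :: ('a \<Rightarrow> int, 'a set \<Rightarrow> 'a set \<Rightarrow> int) module.
    direct_union_of_free_left_modules (group_ring (residue_ring (int p)) G) M \<and>
    left_module_isomorphic (group_ring (residue_ring (int p)) G)
      (completed_group_ring_module (residue_ring (int p)) G) M"
proof -
  obtain F B where "virtually_free G p F B"
    using virtually_free_group_locale[OF assms(2,4,1)] .
  then have "direct_union_of_free_left_modules (group_ring (residue_ring (int p)) G)
      (completed_group_ring_module (residue_ring (int p)) G)"
    by (rule virtually_free.direct_union)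
  moreover have "left_module_isomorphic (group_ring (residue_ring (int p)) G)
      (completed_group_ring_module (residue_ring (int p)) G)
      (completed_group_ring_module (residue_ring (int p)) G)"
    unfolding left_module_isomorphic_def by (intro exI[of _ id]) auto
  ultimately show ?thesis by blast
qed

end
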